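(* Suppose the assumptions on $f$ stated in the context hold. Fix $x_0$, $y_{-1}$. There exist positive constants $\xi,\theta$ independent of $\epsilon$ such that, for any given target accuracy $\epsilon>0$, if $\{x_t\}$ is the sequence generated by the GRTR algorithm (see context) with $$\sigma=\frac{\sqrt{L_2}}{2},\quad r=\frac{1}{4\sqrt{L_2}},\quad \epsilon_1=\min\Big\{\frac1{96},\frac{\sqrt{L_2}}{16L_1}\Big\}\epsilon^{3/2},\quad \epsilon_2=\frac{\sqrt{L_2}}{12}\epsilon^{1/2},$$ and with $\eta_y=1/\ell$, momentum parameter $\theta_y=\frac{\sqrt\kappa-1}{\sqrt\kappa+1}$, and $$N_0\ge 2\sqrt\kappa\ln\frac{\sqrt{\kappa+1}\,\|y_{-1}-y^*(x_0)\|}{A},\qquad N_t\ge 2\sqrt\kappa\ln\frac{\sqrt{\kappa+1}\,(A+\kappa\|s_{t-1}\|)}{A}\ (t\ge1),\qquad A=\min\{\epsilon_1/\ell,\ \epsilon_2/(2L_H)\},$$ then $T(\epsilon):=\min\{t:\ \|\nabla P(x_t)\|\le\xi\epsilon\ \text{and}\ \nabla^2P(x_t)\succeq-\theta\sqrt\epsilon I\}$ satisfies $$T(\epsilon)\le 128\big(\lceil\ln(G/\epsilon)/\ln 3\rceil+1\big)\sqrt{L_2}\,(P(x_0)-P^* )\,\epsilon^{-3/2}+1 ,$$ and the total number of gradient ascent steps satisfies $$\sum_{t=0}^{T(\epsilon)}N_t\le 2\sqrt\kappa\,\ln\frac{\sqrt{\kappa+1}\,\|y_{-1}-y^*(x_0)\|}{A}+2\sqrt\kappa\,T(\epsilon)\,\ln\frac{\sqrt{\kappa+1}\,(A+\kappa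 r\sqrt G)}{A},$$ where $G=\max\big\{2+\frac{L_1}{4\sqrt{L_2}}C^{1/2}+C,\ 2+\frac{L_1}{4\sqrt{L_2}}\big\}$ and $C=\big(128\sqrt{L_2}(P(x_0)-P^* )\big)^{2/3}$.
   Context: Setting. $f:\mathbb{R}^n\times\mathbb{R}^m\to\mathbb{R}$ is continuously differentiable and, for every $x$, $f(x,\cdot)$ is $\mu$-strongly concave ($\mu>0$). Assumptions: (i) $\|\nabla f(x,y)-\nabla f(x',y')\|\le\ell\|(x,y)-(x',y')\|$ for all $(x,y),(x',y')$; (ii) the second-order partial derivative matrices $\nabla^2_{xx}f,\nabla^2_{xy}f,\nabla^2_{yx}f,\nabla^2_{yy}f$ are $\rho$-Lipschitz continuous; (iii) $P(x)=\max_{y\in\mathbb{R}^m}f(x,y)$ is bounded below by a constant $P^*$. $\|\cdot\|$ is the Euclidean norm of vectors and the spectral norm of matrices. Notation. $y^*(x)=\arg\max_{y}f(x,y)$; $\kappa=\ell/\mu$; $L_1=(\kappa+1)\ell$; $L_2=\rho(1+\kappa)^3$; $L_H=\rho(1+\kappa)^2$; $H(x,y)=[\nabla^2_{xx}f-\nabla^2_{xy}f(\nabla^2_{yy}f)^{-1}\nabla^2_{yx}f](x,y)$. GRTR algorithm. Input $x_0,y_{-1}$ and parameters $\eta_y,\theta_y$ (momentum), $\sigma,r,N_t,\epsilon$. For $t=0,1,2,\dots$: (1) set $y^t_0=\tilde y^t_0=y_{t-1}$; for $k=0,\dots,N_t-1$ set $y^t_{k+1}=\tilde y^t_k+\eta_y\nabla_yf(x_t,\tilde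 y^t_k)$ and $\tilde y^t_{k+1}=y^t_{k+1}+\theta_y(y^t_{k+1}-y^t_k)$; set $y_t=y^t_{N_t}$. (2) Set $g_t=\nabla_xf(x_t,y_t)$, $H_t=H(x_t,y_t)$. (3) Let $s_t$ be a (global) solution of $\min_{\|s\|\le r\max\{\|g_t\|^{1/2},\epsilon^{1/2}\}} g_t^\top s+\frac12s^\top(H_t+\sigma\|g_t\|^{1/2}I)s$. (4) Set $x_{t+1}=x_t+s_t$.
   Formalization: The bound on the sum of N_t fails for arbitrarily large N_t (and at T=0 by rounding), so it is proved with the total excess of N_t over the required lower bounds added, and as stated when each N_t (t≤T) is the least admissible natural number and T≥1; ρ>0 is assumed so that r is defined. *)

theory Defs
  imports "HOL-Analysis.Analysis"
begin

definition grad :: "('a::real_inner \<Rightarrow> real) \<Rightarrow> 'a \<Rightarrow> 'a" where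
  "grad F x = (THE D. GDERIV F x :> D)"

definition grad_x :: "('a::real_inner \<times> 'b::real_inner \<Rightarrow> real) \<Rightarrow> 'a \<times> 'b \<Rightarrow> 'a" where
  "grad_x f z = grad (\<lambda>u. f (u, snd z)) (fst z)"

definition grad_y :: "('a::real_inner \<times> 'b::real_inner \<Rightarrow> real) \<Rightarrow> 'a \<times> 'b \<Rightarrow> 'b" where
  "grad_y f z = grad (\<lambda>v. f (fst z, v)) (snd z)"

text \<open>The blocks follow the convention that the first index labels rows: the \<open>(i, j)\<close> entry of
  \<open>hess_xy\<close> is the second derivative in \<open>x\<^sub>i\<close> and \<open>y\<^sub>j\<close>, so it is the Jacobian in \<open>y\<close> of the
  \<open>x\<close>-gradient.\<close>

definition hess_xx :: "((real^'n) \<times> (real^'m) \<Rightarrow> real) \<Rightarrow> (real^'n) \<times> (real^'m) \<Rightarrow> real^'n^'n" where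
  "hess_xx f z = jacobian (\<lambda>u. grad_x f (u, snd z)) (at (fst z))"

definition hess_xy :: "((real^'n) \<times> (real^'m) \<Rightarrow> real) \<Rightarrow> (real^'n) \<times> (real^'m) \<Rightarrow> real^'m^'n" where
  "hess_xy f z = jacobian (\<lambda>v. grad_x f (fst z, v)) (at (snd z))"

definition hess_yx :: "((real^'n) \<times> (real^'m) \<Rightarrow> real) \<Rightarrow> (real^'n) \<times> (real^'m) \<Rightarrow> real^'n^'m" where
  "hess_yx f z = jacobian (\<lambda>u. grad_y f (u, snd z)) (at (fst z))"

definition hess_yy :: "((real^'n) \<times> (real^'m) \<Rightarrow> real) \<Rightarrow> (real^'n) \<times> (real^'m) \<Rightarrow> real^'m^'m" where
  "hess_yy f z = jacobian (\<lambda>v. grad_y f (fst z, v)) (at (snd z))"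

definition hess_blocks_exist :: "((real^'n) \<times> (real^'m) \<Rightarrow> real) \<Rightarrow> bool" where
  "hess_blocks_exist f \<longleftrightarrow> (\<forall>x y.
     (\<lambda>u. grad_x f (u, y)) differentiable (at x) \<and>
     (\<lambda>v. grad_x f (x, v)) differentiable (at y) \<and>
     (\<lambda>u. grad_y f (u, y)) differentiable (at x) \<and>
     (\<lambda>v. grad_y f (x, v)) differentiable (at y))"

definition hessian :: "(real^'n \<Rightarrow> real) \<Rightarrow> real^'n \<Rightarrow> real^'n^'n" where
  "hessian F x = jacobian (grad F) (at x)"

definition spectral_norm :: "real^'n^'m \<Rightarrow> real" where
  "spectral_norm A = onorm ((*v) A)"

text \<open>The distance on \<^typ>\<open>real^'n^'m\<close> is the Frobenius one, so \<^const>\<open>lipschitz_on\<close> would not refer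
  to the spectral norm.\<close>

definition spectral_lipschitz :: "real \<Rightarrow> ('a::real_normed_vector \<Rightarrow> real^'n^'m) \<Rightarrow> bool" where
  "spectral_lipschitz L M \<longleftrightarrow> (\<forall>z z'. spectral_norm (M z - M z') \<le> L * norm (z - z'))"

definition loewner_le :: "real^'n^'n \<Rightarrow> real^'n^'n \<Rightarrow> bool" where
  "loewner_le A B \<longleftrightarrow>
     transpose (B - A) = B - A \<and> (\<forall>v. 0 \<le> v \<bullet> ((B - A) *v v))"

definition strongly_concave :: "real \<Rightarrow> ('a::real_inner \<Rightarrow> real) \<Rightarrow> bool" where
  "strongly_concave \<mu> g \<longleftrightarrow> (\<forall>u v. \<forall>t\<in>{0..1}.
     t * g u + (1 - t) * g v + \<mu> / 2 * t * (1 - t) * (norm (u - v))\<^sup>2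
       \<le> g (t *\<^sub>R u + (1 - t) *\<^sub>R v))"

definition y_star :: "('a \<times> 'b \<Rightarrow> real) \<Rightarrow> 'a \<Rightarrow> 'b" where
  "y_star f x = arg_max (\<lambda>y. f (x, y)) (\<lambda>_. True)"

text \<open>For \<open>f (x, \<cdot>)\<close> continuous and strongly concave on a Euclidean space the supremum is a maximum.\<close>

definition primal :: "('a \<times> 'b \<Rightarrow> real) \<Rightarrow> 'a \<Rightarrow> real" where
  "primal f x = (SUP y. f (x, y))"

definition schur_H :: "((real^'n) \<times> (real^'m) \<Rightarrow> real) \<Rightarrow> (real^'n) \<times> (real^'m) \<Rightarrow> real^'n^'n" where
  "schur_H f z = hess_xx f z - hess_xy f z ** matrix_inv (hess_yy f z) ** hess_yx f z"

text \<open>The pair \<open>(y\<^sub>k, \<tilde>y\<^sub>k)\<close> of the accelerated gradient ascent at a fixed \<open>x\<close>.\<close>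

primrec nag :: "('a::real_inner \<times> 'b::real_inner \<Rightarrow> real) \<Rightarrow> real \<Rightarrow> real \<Rightarrow> 'a \<Rightarrow> 'b \<Rightarrow> nat \<Rightarrow> 'b \<times> 'b" where
  "nag f \<eta>y \<theta>y x y0 0 = (y0, y0)"
| "nag f \<eta>y \<theta>y x y0 (Suc k) =
     (let (y, yt) = nag f \<eta>y \<theta>y x y0 k;
          y' = yt + \<eta>y *\<^sub>R grad_y f (x, yt)
      in (y', y' + \<theta>y *\<^sub>R (y' - y)))"

text \<open>The trust-region solutions \<open>s t\<close> need not be unique, so a run is a relation between the input and
  the generated sequences.  The sequence \<open>y\<close> starts at index \<open>0\<close>; \<open>y\<^sub>-\<^sub>1\<close> is the separate argument
  \<open>yinit\<close>.\<close>

definition grtr_run ::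
  "((real^'n) \<times> (real^'m) \<Rightarrow> real) \<Rightarrow> real^'n \<Rightarrow> real^'m \<Rightarrow> real \<Rightarrow> real \<Rightarrow> real \<Rightarrow> real \<Rightarrow> real \<Rightarrow>
   (nat \<Rightarrow> nat) \<Rightarrow> (nat \<Rightarrow> real^'n) \<Rightarrow> (nat \<Rightarrow> real^'m) \<Rightarrow> (nat \<Rightarrow> real^'n) \<Rightarrow> bool" where
  "grtr_run f x0 yinit \<eta>y \<theta>y \<sigma> r \<epsilon> N x y s \<longleftrightarrow>
     x 0 = x0 \<and>
     (\<forall>t. y t = fst (nag f \<eta>y \<theta>y (x t) (case t of 0 \<Rightarrow> yinit | Suc t' \<Rightarrow> y t') (N t))) \<and>
     (\<forall>t. let g = grad_x f (x t, y t);
              H = schur_H f (x t, y t)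
          in is_arg_min
               (\<lambda>d. g \<bullet> d + 1/2 * (d \<bullet> ((H + mat (\<sigma> * sqrt (norm g))) *v d)))
               (\<lambda>d. norm d \<le> r * max (sqrt (norm g)) (sqrt \<epsilon>))
               (s t)) \<and>
     (\<forall>t. x (Suc t) = x t + s t)"

definition approx_second_order ::
  "(real^'n \<Rightarrow> real) \<Rightarrow> real \<Rightarrow> real \<Rightarrow> real \<Rightarrow> real^'n \<Rightarrow> bool" where
  "approx_second_order F \<xi> \<theta> \<epsilon> x \<longleftrightarrow>
     norm (grad F x) \<le> \<xi> * \<epsilon> \<and> loewner_le (mat (- (\<theta> * sqrt \<epsilon>))) (hessian F x)"

end

theory Submission
  imports Defs
begin

text \<open>Nesterov's method keeps \<open>y\<^sub>t\<close> within \<open>A\<close> of the maximizer, so \<open>g\<^sub>t\<close> and \<open>H\<^sub>t\<close> are close to the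
  gradient and the Hessian of \<open>P\<close> at \<open>x\<^sub>t\<close>.  The optimality conditions of the trust-region problem then show
  that at a nonstationary iterate either \<open>P\<close> drops by at least \<open>\<epsilon>\<^bsup>3/2\<^esup> / (128 sqrt L\<^sub>2)\<close> or the gradient shrinks by a
  factor \<open>3\<close> while \<open>P\<close> does not increase.  The first kind of step is limited by \<open>P x\<^sub>0 - Pstar\<close>; between two such
  steps the second kind occurs at most logarithmically often, because gradients stay below \<open>G\<close>.

  Since \<open>\<xi>\<close> and \<open>\<theta>\<close> may depend on everything but \<open>\<epsilon>\<close>, they are chosen so large that \<open>x\<^sub>0\<close> is stationary unless
  \<open>\<epsilon>\<close> is small.  For small \<open>\<epsilon>\<close> the actual gradients are below \<open>G / 8\<close>, and this slack absorbs the rounding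
  of the inner iteration counts.\<close>

section \<open>Gradients\<close>

text \<open>The gradient that shrinks by a factor 3 is the computed one,
  \<open>grad_x f (x t, y t)\<close>, so the inexactness of consecutive iterates never accumulates.
  Global optimality of \<open>s t\<close> yields a multiplier for which the shifted model Hessian is
  positive semidefinite in every direction. If the multiplier is negligible, the curvature is
  certified or the gradient shrinks; otherwise the step reaches the boundary and
  \<open>primal f\<close> drops. The Hessian of \<open>primal f\<close> is obtained by
  differentiating \<open>grad_y f (x, y_star f x) = 0\<close>, which requires joint
  differentiability of the gradient, here derived from the separate blocks.\<close>

lemma gderiv_imp_grad: 
  assumes "GDERIV F x :> D" shows "grad F x = D"
  unfolding grad_def
proof (rule the_equality)
  fix E assume "GDERIV F x :> E"
  with assms have "(\<lambda>h. h \<bullet> E) = (\<lambda>h. h \<bullet> D)"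
    unfolding gderiv_def using has_derivative_unique by blast
  then have "(E - D) \<bullet> (E - D) = 0"
    by (metis inner_diff_right right_minus_eq)
  then show "E = D" by simp
qed (rule assms)

lemma differentiable_imp_gderiv_grad:
  fixes F :: "'a::euclidean_space \<Rightarrow> real"
  assumes "F differentiable (at x)"
  shows "GDERIV F x :> grad F x"
proof -
  obtain F' where F': "(F has_derivative F') (at x)"
    using assms by (auto simp: differentiable_def)
  interpret F': linear F' using F' by (rule has_derivative_linear)
  \<comment> \<open>Riesz representation in coordinates: the values of \<open>F'\<close> on the
    basis are the components of the gradient.\<close>
  have "F' h = h \<bullet> (\<Sum>b\<in>Basis. F' b *\<^sub>R b)" for h
  proof -
    have "F' h = F' (\<Sum>b\<in>Basis. (h \<bullet> b) *\<^sub>R b)" by (simp add: euclidean_representation)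
    then show ?thesis by (simp add: F'.sum F'.scaleR inner_sum_right mult.commute)
  qed
  then have "F' = (\<lambda>h. h \<bullet> (\<Sum>b\<in>Basis. F' b *\<^sub>R b))" by blast
  with F' have "GDERIV F x :> (\<Sum>b\<in>Basis. F' b *\<^sub>R b)"
    unfolding gderiv_def by simp
  then show ?thesis using gderiv_imp_grad by metis
qed

text \<open>Taylor remainders without integrals: the mean value inequality compares
  \<open>\<phi> \<tau> - \<tau> *\<^sub>R d\<close> with a primitive of
  \<open>c * \<tau> ^ k\<close>. Used with \<open>k = 0\<close> for symmetry of second derivatives,
  \<open>k = 1\<close> for quadratic remainders and \<open>k = 2\<close> for the cubic remainder of
  \<open>primal f\<close>.\<close>

lemma vector_derivative_power_remainder_bound:
  fixes \<phi> :: "real \<Rightarrow> 'a::real_normed_vector"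
  assumes der: "\<And>\<tau>. (\<phi> has_vector_derivative \<phi>' \<tau>) (at \<tau>)"
    and bnd: "\<And>\<tau>. 0 < \<tau> \<Longrightarrow> \<tau> < 1 \<Longrightarrow> norm (\<phi>' \<tau> - d) \<le> c * \<tau> ^ k"
  shows "norm (\<phi> 1 - \<phi> 0 - d) \<le> c / (real k + 1)"
proof -
  define f where "f = (\<lambda>\<tau>. \<phi> \<tau> - \<tau> *\<^sub>R d)"
  define p where "p = (\<lambda>\<tau>::real. c * \<tau> ^ Suc k / (real k + 1))"
  have f': "(f has_vector_derivative (\<phi>' \<tau> - d)) (at \<tau>)" for \<tau>
    unfolding f_def by (auto intro!: derivative_eq_intros der)
  have p': "(p has_vector_derivative (c * \<tau> ^ k)) (at \<tau>)" for \<tau>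
  proof -
    have "(p has_real_derivative (c * \<tau> ^ k)) (at \<tau>)"
      unfolding p_def using DERIV_cdivide[OF DERIV_cmult[OF DERIV_pow[of "Suc k"]], of c "real k + 1"]
      by (simp add: add.commute)
    then show ?thesis by (simp add: has_real_derivative_iff_has_vector_derivative)
  qed
  have "norm (f 1 - f 0) \<le> p 1 - p 0"
  proof (rule differentiable_bound_general[OF _ _ _ f' p' bnd])
    show "continuous_on {0..1} f" "continuous_on {0..1} p"
      using f' p' by (meson continuous_at_imp_continuous_on has_vector_derivative_continuous)+
  qed auto
  then show ?thesis by (simp add: f_def p_def algebra_simps)
qed

lemma gderiv_line:
  assumes "\<And>z. GDERIV F z :> G z"
  shows "((\<lambda>\<tau>. F (x + \<tau> *\<^sub>R h)) has_vector_derivative h \<bullet> G (x + \<tau> *\<^sub>R h)) (at \<tau>)"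
proof -
  have "((\<lambda>\<tau>. F (x + \<tau> *\<^sub>R h)) has_derivative (\<lambda>t. (t *\<^sub>R h) \<bullet> G (x + \<tau> *\<^sub>R h))) (at \<tau>)"
    by (rule has_derivative_compose[where f = "\<lambda>\<tau>. x + \<tau> *\<^sub>R h" and g = F])
      (auto intro!: derivative_eq_intros assms[unfolded gderiv_def])
  then show ?thesis by (simp add: has_vector_derivative_def)
qed

text \<open>Two-sided descent lemma: along the segment the derivative drifts from its initial value
  at most linearly in \<open>\<tau>\<close>, which integrates to the factor 1/2.\<close>

lemma lipschitz_gradient_quadratic_bound:
  assumes F: "\<And>z. GDERIV F z :> G z"
    and G: "\<And>z z'. norm (G z - G z') \<le> L * norm (z - z')"
  shows "\<bar>F (x + h) - F x - h \<bullet> G x\<bar> \<le> L / 2 * (norm h)\<^sup>2"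
proof -
  have "norm (F (x + 1 *\<^sub>R h) - F (x + 0 *\<^sub>R h) - h \<bullet> G x) \<le> (L * (norm h)\<^sup>2) / (real 1 + 1)"
  proof (rule vector_derivative_power_remainder_bound[OF gderiv_line[OF F]])
    fix \<tau> :: real assume \<tau>: "0 < \<tau>" "\<tau> < 1"
    have "norm (h \<bullet> (G (x + \<tau> *\<^sub>R h) - G x)) \<le> norm h * norm (G (x + \<tau> *\<^sub>R h) - G x)"
      by (simp add: Cauchy_Schwarz_ineq2)
    also have "\<dots> \<le> norm h * (L * norm (\<tau> *\<^sub>R h))"
      using G[of "x + \<tau> *\<^sub>R h" x] by (intro mult_left_mono) auto
    also have "\<dots> = L * (norm h)\<^sup>2 * \<tau> ^ 1" using \<tau> by (simp add: power2_eq_square)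
    finally show "norm (h \<bullet> G (x + \<tau> *\<^sub>R h) - h \<bullet> G x) \<le> L * (norm h)\<^sup>2 * \<tau> ^ 1"
      by (simp add: inner_diff_right)
  qed
  then show ?thesis by simp
qed

text \<open>A gradient step of length \<open>1 / L\<close> lowers \<open>F\<close> by at least
  \<open>(norm (G x))\<^sup>2 / (2 * L)\<close> and still cannot get below \<open>m\<close>.\<close>

lemma lipschitz_gradient_norm_bound:
  assumes F: "\<And>z. GDERIV F z :> G z"
    and G: "\<And>z z'. norm (G z - G z') \<le> L * norm (z - z')"
    and L: "0 < L" and bdd: "\<And>z. m \<le> F z"
  shows "(norm (G x))\<^sup>2 \<le> 2 * L * (F x - m)"
proof -
  have "F (x + (- 1 / L) *\<^sub>R G x) - F x - ((- 1 / L) *\<^sub>R G x) \<bullet> G x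
      \<le> L / 2 * (norm ((- 1 / L) *\<^sub>R G x))\<^sup>2"
    using lipschitz_gradient_quadratic_bound[OF F G, of x "(- 1 / L) *\<^sub>R G x"] by linarith
  moreover have "((- 1 / L) *\<^sub>R G x) \<bullet> G x = - (norm (G x))\<^sup>2 / L"
    by (simp add: power2_norm_eq_inner)
  moreover have "L / 2 * (norm ((- 1 / L) *\<^sub>R G x))\<^sup>2 = (norm (G x))\<^sup>2 / (2 * L)"
    using L by (simp add: power_mult_distrib power2_eq_square)
  ultimately have "m - F x - (- (norm (G x))\<^sup>2 / L) \<le> (norm (G x))\<^sup>2 / (2 * L)"
    using bdd[of "x + (- 1 / L) *\<^sub>R G x"] by linarith
  moreover have "(norm (G x))\<^sup>2 / L = 2 * ((norm (G x))\<^sup>2 / (2 * L))" by simp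
  ultimately have "(norm (G x))\<^sup>2 / (2 * L) \<le> F x - m" by linarith
  then show ?thesis using L by (simp add: pos_divide_le_eq mult.commute)
qed

text \<open>Divide the concavity inequality on the segment from \<open>v\<close> to \<open>u\<close>
  by \<open>t\<close> and let \<open>t\<close> tend to 0 from the right.\<close>

lemma strongly_concave_gradient_bound:
  assumes g: "strongly_concave \<mu> g" and D: "GDERIV g v :> D"
  shows "g u \<le> g v + (u - v) \<bullet> D - \<mu> / 2 * (norm (u - v))\<^sup>2"
proof -
  have "((\<lambda>t. g (v + t *\<^sub>R (u - v))) has_derivative (\<lambda>t. (t *\<^sub>R (u - v)) \<bullet> D)) (at 0)"
    by (rule has_derivative_compose[where f = "\<lambda>t. v + t *\<^sub>R (u - v)" and g = g])
      (auto intro!: derivative_eq_intros D[unfolded gderiv_def])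
  then have "((\<lambda>t. g (v + t *\<^sub>R (u - v))) has_field_derivative (u - v) \<bullet> D) (at 0)"
    by (simp add: has_field_derivative_def mult.commute[of _ "(u - v) \<bullet> D"] mult_commute_abs)
  then have "((\<lambda>t. (g (v + t *\<^sub>R (u - v)) - g v) / t) \<longlongrightarrow> (u - v) \<bullet> D) (at 0)"
    by (simp add: DERIV_def)
  then have lim: "((\<lambda>t. (g (v + t *\<^sub>R (u - v)) - g v) / t) \<longlongrightarrow> (u - v) \<bullet> D) (at_right 0)"
    by (rule filterlim_mono) (auto intro: at_le)
  have lim': "((\<lambda>t. g u - g v + \<mu> / 2 * (1 - t) * (norm (u - v))\<^sup>2)
      \<longlongrightarrow> g u - g v + \<mu> / 2 * (1 - 0) * (norm (u - v))\<^sup>2) (at_right 0)"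
    by (intro tendsto_intros)
  have "g u - g v + \<mu> / 2 * (1 - t) * (norm (u - v))\<^sup>2 \<le> (g (v + t *\<^sub>R (u - v)) - g v) / t"
    if t: "0 < t" "t < 1" for t :: real
  proof -
    have "t *\<^sub>R u + (1 - t) *\<^sub>R v = v + t *\<^sub>R (u - v)" by (simp add: algebra_simps)
    then have "t * g u + (1 - t) * g v + \<mu> / 2 * t * (1 - t) * (norm (u - v))\<^sup>2 \<le> g (v + t *\<^sub>R (u - v))"
      using g t unfolding strongly_concave_def by (metis atLeastAtMost_iff less_eq_real_def)
    then have "t * (g u - g v + \<mu> / 2 * (1 - t) * (norm (u - v))\<^sup>2) \<le> g (v + t *\<^sub>R (u - v)) - g v"
      by (simp add: algebra_simps)
    then show ?thesis using t by (simp add: pos_le_divide_eq mult.commute)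
  qed
  then have "eventually (\<lambda>t. g u - g v + \<mu> / 2 * (1 - t) * (norm (u - v))\<^sup>2
      \<le> (g (v + t *\<^sub>R (u - v)) - g v) / t) (at_right 0)"
    by (intro eventually_at_rightI[of 0 1]) auto
  from tendsto_le[OF _ lim lim' this] show ?thesis by simp
qed

text \<open>The second difference of \<open>F\<close> over a small parallelogram is symmetric in the
  two sides; divided by \<open>t\<^sup>2\<close> it approximates both \<open>u \<bullet> D v\<close>
  and \<open>v \<bullet> D u\<close>. Differentiability of \<open>G\<close> at the single point
  \<open>x\<close> controls the error.\<close>

lemma gradient_derivative_symmetric:
  assumes F: "\<And>z. GDERIV F z :> G z" and D: "(G has_derivative D) (at x)"
  shows "u \<bullet> D v = v \<bullet> D u"
proof -
  interpret D: linear D using D by (rule has_derivative_linear)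
  have *: "\<bar>u \<bullet> D v - v \<bullet> D u\<bar> \<le> e * (4 * (norm u + norm v)\<^sup>2)" if e: "e > 0" for e
  proof -
    obtain \<delta> where \<delta>: "\<delta> > 0"
      and small: "\<And>w. norm w < \<delta> \<Longrightarrow> norm (G (x + w) - G x - D w) \<le> e * norm w"
    proof -
      obtain \<delta> where "\<delta> > 0" "\<And>y. norm (y - x) < \<delta> \<Longrightarrow> norm (G y - G x - D (y - x)) \<le> e * norm (y - x)"
        using D e unfolding has_derivative_at_alt by blast
      from this(1) this(2)[of "x + w" for w] show ?thesis by (intro that[of \<delta>]) auto
    qed
    define t where "t = \<delta> / (2 * (norm u + norm v + 1))"
    have t: "t > 0" using \<delta> by (simp add: t_def add_nonneg_pos)
    have "t * (norm u + norm v + 1) = \<delta> / 2"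
      using add_nonneg_pos[OF add_nonneg_nonneg[OF norm_ge_zero[of u] norm_ge_zero[of v]] zero_less_one]
      by (simp only: t_def) (simp add: divide_simps)
    then have tb: "t * norm u + t * norm v < \<delta>" using \<delta> t by (simp add: distrib_left)
    \<comment> \<open>With the side \<open>t *\<^sub>R b\<close> fixed, the second difference is the
      increment of a function of one variable along \<open>t *\<^sub>R a\<close>. General
      \<open>a\<close> and \<open>b\<close> allow the use with \<open>u\<close> and \<open>v\<close>
      swapped.\<close>
    have half: "\<bar>F (x + t *\<^sub>R a + t *\<^sub>R b) - F (x + t *\<^sub>R a) - F (x + t *\<^sub>R b) + F x - t\<^sup>2 * (a \<bullet> D b)\<bar>
        \<le> 2 * t\<^sup>2 * e * (norm u + norm v)\<^sup>2"
      if ab: "norm a + norm b = norm u + norm v" for a b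
    proof -
      have "norm ((\<lambda>\<tau>. F ((x + t *\<^sub>R b) + \<tau> *\<^sub>R (t *\<^sub>R a)) - F (x + \<tau> *\<^sub>R (t *\<^sub>R a))) 1
         - (\<lambda>\<tau>. F ((x + t *\<^sub>R b) + \<tau> *\<^sub>R (t *\<^sub>R a)) - F (x + \<tau> *\<^sub>R (t *\<^sub>R a))) 0 - t\<^sup>2 * (a \<bullet> D b))
        \<le> (2 * t\<^sup>2 * e * (norm u + norm v)\<^sup>2) / (real 0 + 1)"
      proof (rule vector_derivative_power_remainder_bound)
        fix \<tau> :: real
        show "((\<lambda>\<tau>. F ((x + t *\<^sub>R b) + \<tau> *\<^sub>R (t *\<^sub>R a)) - F (x + \<tau> *\<^sub>R (t *\<^sub>R a))) has_vector_derivative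
           ((t *\<^sub>R a) \<bullet> G ((x + t *\<^sub>R b) + \<tau> *\<^sub>R (t *\<^sub>R a)) - (t *\<^sub>R a) \<bullet> G (x + \<tau> *\<^sub>R (t *\<^sub>R a)))) (at \<tau>)"
          by (intro derivative_intros gderiv_line F)
      next
        fix \<tau> :: real assume \<tau>: "0 < \<tau>" "\<tau> < 1"
        define w1 where "w1 = t *\<^sub>R b + \<tau> *\<^sub>R (t *\<^sub>R a)"
        define w2 where "w2 = \<tau> *\<^sub>R (t *\<^sub>R a)"
        have na: "norm (\<tau> *\<^sub>R (t *\<^sub>R a)) \<le> t * norm a"
          using \<tau> t by (simp add: mult_left_le_one_le)
        have tb': "t * norm a + t * norm b < \<delta>" using tb ab by (metis distrib_left)
        have n1: "norm w1 \<le> t * (norm u + norm v)"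
          using na norm_triangle_ineq[of "t *\<^sub>R b" "\<tau> *\<^sub>R (t *\<^sub>R a)"] t ab[symmetric]
          by (simp add: w1_def distrib_left)
        have n2: "norm w2 \<le> t * (norm u + norm v)"
        proof -
          have "t * norm a \<le> t * (norm a + norm b)" using t by simp
          then show ?thesis using na ab by (simp add: w2_def)
        qed
        have s: "norm (G (x + w) - G x - D w) \<le> e * (t * (norm u + norm v))"
          if "norm w \<le> t * (norm u + norm v)" for w
        proof -
          have "norm (G (x + w) - G x - D w) \<le> e * norm w" 
            using that tb by (intro small) (simp add: distrib_left)
          also have "\<dots> \<le> e * (t * (norm u + norm v))" using that e by simp
          finally show ?thesis .
        qed
        have Dw: "D w1 - D w2 = t *\<^sub>R D b"
          unfolding D.diff[symmetric] D.scaleR[symmetric] w1_def w2_def by simp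
        have "norm (G (x + w1) - G (x + w2) - t *\<^sub>R D b) \<le> 2 * (e * (t * (norm u + norm v)))"
        proof -
          have eq: "G (x + w1) - G (x + w2) - t *\<^sub>R D b
             = (G (x + w1) - G x - D w1) - (G (x + w2) - G x - D w2)"
            using Dw by (simp add: algebra_simps)
          show ?thesis unfolding eq using s[OF n1] s[OF n2]
            norm_triangle_ineq4[of "G (x + w1) - G x - D w1" "G (x + w2) - G x - D w2"]
            by linarith
        qed
        then have "norm ((t *\<^sub>R a) \<bullet> (G (x + w1) - G (x + w2) - t *\<^sub>R D b))
           \<le> (t * norm a) * (2 * (e * (t * (norm u + norm v))))"
          using t by (intro order.trans[OF Cauchy_Schwarz_ineq2[THEN order.trans[OF eq_refl[OF real_norm_def]]]]
              mult_mono) auto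
        also have "\<dots> \<le> (t * (norm u + norm v)) * (2 * (e * (t * (norm u + norm v))))"
          using t e ab by (intro mult_right_mono) (auto simp flip: ab)
        finally show "norm ((t *\<^sub>R a) \<bullet> G ((x + t *\<^sub>R b) + \<tau> *\<^sub>R (t *\<^sub>R a)) - (t *\<^sub>R a) \<bullet> G (x + \<tau> *\<^sub>R (t *\<^sub>R a))
           - t\<^sup>2 * (a \<bullet> D b)) \<le> 2 * t\<^sup>2 * e * (norm u + norm v)\<^sup>2 * \<tau> ^ 0"
          by (simp add: w1_def w2_def inner_diff_right power2_eq_square algebra_simps)
      qed
      then show ?thesis by (simp add: algebra_simps)
    qed
    have "t\<^sup>2 * \<bar>u \<bullet> D v - v \<bullet> D u\<bar> = \<bar>t\<^sup>2 * (u \<bullet> D v) - t\<^sup>2 * (v \<bullet> D u)\<bar>"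
      by (simp add: abs_mult flip: right_diff_distrib)
    also have "\<dots> \<le> 2 * (2 * t\<^sup>2 * e * (norm u + norm v)\<^sup>2)"
      using half[of u v] half[of v u] by (simp add: algebra_simps) 
    finally have "t\<^sup>2 * \<bar>u \<bullet> D v - v \<bullet> D u\<bar> \<le> t\<^sup>2 * (e * (4 * (norm u + norm v)\<^sup>2))" by (simp add: algebra_simps)
    then show ?thesis using t by simp
  qed
  have "\<bar>u \<bullet> D v - v \<bullet> D u\<bar> \<le> 0"
  proof (rule field_le_epsilon)
    fix e :: real assume e: "e > 0"
    define c where "c = 4 * (norm u + norm v)\<^sup>2 + 1"
    have c: "c \<ge> 1" by (simp add: c_def)
    have "\<bar>u \<bullet> D v - v \<bullet> D u\<bar> \<le> e / c * (4 * (norm u + norm v)\<^sup>2)" using e c by (intro *) auto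
    also have "\<dots> \<le> e / c * c" using e c by (intro mult_left_mono) (auto simp: c_def)
    also have "\<dots> = e" using c by simp
    finally show "\<bar>u \<bullet> D v - v \<bullet> D u\<bar> \<le> 0 + e" by simp
  qed
  then show ?thesis by simp
qed

section \<open>Accelerated gradient ascent\<close>

lemma norm_convex_combination_sq:
  fixes a b :: "'a::real_inner"
  shows "(norm ((1 - q) *\<^sub>R a + q *\<^sub>R b))\<^sup>2
     = (1 - q) * (norm a)\<^sup>2 + q * (norm b)\<^sup>2 - q * (1 - q) * (norm (a - b))\<^sup>2"
  by (simp add: power2_norm_eq_inner inner_add inner_diff inner_commute[of b a] algebra_simps)

text \<open>One step of a Lyapunov argument. The point \<open>v\<close> is never computed by the
  method; the optimality gap plus \<open>\<mu> / 2\<close> times the squared distance of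
  \<open>v\<close> to \<open>ys\<close> contracts by \<open>1 - q\<close>, where \<open>q\<close> is
  the inverse square root of the condition number.\<close>

lemma nesterov_step:
  fixes G :: "'a::real_inner \<Rightarrow> 'a" and g :: "'a \<Rightarrow> real"
  assumes up: "\<And>u v. g u \<le> g v + (u - v) \<bullet> G v - \<mu> / 2 * (norm (u - v))\<^sup>2"
    and low: "\<And>u v. g v + (u - v) \<bullet> G v - l / 2 * (norm (u - v))\<^sup>2 \<le> g u"
    and \<mu>: "0 < \<mu>" and q: "0 < q" "q \<le> 1" and l: "l * q\<^sup>2 = \<mu>"
    and z: "(1 + q) *\<^sub>R z = x + q *\<^sub>R v"
    and x': "x' = z + (1 / l) *\<^sub>R G z"
    and v': "q *\<^sub>R v' = x' - (1 - q) *\<^sub>R x"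
  shows "g ys - g x' + \<mu> / 2 * (norm (v' - ys))\<^sup>2
     \<le> (1 - q) * (g ys - g x + \<mu> / 2 * (norm (v - ys))\<^sup>2)"
proof -
  have l0: "l > 0" using \<mu> q l by (metis zero_less_mult_pos2 zero_less_power)
  define p where "p = (1 - q) *\<^sub>R (v - ys) + q *\<^sub>R (z - ys)"
  have x: "x = (1 + q) *\<^sub>R z - q *\<^sub>R v" using z by simp
  \<comment> \<open>Eliminating \<open>x\<close> shows that \<open>v'\<close> averages
    \<open>v\<close> and \<open>z\<close> and then moves along the gradient by
    \<open>q / \<mu>\<close>; \<open>p\<close> is that average relative to
    \<open>ys\<close>.\<close>
  have "q *\<^sub>R v' = q *\<^sub>R ((1 - q) *\<^sub>R v + q *\<^sub>R z + (q / \<mu>) *\<^sub>R G z)"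
  proof -
    have "q * (q / \<mu>) = 1 / l" using l \<mu> q l0 by (simp add: field_simps power2_eq_square)
    then have eq: "q *\<^sub>R ((1 - q) *\<^sub>R v + q *\<^sub>R z + (q / \<mu>) *\<^sub>R G z)
        = q *\<^sub>R ((1 - q) *\<^sub>R v) + q *\<^sub>R q *\<^sub>R z + (1 / l) *\<^sub>R G z"
      by (simp only: scaleR_add_right scaleR_scaleR)
    show ?thesis unfolding eq v' x' x by (simp add: algebra_simps)
  qed
  then have v'_eq: "v' = (1 - q) *\<^sub>R v + q *\<^sub>R z + (q / \<mu>) *\<^sub>R G z" using q by simp
  have v'_p: "v' - ys = p + (q / \<mu>) *\<^sub>R G z" by (simp add: v'_eq p_def algebra_simps)
  have q2: "q\<^sup>2 / (2 * \<mu>) = 1 / (2 * l)" using l \<mu> l0 q by (simp add: field_simps)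
  have V': "\<mu> / 2 * (norm (v' - ys))\<^sup>2 = \<mu> / 2 * (norm p)\<^sup>2 + q * (p \<bullet> G z) + 1 / (2 * l) * (norm (G z))\<^sup>2"
  proof -
    have "(norm (p + c *\<^sub>R G z))\<^sup>2 = (norm p)\<^sup>2 + 2 * c * (p \<bullet> G z) + c\<^sup>2 * (norm (G z))\<^sup>2" for c
      by (simp add: power2_norm_eq_inner inner_add inner_commute algebra_simps power2_eq_square[of c])
    moreover have "\<mu> / 2 * (a + 2 * (q / \<mu>) * b + (q / \<mu>)\<^sup>2 * c) = \<mu> / 2 * a + q * b + q\<^sup>2 / (2 * \<mu>) * c"
      for a b c using \<mu> by (simp add: distrib_left power_divide power2_eq_square)
    ultimately show ?thesis unfolding v'_p q2[symmetric] by metis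
  qed
  have p2: "(norm p)\<^sup>2 = (1 - q) * (norm (v - ys))\<^sup>2 + q * (norm (z - ys))\<^sup>2 - q * (1 - q) * (norm (v - z))\<^sup>2"
    unfolding p_def norm_convex_combination_sq by simp
  have pG: "q * (p \<bullet> G z) = (1 - q) * ((z - x) \<bullet> G z) + q * ((z - ys) \<bullet> G z)"
    unfolding p_def x by (simp add: inner_add inner_diff algebra_simps power2_eq_square)
  have "\<mu> / 2 * (norm (v' - ys))\<^sup>2 = \<mu> / 2 * ((1 - q) * (norm (v - ys))\<^sup>2 + q * (norm (z - ys))\<^sup>2
      - q * (1 - q) * (norm (v - z))\<^sup>2) + (1 - q) * ((z - x) \<bullet> G z) + q * ((z - ys) \<bullet> G z)
      + 1 / (2 * l) * (norm (G z))\<^sup>2"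
    unfolding V' p2 pG by simp
  moreover have "g z + 1 / (2 * l) * (norm (G z))\<^sup>2 \<le> g x'"
  proof -
    have "g z + (x' - z) \<bullet> G z - l / 2 * (norm (x' - z))\<^sup>2 \<le> g x'" by (rule low)
    moreover have "(x' - z) \<bullet> G z = 1 / l * (norm (G z))\<^sup>2" by (simp add: x' power2_norm_eq_inner)
    moreover have "l / 2 * (norm (x' - z))\<^sup>2 = 1 / (2 * l) * (norm (G z))\<^sup>2"
      using l0 by (simp add: x' power2_eq_square)
    ultimately show ?thesis by (simp add: field_simps)
  qed
  \<comment> \<open>Concavity at \<open>z\<close> is used towards \<open>ys\<close> with weight
    \<open>q\<close> and towards \<open>x\<close> with weight \<open>1 - q\<close>; the linear terms
    then cancel those of \<open>pG\<close>.\<close>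
  moreover have "q * g ys \<le> q * (g z - (z - ys) \<bullet> G z - \<mu> / 2 * (norm (z - ys))\<^sup>2)"
    using up[of ys z] q by (intro mult_left_mono) (auto simp: norm_minus_commute inner_diff_left)
  moreover have "(1 - q) * g x \<le> (1 - q) * (g z - (z - x) \<bullet> G z)"
  proof (rule mult_left_mono)
    have "0 \<le> \<mu> / 2 * (norm (x - z))\<^sup>2" using \<mu> by simp
    then show "g x \<le> g z - (z - x) \<bullet> G z" using up[of x z] by (simp add: inner_diff_left)
  qed (use q in auto)
  moreover have "0 \<le> \<mu> / 2 * (q * (1 - q) * (norm (v - z))\<^sup>2)" using \<mu> q by simp
  ultimately show ?thesis by argo
qed

text \<open>The gap controls \<open>\<mu> / 2\<close> times the squared error, and the initial
  potential is at most \<open>(l + \<mu>) / 2\<close> times the squared initial distance; hence the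
  factor \<open>l / \<mu> + 1\<close>. The rest is \<open>1 - q \<le> exp (- q)\<close>.\<close>

lemma nag_linear_rate:
  fixes f :: "'a::real_inner \<times> 'b::real_inner \<Rightarrow> real"
  assumes up: "\<And>u v. f (x, u) \<le> f (x, v) + (u - v) \<bullet> grad_y f (x, v) - \<mu> / 2 * (norm (u - v))\<^sup>2"
    and low: "\<And>u v. f (x, v) + (u - v) \<bullet> grad_y f (x, v) - l / 2 * (norm (u - v))\<^sup>2 \<le> f (x, u)"
    and \<mu>: "0 < \<mu>" "\<mu> \<le> l" and ys: "grad_y f (x, ys) = 0"
    and k: "2 * sqrt (l / \<mu>) * ln (sqrt (l / \<mu> + 1) * norm (y0 - ys) / A) \<le> real k"
    and A: "A > 0"
  shows "norm (fst (nag f (1 / l) ((sqrt (l / \<mu>) - 1) / (sqrt (l / \<mu>) + 1)) x y0 k) - ys) \<le> A"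
proof -
  define \<kappa> where "\<kappa> = l / \<mu>"
  define q where "q = 1 / sqrt \<kappa>"
  define \<theta> where "\<theta> = (sqrt \<kappa> - 1) / (sqrt \<kappa> + 1)"
  have \<kappa>: "1 \<le> \<kappa>" using \<mu> by (simp add: \<kappa>_def)
  then have sk: "1 \<le> sqrt \<kappa>" by simp
  have q: "0 < q" "q \<le> 1" using sk by (auto simp: q_def)
  have l: "l * q\<^sup>2 = \<mu>" using \<kappa> \<mu> by (simp add: q_def power_divide \<kappa>_def)
  have \<theta>: "\<theta> = (1 - q) / (1 + q)"
  proof -
    have "(s - 1) / (s + 1) = (1 - 1 / s) / (1 + 1 / s)" if "s \<ge> 1" for s :: real
      using that by (simp add: divide_simps)
    then show ?thesis using sk by (simp only: \<theta>_def q_def)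
  qed
  have \<theta>': "(1 + q) * \<theta> = 1 - q" using q by (simp add: \<theta>)
  \<comment> \<open>The vector \<open>(1 / q) *\<^sub>R ((1 + q) *\<^sub>R yt - y)\<close> is the
    auxiliary point of \<open>nesterov_step\<close>, recovered from the stored pair. That it evolves
    as required there is the identity \<open>(1 + q) * \<theta> = 1 - q\<close>.\<close>
  define E where "E = (\<lambda>y yt. f (x, ys) - f (x, y) + \<mu> / 2 * (norm ((1 / q) *\<^sub>R ((1 + q) *\<^sub>R yt - y) - ys))\<^sup>2)"
  have step: "(case nag f (1 / l) \<theta> x y0 k of (y, yt) \<Rightarrow> E y yt) \<le> (1 - q) ^ k * E y0 y0" for k
  proof (induction k)
    case (Suc k)
    obtain y yt where n: "nag f (1 / l) \<theta> x y0 k = (y, yt)" by fastforce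
    define y' where "y' = yt + (1 / l) *\<^sub>R grad_y f (x, yt)"
    define yt' where "yt' = y' + \<theta> *\<^sub>R (y' - y)"
    have "E y' yt' \<le> (1 - q) * E y yt"
      unfolding E_def
    proof (rule nesterov_step[OF up low \<mu>(1) q l _ y'_def])
      show "(1 + q) *\<^sub>R yt = y + q *\<^sub>R ((1 / q) *\<^sub>R ((1 + q) *\<^sub>R yt - y))" using q by simp
      have "(1 + q) *\<^sub>R yt' = (1 + q) *\<^sub>R y' + (1 - q) *\<^sub>R (y' - y)"
        by (simp only: yt'_def scaleR_add_right scaleR_scaleR \<theta>')
      then show "q *\<^sub>R ((1 / q) *\<^sub>R ((1 + q) *\<^sub>R yt' - y')) = y' - (1 - q) *\<^sub>R y"
        using q by (simp add: algebra_simps)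
    qed
    also have "\<dots> \<le> (1 - q) * ((1 - q) ^ k * E y0 y0)"
      using Suc q by (intro mult_left_mono) (auto simp: n)
    finally show ?case by (simp add: n Let_def y'_def yt'_def)
  qed simp
  obtain y yt where n: "nag f (1 / l) \<theta> x y0 k = (y, yt)" by fastforce
  have E0: "E y0 y0 \<le> (l + \<mu>) / 2 * (norm (y0 - ys))\<^sup>2"
  proof -
    have "(1 / q) *\<^sub>R ((1 + q) *\<^sub>R y0 - y0) = y0" using q by (simp add: algebra_simps)
    moreover have "f (x, ys) - f (x, y0) \<le> l / 2 * (norm (y0 - ys))\<^sup>2"
      using low[of ys y0] by (simp add: ys)
    ultimately show ?thesis by (simp add: E_def algebra_simps add_divide_distrib)
  qed
  have "\<mu> / 2 * (norm (y - ys))\<^sup>2 \<le> f (x, ys) - f (x, y)" using up[of y ys] by (simp add: ys)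
  also have "\<dots> \<le> E y yt" using \<mu> by (simp add: E_def)
  also have "\<dots> \<le> (1 - q) ^ k * E y0 y0" using step[of k] by (simp add: n)
  also have "\<dots> \<le> (1 - q) ^ k * ((l + \<mu>) / 2 * (norm (y0 - ys))\<^sup>2)"
    using E0 q by (intro mult_left_mono) auto
  finally have "(norm (y - ys))\<^sup>2 \<le> (1 - q) ^ k * ((\<kappa> + 1) * (norm (y0 - ys))\<^sup>2)"
    using \<mu> by (simp add: \<kappa>_def field_simps)
  also have "\<dots> \<le> exp (- q) ^ k * ((\<kappa> + 1) * (norm (y0 - ys))\<^sup>2)"
    using q \<kappa> exp_ge_add_one_self[of "- q"] by (intro mult_right_mono power_mono) auto
  also have "\<dots> \<le> A\<^sup>2"
  \<comment> \<open>For \<open>y0 = ys\<close> the budget contains \<open>ln 0\<close> and says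
    nothing, but the left-hand side is 0.\<close>
  proof (cases "y0 = ys")
    case False
    define W where "W = sqrt (\<kappa> + 1) * norm (y0 - ys) / A"
    have W: "W > 0" using False \<kappa> A by (simp add: W_def)
    have "2 * sqrt \<kappa> * ln W \<le> real k" using k by (simp add: W_def \<kappa>_def)
    then have "2 * ln W \<le> q * real k" using sk by (simp add: q_def field_simps)
    moreover have "2 * ln W = ln (W\<^sup>2)" using W by (simp add: ln_realpow)
    ultimately have "W\<^sup>2 \<le> exp (q * real k)"
      using W by (metis exp_le_cancel_iff exp_ln zero_less_power)
    moreover have "W\<^sup>2 = ((\<kappa> + 1) * (norm (y0 - ys))\<^sup>2) / A\<^sup>2"
      using \<kappa> by (simp add: W_def power_divide power_mult_distrib)
    ultimately have "(\<kappa> + 1) * (norm (y0 - ys))\<^sup>2 \<le> A\<^sup>2 * exp (q * real k)"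
      using A by (simp add: pos_divide_le_eq mult.commute)
    then have "exp (- (q * real k)) * ((\<kappa> + 1) * (norm (y0 - ys))\<^sup>2)
        \<le> exp (- (q * real k)) * (A\<^sup>2 * exp (q * real k))"
      by (intro mult_left_mono) auto
    moreover have "exp (- q) ^ k = exp (- (q * real k))"
      using exp_of_nat_mult[of k "- q"] by (simp add: mult.commute)
    moreover have "exp (- (q * real k)) * (A\<^sup>2 * exp (q * real k)) = A\<^sup>2"
      by (simp add: exp_minus)
    ultimately show ?thesis by metis
  qed simp
  finally have "norm (y - ys) \<le> A" by (rule power2_le_imp_le) (use A in simp)
  then show ?thesis using n by (simp add: \<theta>_def \<kappa>_def)
qed

section \<open>The trust-region step\<close>

lemma mat_vector_mult: "(mat c :: real^'n^'n) *v v = c *\<^sub>R v"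
proof -
  have "mat c = c *\<^sub>R (mat 1 :: real^'n^'n)" by (simp add: mat_def vec_eq_iff)
  then show ?thesis by (simp add: scaleR_matrix_vector_assoc[symmetric])
qed

lemma symmetric_matrix_inner:
  fixes M :: "real^'n^'n"
  assumes "transpose M = M"
  shows "u \<bullet> (M *v v) = v \<bullet> (M *v u)"
  by (metis assms dot_lmul_matrix inner_commute vector_transpose_matrix transpose_transpose)

lemma quadratic_difference:
  fixes M :: "real^'n^'n"
  assumes M: "transpose M = M"
  shows "g \<bullet> (s + w) + 1/2 * ((s + w) \<bullet> (M *v (s + w))) - (g \<bullet> s + 1/2 * (s \<bullet> (M *v s)))
     = (g + M *v s) \<bullet> w + 1/2 * (w \<bullet> (M *v w))"
  using symmetric_matrix_inner[OF M, of s w]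
  by (simp add: matrix_vector_right_distrib inner_add inner_commute algebra_simps)

lemma nonneg_if_small_quadratic_nonneg:
  fixes b c :: real
  assumes "\<And>t. 0 < t \<Longrightarrow> t < \<delta> \<Longrightarrow> 0 \<le> t * b + t\<^sup>2 * c" "0 < \<delta>"
  shows "0 \<le> b"
proof -
  have "eventually (\<lambda>t. 0 \<le> b + t * c) (at_right 0)"
  proof (rule eventually_at_rightI)
    fix t :: real assume t: "t \<in> {0<..<\<delta>}"
    then have "0 \<le> t * (b + t * c)" using assms(1)[of t] by (simp add: algebra_simps power2_eq_square)
    then show "0 \<le> b + t * c" using t by (simp add: zero_le_mult_iff)
  qed (rule assms)
  moreover have "((\<lambda>t. b + t * c) \<longlongrightarrow> b + 0 * c) (at_right 0)" by (intro tendsto_intros)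
  ultimately show ?thesis
    using tendsto_lowerbound[of "\<lambda>t. b + t * c" b "at_right 0" 0] by simp
qed

text \<open>The last conclusion uses global optimality: a local minimizer on the sphere would give
  semidefiniteness of the shifted matrix only in tangent directions.\<close>

lemma trust_region_optimality:
  fixes M :: "real^'n^'n"
  assumes M: "transpose M = M" and R: "0 < R"
    and opt: "is_arg_min (\<lambda>d. g \<bullet> d + 1/2 * (d \<bullet> (M *v d))) (\<lambda>d. norm d \<le> R) s"
  obtains lam where "0 \<le> lam" "g + M *v s + lam *\<^sub>R s = 0" "lam = 0 \<or> norm s = R"
    "\<And>v. 0 \<le> v \<bullet> (M *v v) + lam * (norm v)\<^sup>2"
proof -
  define p where "p = g + M *v s"
  have s: "norm s \<le> R" using opt by (auto simp: is_arg_min_def)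
  have min: "0 \<le> p \<bullet> w + 1/2 * (w \<bullet> (M *v w))" if "norm (s + w) \<le> R" for w
  proof -
    have "g \<bullet> s + 1/2 * (s \<bullet> (M *v s)) \<le> g \<bullet> (s + w) + 1/2 * ((s + w) \<bullet> (M *v (s + w)))"
      using opt that unfolding is_arg_min_def by (meson not_le_imp_less)
    then show ?thesis using quadratic_difference[OF M, of g s w] unfolding p_def by linarith
  qed
  have first_order: "0 \<le> p \<bullet> v"
    if \<delta>: "0 < \<delta>" and feas: "\<And>t. 0 < t \<Longrightarrow> t < \<delta> \<Longrightarrow> norm (s + t *\<^sub>R v) \<le> R" for v \<delta>
  proof (rule nonneg_if_small_quadratic_nonneg[OF _ \<delta>])
    fix t :: real assume "0 < t" "t < \<delta>"
    then show "0 \<le> t * (p \<bullet> v) + t\<^sup>2 * (1/2 * (v \<bullet> (M *v v)))"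
      using min[of "t *\<^sub>R v"] feas[of t] by (simp add: matrix_vector_mult_scaleR power2_eq_square)
  qed
  show ?thesis
  proof (cases "norm s < R")
    case True
    have inner: "norm (s + t *\<^sub>R v) \<le> R" if "0 < t" "t < (R - norm s) / (norm v + 1)" for t v
    proof -
      have "t * norm v \<le> t * (norm v + 1)" using that by simp
      also have "\<dots> \<le> R - norm s"
        using that by (simp add: pos_less_divide_eq add_nonneg_pos less_imp_le)
      finally show ?thesis using norm_triangle_ineq[of s "t *\<^sub>R v"] that by simp
    qed
    have pv: "0 \<le> p \<bullet> v" for v
      using True by (intro first_order[OF _ inner]) (auto simp: add_nonneg_pos)
    have p0: "p = 0" using pv[of "- p"] 
      by (metis inner_eq_zero_iff inner_ge_zero inner_minus_right neg_0_le_iff_le order_antisym)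
    have "0 \<le> v \<bullet> (M *v v)" for v
    proof -
      define t where "t = (R - norm s) / (2 * (norm v + 1))"
      have t: "0 < t" "t < (R - norm s) / (norm v + 1)" using True add_nonneg_pos[OF norm_ge_zero[of v] zero_less_one]
        by (auto simp: t_def intro!: divide_strict_left_mono)
      have "0 \<le> t\<^sup>2 * (v \<bullet> (M *v v))"
        using min[OF inner[OF t]] p0 by (simp add: matrix_vector_mult_scaleR power2_eq_square)
      then show ?thesis using t by (simp add: zero_le_mult_iff)
    qed
    then show ?thesis using p0 by (intro that[of 0]) (auto simp: p_def)
  next
    case False
    then have sR: "norm s = R" using s by simp
    then have ss: "s \<bullet> s = R\<^sup>2" by (metis power2_norm_eq_inner)
    \<comment> \<open>A ray that strictly enters the ball remains in it up to its second
      intersection with the sphere, at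
      \<open>t = - 2 * (s \<bullet> v) / (v \<bullet> v)\<close>.\<close>
    have dir: "0 \<le> p \<bullet> v" if v: "s \<bullet> v < 0" for v
    proof -
      have "v \<noteq> 0" using v by auto
      then have vv: "0 < v \<bullet> v" by simp
      show ?thesis
      proof (rule first_order[of "- 2 * (s \<bullet> v) / (v \<bullet> v)"])
        fix t :: real assume t: "0 < t" "t < - 2 * (s \<bullet> v) / (v \<bullet> v)"
        then have "t * (v \<bullet> v) \<le> - 2 * (s \<bullet> v)" using vv
          by (metis less_imp_le pos_less_divide_eq)
        then have "t * (t * (v \<bullet> v)) \<le> t * (- 2 * (s \<bullet> v))" using t by (intro mult_left_mono) auto
        then have "(norm (s + t *\<^sub>R v))\<^sup>2 \<le> R\<^sup>2"
          by (simp add: power2_norm_eq_inner inner_add inner_commute ss algebra_simps)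
        then show "norm (s + t *\<^sub>R v) \<le> R" by (rule power2_le_imp_le) (use R in simp)
      qed (use v vv in \<open>auto intro!: divide_neg_pos\<close>)
    qed
    \<comment> \<open>This choice makes \<open>w\<close> orthogonal to \<open>s\<close>. The tangent
      direction \<open>- w\<close> is tilted inwards to \<open>- w - t *\<^sub>R s\<close> so that
      \<open>dir\<close> applies, and letting \<open>t\<close> tend to 0 leaves
      \<open>0 \<le> - (norm w)\<^sup>2\<close>.\<close>
    define lam where "lam = - (p \<bullet> s) / R\<^sup>2"
    define w where "w = p + lam *\<^sub>R s"
    have ws: "w \<bullet> s = 0" using R by (simp add: w_def inner_diff_left lam_def ss)
    have lam: "0 \<le> lam" using dir[of "- s"] R ss by (simp add: lam_def divide_nonpos_pos)
    have "0 \<le> - (norm w)\<^sup>2"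
    proof (rule nonneg_if_small_quadratic_nonneg[of 1])
      fix t :: real assume t: "0 < t" "t < 1"
      have "s \<bullet> (- w - t *\<^sub>R s) < 0" using ws ss R t by (simp add: inner_diff inner_commute)
      then have "0 \<le> p \<bullet> (- w - t *\<^sub>R s)" by (rule dir)
      moreover have "p \<bullet> (- w - t *\<^sub>R s) = - (norm w)\<^sup>2 + t * (lam * R\<^sup>2)"
      proof -
        have p: "p = w - lam *\<^sub>R s" by (simp add: w_def)
        show ?thesis unfolding p using ws ss
          by (simp add: inner_diff inner_commute power2_norm_eq_inner)
      qed
      ultimately have "0 \<le> t * (- (norm w)\<^sup>2 + t * (lam * R\<^sup>2))" using t by simp
      then show "0 \<le> t * - (norm w)\<^sup>2 + t\<^sup>2 * (lam * R\<^sup>2)" by (simp add: algebra_simps power2_eq_square)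
    qed simp
    then have w0: "w = 0" by simp
    then have p: "p = - lam *\<^sub>R s" by (simp add: w_def eq_neg_iff_add_eq_0)
    have curv: "0 \<le> v \<bullet> (M *v v) + lam * (norm v)\<^sup>2" if sv: "s \<bullet> v \<noteq> 0" for v
    proof -
      \<comment> \<open>Moving along \<open>v\<close> to the second intersection with the sphere, the linear term equals the
        curvature of the multiplier term.\<close>
      have vv: "0 < v \<bullet> v" using sv by auto
      define t where "t = - 2 * (s \<bullet> v) / (v \<bullet> v)"
      have t: "t \<noteq> 0" "t * (v \<bullet> v) = - 2 * (s \<bullet> v)" using sv vv by (auto simp: t_def)
      have "(norm (s + t *\<^sub>R v))\<^sup>2 = R\<^sup>2 + t * (2 * (s \<bullet> v) + t * (v \<bullet> v))"
        by (simp add: power2_norm_eq_inner inner_add inner_commute ss algebra_simps)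
      then have "(norm (s + t *\<^sub>R v))\<^sup>2 \<le> R\<^sup>2" using t by simp
      then have "norm (s + t *\<^sub>R v) \<le> R" by (rule power2_le_imp_le) (use R in simp)
      from min[OF this] have "0 \<le> - lam * (t * (s \<bullet> v)) + 1/2 * (t\<^sup>2 * (v \<bullet> (M *v v)))"
        by (simp add: p matrix_vector_mult_scaleR power2_eq_square algebra_simps)
      moreover have "s \<bullet> v = - 1/2 * (t * (v \<bullet> v))" using t(2) by simp
      then have "t * (s \<bullet> v) = - 1/2 * t\<^sup>2 * (v \<bullet> v)" by (simp add: power2_eq_square)
      ultimately have "0 \<le> t\<^sup>2 * (v \<bullet> (M *v v) + lam * (norm v)\<^sup>2)"
        by (simp add: power2_norm_eq_inner algebra_simps)
      then show ?thesis using t by (simp add: zero_le_mult_iff)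
    qed
    \<comment> \<open>A tangent line has no second intersection with the sphere; tilting it by
      \<open>t *\<^sub>R s\<close> reduces it to \<open>curv\<close>, and continuity gives the
      limit.\<close>
    have "0 \<le> v \<bullet> (M *v v) + lam * (norm v)\<^sup>2" for v
    proof (cases "s \<bullet> v = 0")
      case True
      have "eventually (\<lambda>t. 0 \<le> (v + t *\<^sub>R s) \<bullet> (M *v (v + t *\<^sub>R s)) + lam * (norm (v + t *\<^sub>R s))\<^sup>2) (at_right 0)"
        using True ss R by (intro eventually_at_rightI[of 0 1] curv) (auto simp: inner_add)
      moreover have "((\<lambda>t. (v + t *\<^sub>R s) \<bullet> (M *v (v + t *\<^sub>R s)) + lam * (norm (v + t *\<^sub>R s))\<^sup>2)
        \<longlongrightarrow> (v + 0 *\<^sub>R s) \<bullet> (M *v (v + 0 *\<^sub>R s)) + lam * (norm (v + 0 *\<^sub>R s))\<^sup>2) (at_right 0)"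
        by (intro tendsto_intros bounded_linear.tendsto[OF matrix_vector_mul_bounded_linear])
      ultimately show ?thesis
        using tendsto_lowerbound[of "\<lambda>t. (v + t *\<^sub>R s) \<bullet> (M *v (v + t *\<^sub>R s)) + lam * (norm (v + t *\<^sub>R s))\<^sup>2" _ "at_right 0" 0]
        by fastforce
    qed (rule curv)
    then show ?thesis using lam w0 sR by (intro that[of lam]) (auto simp: w_def p_def)
  qed
qed


text \<open>In the application \<open>b = sqrt L\<^sub>2\<close> and \<open>w = sqrt \<epsilon>\<close>.  Steps to the boundary of the trust region
  with a large multiplier give the second alternative, interior steps give the third.\<close>

lemma trust_region_step_cases:
  fixes H HP :: "real^'n^'n" and g gP g' gP' s :: "real^'n" and P P' :: real
  assumes pos: "0 < b" "0 < L1" "0 < w" "w \<le> 1"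
    and H: "transpose H = H" "\<And>v. norm (H *v v) \<le> L1 * norm v"
    and \<gamma>: "\<gamma> = sqrt (norm g)"
    and opt: "is_arg_min (\<lambda>d. g \<bullet> d + 1/2 * (d \<bullet> ((H + mat (b / 2 * \<gamma>)) *v d)))
       (\<lambda>d. norm d \<le> 1 / (4 * b) * max \<gamma> w) s"
    and e1: "norm (g - gP) \<le> e1" "norm (g' - gP') \<le> e1" "e1 \<le> w ^ 3 / 96" "e1 * L1 \<le> b * w ^ 3 / 16"
    and e2: "\<And>v. norm (H *v v - HP *v v) \<le> b * w / 24 * norm v"
    and P: "P' \<le> P + gP \<bullet> s + 1/2 * (s \<bullet> (HP *v s)) + b\<^sup>2 / 6 * norm s ^ 3"
    and gP': "norm (gP' - gP - HP *v s) \<le> b\<^sup>2 / 2 * (norm s)\<^sup>2"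
  shows "(norm g < 3 * w\<^sup>2 \<and> (\<forall>v. - (2 * b * w * (norm v)\<^sup>2) \<le> v \<bullet> (H *v v)))
    \<or> P' \<le> P - w ^ 3 / (128 * b)
    \<or> (P' \<le> P \<and> 3 * w\<^sup>2 \<le> norm g \<and> norm g' \<le> norm g / 3)"
proof -
  define M where "M = H + mat (b / 2 * \<gamma>)"
  have \<gamma>0: "0 \<le> \<gamma>" and g2: "norm g = \<gamma>\<^sup>2" using \<gamma> by auto
  have Mv: "M *v v = H *v v + (b / 2 * \<gamma>) *\<^sub>R v" for v
    by (simp add: M_def matrix_vector_mult_add_rdistrib mat_vector_mult)
  have MT: "transpose M = M"
    using H(1) by (simp add: M_def transpose_def mat_def vec_eq_iff)
  have R: "0 < 1 / (4 * b) * max \<gamma> w" using pos by simp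
  obtain lam where lam: "0 \<le> lam" "g + M *v s + lam *\<^sub>R s = 0"
      "lam = 0 \<or> norm s = 1 / (4 * b) * max \<gamma> w"
    and curv: "\<And>v. 0 \<le> v \<bullet> (M *v v) + lam * (norm v)\<^sup>2"
    using trust_region_optimality[OF MT R opt[folded M_def]] by metis
  define n where "n = norm s"
  have n0: "0 \<le> n" by (simp add: n_def)
  have n: "n \<le> 1 / (4 * b) * max \<gamma> w" using opt by (simp add: is_arg_min_def n_def)
  have e10: "0 \<le> e1" using e1(1) norm_ge_zero order.trans by blast
  have curvH: "- ((b / 2 * \<gamma> + lam) * (norm v)\<^sup>2) \<le> v \<bullet> (H *v v)" for v
    using curv[of v] by (simp add: Mv inner_add power2_norm_eq_inner algebra_simps)
  have w32: "w ^ 3 \<le> w\<^sup>2" using pos by (simp add: power_decreasing)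
  \<comment> \<open>Inserting the stationarity equation turns
    \<open>g \<bullet> s + 1/2 * (s \<bullet> (H *v s))\<close> into minus half of
    \<open>s \<bullet> (M *v s) + lam * n\<^sup>2\<close>, which \<open>curv\<close> makes
    nonpositive, and the first two terms displayed. The others are the gradient error, the Hessian
    error and the cubic remainder.\<close>
  have desc: "P' - P \<le> - (1/2 * lam * n\<^sup>2) - b / 4 * \<gamma> * n\<^sup>2 + e1 * n + b * w / 48 * n\<^sup>2 + b\<^sup>2 / 6 * n ^ 3"
  proof -
    have "gP \<bullet> s \<le> g \<bullet> s + e1 * n"
    proof -
      have "(gP - g) \<bullet> s \<le> norm (gP - g) * norm s" by (rule norm_cauchy_schwarz)
      also have "\<dots> \<le> e1 * n" using e1(1) by (simp add: n_def norm_minus_commute mult_right_mono)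
      finally show ?thesis by (simp add: inner_diff_left)
    qed
    moreover have "s \<bullet> (HP *v s) \<le> s \<bullet> (H *v s) + b * w / 24 * n\<^sup>2"
    proof -
      have "s \<bullet> (HP *v s - H *v s) \<le> norm s * norm (HP *v s - H *v s)" by (rule norm_cauchy_schwarz)
      also have "\<dots> \<le> n * (b * w / 24 * n)"
        unfolding n_def by (intro mult_left_mono) (use e2[of s] in \<open>simp_all add: norm_minus_commute\<close>)
      finally show ?thesis by (simp add: inner_diff_right power2_eq_square algebra_simps)
    qed
    moreover have "g \<bullet> s = - (s \<bullet> (M *v s)) - lam * n\<^sup>2"
    proof -
      have "g = - (M *v s) - lam *\<^sub>R s" using lam(2) by (simp add: algebra_simps eq_neg_iff_add_eq_0)
      then show ?thesis by (simp add: inner_diff_left inner_diff_right n_def power2_norm_eq_inner inner_commute)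
    qed
    moreover have "s \<bullet> (M *v s) = s \<bullet> (H *v s) + b / 2 * \<gamma> * n\<^sup>2"
      by (simp add: Mv inner_add n_def power2_norm_eq_inner)
    moreover have "0 \<le> s \<bullet> (M *v s) + lam * n\<^sup>2" using curv[of s] by (simp add: n_def)
    ultimately show ?thesis using P unfolding n_def[symmetric] by argo
  qed
  show ?thesis
  proof (cases "w \<le> \<gamma>")
    case True
    then have n\<gamma>: "n \<le> \<gamma> / (4 * b)" using n by (simp add: max_def)
    have \<gamma>pos: "0 < \<gamma>" using True pos by simp
    have w2\<gamma>2: "w\<^sup>2 \<le> \<gamma>\<^sup>2" using True pos by (simp add: power_mono)
    have w3\<gamma>3: "w ^ 3 \<le> \<gamma> ^ 3" using True pos by (simp add: power_mono)
    have e1\<gamma>: "e1 \<le> \<gamma>\<^sup>2 / 96" using e1(3) w32 w2\<gamma>2 by linarith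
    have bn: "b * n \<le> \<gamma> / 4" using n\<gamma> pos by (simp add: field_simps)
    \<comment> \<open>By \<open>bn\<close> the cubic and Hessian errors cost
      \<open>1/24 + 1/48 = 1/16\<close> of \<open>b * \<gamma> * n\<^sup>2\<close>, which leaves
      3/16 of the regularization term 1/4.\<close>
    have desc': "P' - P \<le> - (1/2 * lam * n\<^sup>2) - 3 / 16 * (b * \<gamma> * n\<^sup>2) + e1 * n"
    proof -
      have "b * n * (b * n\<^sup>2) \<le> \<gamma> / 4 * (b * n\<^sup>2)" using bn pos by (intro mult_right_mono) auto
      then have "b\<^sup>2 / 6 * n ^ 3 \<le> 1 / 24 * (b * \<gamma> * n\<^sup>2)"
        by (simp add: power2_eq_square power3_eq_cube algebra_simps)
      moreover have "w * (b * n\<^sup>2) \<le> \<gamma> * (b * n\<^sup>2)" using True pos by (intro mult_right_mono) auto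
      ultimately show ?thesis using desc by (simp add: algebra_simps)
    qed
    show ?thesis
    proof (cases "lam = 0")
      case l0: True
      show ?thesis
      proof (cases "norm g < 3 * w\<^sup>2")
        case g3: True
        have "(2 * w)\<^sup>2 = 4 * w\<^sup>2" by (simp add: power_mult_distrib)
        then have "\<gamma>\<^sup>2 \<le> (2 * w)\<^sup>2" using g3 g2 zero_le_power2[of w] by linarith
        then have "\<gamma> \<le> 2 * w" by (rule power2_le_imp_le) (use pos in simp)
        have "- (2 * b * w * (norm v)\<^sup>2) \<le> v \<bullet> (H *v v)" for v
        proof -
          have "b / 2 * \<gamma> * (norm v)\<^sup>2 \<le> 2 * b * w * (norm v)\<^sup>2"
            using \<open>\<gamma> \<le> 2 * w\<close> pos by (intro mult_right_mono) auto
          then show ?thesis using curvH[of v] l0 by simp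
        qed
        then show ?thesis using g3 by simp
      next
        case False
        have Ms: "g + M *v s = 0" using lam(2) l0 by simp
        \<comment> \<open>A step with zero multiplier cannot be short, because
          \<open>M *v s = - g\<close> and \<open>M\<close> is bounded. So the regularization term
          beats the gradient error; the bound on \<open>e1 * L1\<close> is made for this
          comparison.\<close>
        have "e1 \<le> 3 / 16 * (b * \<gamma> * n)"
        proof -
          have lb: "\<gamma>\<^sup>2 \<le> (L1 + b / 2 * \<gamma>) * n"
          proof -
            have "\<gamma>\<^sup>2 = norm (M *v s)" using Ms g2 by (metis add_eq_0_iff norm_minus_cancel)
            also have "\<dots> \<le> norm (H *v s) + norm ((b / 2 * \<gamma>) *\<^sub>R s)" unfolding Mv by (rule norm_triangle_ineq)
            also have "\<dots> \<le> (L1 + b / 2 * \<gamma>) * n"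
              using H(2)[of s] pos \<gamma>0 by (simp add: n_def algebra_simps)
            finally show ?thesis .
          qed
          have "b * \<gamma> * e1 \<le> b * \<gamma> * (\<gamma>\<^sup>2 / 96)" using e1\<gamma> pos \<gamma>0 by (intro mult_left_mono) auto
          moreover have "b * w ^ 3 \<le> b * \<gamma> ^ 3" using w3\<gamma>3 pos by simp
          moreover have "0 \<le> b * \<gamma> ^ 3" using pos \<gamma>0 by simp
          ultimately have "(L1 + b / 2 * \<gamma>) * e1 \<le> 3 / 16 * (b * \<gamma> ^ 3)"
            using e1(4) by (simp add: algebra_simps power2_eq_square power3_eq_cube)
          also have "\<dots> = 3 / 16 * b * \<gamma> * \<gamma>\<^sup>2" by (simp add: power2_eq_square power3_eq_cube)
          also have "\<dots> \<le> 3 / 16 * b * \<gamma> * ((L1 + b / 2 * \<gamma>) * n)"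
            using lb pos \<gamma>0 by (intro mult_left_mono) auto
          finally have "(L1 + b / 2 * \<gamma>) * e1 \<le> (L1 + b / 2 * \<gamma>) * (3 / 16 * (b * \<gamma> * n))"
            by (simp add: algebra_simps)
          moreover have "0 < L1 + b / 2 * \<gamma>" using pos \<gamma>0 by (simp add: add_pos_nonneg)
          ultimately show ?thesis by (rule mult_left_le_imp_le)
        qed
        then have "e1 * n \<le> 3 / 16 * (b * \<gamma> * n) * n" using n0 by (rule mult_right_mono)
        then have "P' \<le> P" using desc' l0 by (simp add: power2_eq_square algebra_simps)
        moreover have "norm g' \<le> norm g / 3"
        proof -
          have gH: "g + H *v s = - ((b / 2 * \<gamma>) *\<^sub>R s)"
            using Ms by (simp add: Mv algebra_simps eq_neg_iff_add_eq_0)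
          \<comment> \<open>The new gradient splits into the inexactness at both ends, the Taylor
            remainder, the Hessian error and the residual \<open>g + H *v s\<close>. Their bounds
            add up to 3/16 of \<open>\<gamma>\<^sup>2\<close>.\<close>
          have "g' = (g' - gP') + (gP' - gP - HP *v s) - (g - gP) - (H *v s - HP *v s) + (g + H *v s)"
            by simp
          then have "norm g' \<le> norm (g' - gP') + norm (gP' - gP - HP *v s) + norm (g - gP)
             + norm (H *v s - HP *v s) + norm (g + H *v s)"
            by (smt (verit) norm_triangle_ineq norm_triangle_ineq4)
          also have "\<dots> \<le> 2 * e1 + b\<^sup>2 / 2 * n\<^sup>2 + b * w / 24 * n + b / 2 * \<gamma> * n"
            using e1 gP' e2[of s] pos \<gamma>0 unfolding gH by (simp add: n_def)
          also have "\<dots> = 2 * e1 + (b * n)\<^sup>2 / 2 + w * (b * n) / 24 + \<gamma> * (b * n) / 2"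
            by (simp add: power_mult_distrib algebra_simps)
          also have "\<dots> \<le> 2 * (\<gamma>\<^sup>2 / 96) + (\<gamma> / 4)\<^sup>2 / 2 + \<gamma> * (\<gamma> / 4) / 24 + \<gamma> * (\<gamma> / 4) / 2"
            using e10 e1\<gamma> bn True pos \<gamma>0 n0
            by (intro add_mono divide_right_mono mult_mono power_mono) auto
          also have "\<dots> \<le> \<gamma>\<^sup>2 / 3" by (simp add: power2_eq_square)
          finally show ?thesis by (simp add: g2)
        qed
        ultimately show ?thesis using False by simp
      qed
    next
      case False
      \<comment> \<open>On the boundary, in units of \<open>\<gamma> ^ 3 / b\<close>, the gain is
        9/768 and the gradient error 2/768; the difference exceeds
        \<open>1/128 = 6/768\<close>.\<close>
      then have ns: "n = \<gamma> / (4 * b)" using lam(3) True by (simp add: n_def max_def)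
      have "e1 * n \<le> \<gamma>\<^sup>2 / 96 * n" using e1\<gamma> n0 by (rule mult_right_mono)
      moreover have "0 \<le> 1/2 * lam * n\<^sup>2" using lam(1) by simp
      ultimately have "P' - P \<le> \<gamma>\<^sup>2 / 96 * n - 3 / 16 * (b * \<gamma> * n\<^sup>2)" using desc' by linarith
      also have "\<dots> = - (7 / 768 * (\<gamma> ^ 3 / b))"
        unfolding ns using pos by (simp add: power2_eq_square power3_eq_cube field_simps)
      finally have "P' - P \<le> - (7 / 768 * (\<gamma> ^ 3 / b))" .
      moreover have "w ^ 3 / b \<le> \<gamma> ^ 3 / b" using w3\<gamma>3 pos by (intro divide_right_mono) auto
      moreover have "w ^ 3 / (128 * b) = 6 / 768 * (w ^ 3 / b)" by simp
      moreover have "0 \<le> w ^ 3 / b" using pos by simp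
      ultimately have "P' \<le> P - w ^ 3 / (128 * b)" by linarith
      then show ?thesis by simp
    qed
  next
    case False
    then have \<gamma>w: "\<gamma> < w" by simp
    have gw: "norm g < 3 * w\<^sup>2"
    proof -
      have "\<gamma>\<^sup>2 \<le> w\<^sup>2" using \<gamma>w \<gamma>0 by (simp add: power_mono)
      moreover have "0 < w\<^sup>2" using pos by simp
      ultimately show ?thesis using g2 by linarith
    qed
    show ?thesis
    \<comment> \<open>The model gradient is already small, so only curvature is at stake; up to the
      level \<open>b * w\<close> the multiplier still certifies it.\<close>
    proof (cases "lam \<le> b * w")
      case True
      have "- (2 * b * w * (norm v)\<^sup>2) \<le> v \<bullet> (H *v v)" for v
      proof -
        have "b * \<gamma> \<le> b * w" using \<gamma>w pos by simp
        moreover have "0 < b * w" using pos by simp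
        ultimately have "b / 2 * \<gamma> + lam \<le> 2 * b * w" using True by simp
        then have "(b / 2 * \<gamma> + lam) * (norm v)\<^sup>2 \<le> 2 * b * w * (norm v)\<^sup>2"
          by (intro mult_right_mono) auto
        then show ?thesis using curvH[of v] by simp
      qed
      then show ?thesis using gw by simp
    next
      case lam_big: False
      then have "lam \<noteq> 0" using pos by auto
      \<comment> \<open>The multiplier term takes over the role of the regularization: in units of
        \<open>w ^ 3 / b\<close> it gains 24/768, and the three errors cost 2, 1 and 2 of these
        parts.\<close>
      then have ns: "n = w / (4 * b)" using lam(3) \<gamma>w by (simp add: n_def max_def)
      have "b * w * n\<^sup>2 \<le> lam * n\<^sup>2" using lam_big by (intro mult_right_mono) auto
      moreover have "e1 * n \<le> w\<^sup>2 / 96 * n" using e1(3) w32 n0 by (intro mult_right_mono) auto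
      moreover have "0 \<le> b / 4 * \<gamma> * n\<^sup>2" using pos \<gamma>0 by simp
      ultimately have "P' - P \<le> w\<^sup>2 / 96 * n - 1/2 * (b * w * n\<^sup>2) + b * w / 48 * n\<^sup>2 + b\<^sup>2 / 6 * n ^ 3"
        using desc by linarith
      also have "\<dots> = - (19 / 768 * (w ^ 3 / b))"
        unfolding ns using pos by (simp add: power2_eq_square power3_eq_cube field_simps)
      finally have "P' - P \<le> - (19 / 768 * (w ^ 3 / b))" .
      moreover have "w ^ 3 / (128 * b) = 6 / 768 * (w ^ 3 / b)" by simp
      moreover have "0 \<le> w ^ 3 / b" using pos by simp
      ultimately have "P' \<le> P - w ^ 3 / (128 * b)" by linarith
      then show ?thesis by simp
    qed
  qed
qed

section \<open>The primal function\<close>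

text \<open>Made for \<open>primal f\<close>, whose increments are squeezed quadratically before
  anything is known about differentiability of \<open>y_star f\<close>.\<close>

lemma gderivI_quadratic:
  assumes "\<And>h. \<bar>F (x + h) - F x - h \<bullet> D\<bar> \<le> K * (norm h)\<^sup>2"
  shows "GDERIV F x :> D"
  unfolding gderiv_def has_derivative_at_alt
proof (intro conjI allI impI)
  show "bounded_linear (\<lambda>h. h \<bullet> D)" by (rule bounded_linear_inner_left)
  fix e :: real assume e: "0 < e"
  define \<delta> where "\<delta> = e / (\<bar>K\<bar> + 1)"
  have \<delta>: "0 < \<delta>" using e by (simp add: \<delta>_def add_nonneg_pos)
  show "\<exists>d>0. \<forall>y. norm (y - x) < d \<longrightarrow> norm (F y - F x - (y - x) \<bullet> D) \<le> e * norm (y - x)"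
  proof (intro exI[of _ \<delta>] conjI allI impI \<delta>)
    fix y assume y: "norm (y - x) < \<delta>"
    have "norm (F y - F x - (y - x) \<bullet> D) \<le> K * (norm (y - x))\<^sup>2"
      using assms[of "y - x"] by simp
    also have "\<dots> \<le> (\<bar>K\<bar> + 1) * (norm (y - x))\<^sup>2" by (intro mult_right_mono) auto
    also have "\<dots> = ((\<bar>K\<bar> + 1) * norm (y - x)) * norm (y - x)" by (simp add: power2_eq_square)
    also have "\<dots> \<le> ((\<bar>K\<bar> + 1) * \<delta>) * norm (y - x)"
      using y by (intro mult_right_mono mult_left_mono) auto
    also have "(\<bar>K\<bar> + 1) * \<delta> = e" by (simp add: \<delta>_def add_nonneg_pos)
    finally show "norm (F y - F x - (y - x) \<bullet> D) \<le> e * norm (y - x)" .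
  qed
qed

text \<open>One positive \<open>t\<close> for each \<open>e\<close> suffices to carry an inequality
  from difference quotients over to \<open>D v\<close>.\<close>

lemma has_derivative_small_increment:
  assumes "(G has_derivative D) (at x)" "0 < e"
  obtains t where "0 < t" "norm (G (x + t *\<^sub>R v) - G x - t *\<^sub>R D v) \<le> e * t"
proof -
  have e': "0 < e / (norm v + 1)" using assms(2) by (simp add: add_nonneg_pos)
  obtain \<delta> where \<delta>: "0 < \<delta>"
    and small: "\<And>y. norm (y - x) < \<delta> \<Longrightarrow> norm (G y - G x - D (y - x)) \<le> e / (norm v + 1) * norm (y - x)"
    using assms(1) e' unfolding has_derivative_at_alt by blast
  define t where "t = \<delta> / (norm v + 1)"
  have t: "0 < t" using \<delta> by (simp add: t_def add_nonneg_pos)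
  have n1: "0 < norm v + 1" by (simp add: add_nonneg_pos)
  have "t * norm v < t * (norm v + 1)" using t by simp
  also have "\<dots> = \<delta>" using n1 by (simp add: t_def)
  finally have "norm (G (x + t *\<^sub>R v) - G x - D (t *\<^sub>R v)) \<le> e / (norm v + 1) * (t * norm v)"
    using small[of "x + t *\<^sub>R v"] t by simp
  also have "\<dots> = (e * t) * (norm v / (norm v + 1))" by simp
  also have "\<dots> \<le> (e * t) * 1"
    using t assms(2) n1 by (intro mult_left_mono) (auto simp: pos_divide_le_eq)
  also have "D (t *\<^sub>R v) = t *\<^sub>R D v"
    using has_derivative_linear[OF assms(1)] by (simp add: linear_scale)
  finally show ?thesis using t that by simp
qed

lemma lipschitz_derivative_bound:
  assumes D: "(G has_derivative D) (at x)"
    and L: "\<And>y. norm (G y - G x) \<le> L * norm (y - x)"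
  shows "norm (D v) \<le> L * norm v"
proof (rule field_le_epsilon)
  fix e :: real assume e: "0 < e"
  obtain t where t: "0 < t" "norm (G (x + t *\<^sub>R v) - G x - t *\<^sub>R D v) \<le> e * t"
    by (rule has_derivative_small_increment[OF D e])
  have "norm (t *\<^sub>R D v) \<le> norm (G (x + t *\<^sub>R v) - G x) + e * t"
    using t(2) norm_triangle_sub[of "t *\<^sub>R D v" "G (x + t *\<^sub>R v) - G x"]
    by (simp add: norm_minus_commute)
  also have "\<dots> \<le> L * norm (t *\<^sub>R v) + e * t" using L[of "x + t *\<^sub>R v"] by simp
  finally have "t * norm (D v) \<le> t * (L * norm v + e)" using t(1) by (simp add: algebra_simps)
  then show "norm (D v) \<le> L * norm v + e" using t(1) by simp
qed

lemma strongly_monotone_derivative_bound: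
  assumes D: "(G has_derivative D) (at x)"
    and mono: "\<And>y. (y - x) \<bullet> (G y - G x) \<le> - \<mu> * (norm (y - x))\<^sup>2"
  shows "v \<bullet> D v \<le> - \<mu> * (norm v)\<^sup>2"
proof (rule field_le_epsilon)
  fix e :: real assume e: "0 < e"
  have n1: "0 < norm v + 1" by (simp add: add_nonneg_pos)
  then have e': "0 < e / (norm v + 1)" using e by simp
  obtain t where t: "0 < t" "norm (G (x + t *\<^sub>R v) - G x - t *\<^sub>R D v) \<le> e / (norm v + 1) * t"
    by (rule has_derivative_small_increment[OF D e'])
  have "- (v \<bullet> (G (x + t *\<^sub>R v) - G x - t *\<^sub>R D v)) \<le> norm v * (e / (norm v + 1) * t)"
    using norm_cauchy_schwarz[of "- v" "G (x + t *\<^sub>R v) - G x - t *\<^sub>R D v"] t(2)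
    by (smt (verit) inner_minus_left mult_left_mono norm_ge_zero norm_minus_cancel)
  also have "\<dots> = (e * t) * (norm v / (norm v + 1))" by simp
  also have "\<dots> \<le> (e * t) * 1"
    using t e n1 by (intro mult_left_mono) (auto simp: pos_divide_le_eq)
  finally have 1: "t * (v \<bullet> D v) \<le> v \<bullet> (G (x + t *\<^sub>R v) - G x) + e * t"
    by (simp add: inner_diff_right)
  have "t * (v \<bullet> (G (x + t *\<^sub>R v) - G x)) \<le> - \<mu> * (t * t) * (norm v)\<^sup>2"
    using mono[of "x + t *\<^sub>R v"] by (simp add: power2_eq_square algebra_simps)
  then have "t * (v \<bullet> (G (x + t *\<^sub>R v) - G x)) \<le> t * (- \<mu> * t * (norm v)\<^sup>2)" by (simp add: algebra_simps)
  then have "v \<bullet> (G (x + t *\<^sub>R v) - G x) \<le> - \<mu> * t * (norm v)\<^sup>2"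
    using t(1) by (rule mult_left_le_imp_le)
  with 1 have "t * (v \<bullet> D v) \<le> t * (- \<mu> * (norm v)\<^sup>2 + e)" by (simp add: algebra_simps)
  then show "v \<bullet> D v \<le> - \<mu> * (norm v)\<^sup>2 + e" using t by simp
qed

lemma transpose_eq_if_inner:
  fixes A :: "real^'i^'j" and B :: "real^'j^'i"
  assumes "\<And>u v. u \<bullet> (A *v v) = v \<bullet> (B *v u)"
  shows "transpose A = B"
proof -
  have "transpose A *v u = B *v u" for u
  proof (rule vector_eq_ldot[THEN iffD1, rule_format])
    fix v show "v \<bullet> (transpose A *v u) = v \<bullet> (B *v u)"
      using assms[of u v] by (simp add: dot_lmul_matrix[symmetric] inner_commute)
  qed
  then show ?thesis by (simp add: matrix_eq)
qed

lemma norm_matrix_vector_le_spectral_norm: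
  "norm (A *v v) \<le> spectral_norm A * norm v"
  unfolding spectral_norm_def by (rule onorm) (rule matrix_vector_mul_bounded_linear)

lemma spectral_lipschitzD:
  assumes "spectral_lipschitz L M"
  shows "norm (M z *v v - M z' *v v) \<le> L * norm (z - z') * norm v"
proof -
  have "norm ((M z - M z') *v v) \<le> spectral_norm (M z - M z') * norm v"
    by (rule norm_matrix_vector_le_spectral_norm)
  also have "\<dots> \<le> L * norm (z - z') * norm v"
    using assms unfolding spectral_lipschitz_def by (intro mult_right_mono) auto
  finally show ?thesis by (simp add: matrix_vector_mult_diff_rdistrib)
qed

text \<open>Partial derivatives combine to a total one when one of them is continuous. The spectral
  Lipschitz condition gives continuity of \<open>B\<close> as a bounded linear function, because the
  norm there is the operator norm.\<close>

lemma has_derivative_jacobian_partials: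
  fixes F :: "(real^'n) \<times> (real^'m) \<Rightarrow> real^'k"
  assumes A: "\<And>x y. ((\<lambda>u. F (u, y)) has_derivative (*v) (A (x, y))) (at x)"
    and B: "\<And>x y. ((\<lambda>v. F (x, v)) has_derivative (*v) (B (x, y))) (at y)"
    and lip: "spectral_lipschitz L B"
  shows "(F has_derivative (\<lambda>(h, k). A z *v h + B z *v k)) (at z)"
proof -
  obtain x y where z: "z = (x, y)" by fastforce
  define fy where "fy = (\<lambda>x y. Blinfun ((*v) (B (x, y))))"
  have fy: "blinfun_apply (fy x y) = (*v) (B (x, y))" for x y
    by (simp add: fy_def bounded_linear_Blinfun_apply)
  have lip': "norm (fy x' y' - fy x y) \<le> \<bar>L\<bar> * norm ((x', y') - (x, y))" for x' y'
  proof (rule norm_blinfun_bound)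
    fix v
    have "norm (B (x', y') *v v - B (x, y) *v v) \<le> L * norm ((x', y') - (x, y)) * norm v"
      by (rule spectral_lipschitzD[OF lip])
    also have "\<dots> \<le> \<bar>L\<bar> * norm ((x', y') - (x, y)) * norm v"
      by (intro mult_right_mono) auto
    finally show "norm (blinfun_apply (fy x' y' - fy x y) v) \<le> \<bar>L\<bar> * norm ((x', y') - (x, y)) * norm v"
      by (simp add: blinfun.diff_left fy)
  qed simp
  have "((\<lambda>z. fy (fst z) (snd z)) \<longlongrightarrow> fy x y) (at (x, y))"
  proof (rule LIM_zero_cancel, rule Lim_null_comparison)
    show "\<forall>\<^sub>F z in at (x, y). norm (fy (fst z) (snd z) - fy x y) \<le> \<bar>L\<bar> * norm (z - (x, y))"
      using lip' by (intro always_eventually) (metis prod.collapse)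
    have "((\<lambda>z. \<bar>L\<bar> * norm (z - (x, y))) \<longlongrightarrow> \<bar>L\<bar> * norm ((x, y) - (x, y))) (at (x, y))"
      by (intro tendsto_intros)
    then show "((\<lambda>z. \<bar>L\<bar> * norm (z - (x, y))) \<longlongrightarrow> 0) (at (x, y))" by simp
  qed
  then have cont: "continuous (at (x, y) within UNIV \<times> UNIV) (\<lambda>(x, y). fy x y)"
    by (simp add: continuous_within split_beta')
  have "((\<lambda>(x, y). F (x, y)) has_derivative (\<lambda>(tx, ty). A (x, y) *v tx + blinfun_apply (fy x y) ty))
      (at (x, y) within UNIV \<times> UNIV)"
    by (rule has_derivative_partialsI[OF _ _ cont]) (use A B in \<open>auto simp: fy\<close>)
  then show ?thesis by (simp add: z fy split_beta')
qed

section \<open>The maximizer and the gradient of the primal function\<close>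

locale minimax_problem =
  fixes f :: "(real^'n) \<times> (real^'m) \<Rightarrow> real" and \<mu> l \<rho> :: real
  assumes mu_pos: "0 < \<mu>" and rho_pos: "0 < \<rho>"
    and differentiable: "\<And>z. f differentiable (at z)"
    and strongly_concave: "\<And>x. strongly_concave \<mu> (\<lambda>y. f (x, y))"
    and lipschitz: "l-lipschitz_on UNIV (grad f)"
    and blocks: "hess_blocks_exist f"
    and lipschitz_xx: "spectral_lipschitz \<rho> (hess_xx f)"
    and lipschitz_xy: "spectral_lipschitz \<rho> (hess_xy f)"
    and lipschitz_yx: "spectral_lipschitz \<rho> (hess_yx f)"
    and lipschitz_yy: "spectral_lipschitz \<rho> (hess_yy f)"
begin

lemma gderiv: "GDERIV f z :> grad f z"
  by (rule differentiable_imp_gderiv_grad[OF differentiable])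

lemma gderiv_x: "GDERIV (\<lambda>u. f (u, y)) x :> fst (grad f (x, y))"
proof -
  have "((\<lambda>u. f (u, y)) has_derivative (\<lambda>h. (h, 0) \<bullet> grad f (x, y))) (at x)"
    by (rule has_derivative_compose[where f = "\<lambda>u. (u, y)" and g = f])
      (auto intro!: derivative_eq_intros gderiv[unfolded gderiv_def])
  then show ?thesis by (simp add: gderiv_def inner_prod_def)
qed

lemma gderiv_y: "GDERIV (\<lambda>v. f (x, v)) y :> snd (grad f (x, y))"
proof -
  have "((\<lambda>v. f (x, v)) has_derivative (\<lambda>h. (0, h) \<bullet> grad f (x, y))) (at y)"
    by (rule has_derivative_compose[where f = "\<lambda>v. (x, v)" and g = f])
      (auto intro!: derivative_eq_intros gderiv[unfolded gderiv_def])
  then show ?thesis by (simp add: gderiv_def inner_prod_def)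
qed

lemma grad_x_eq: "grad_x f z = fst (grad f z)"
  unfolding grad_x_def using gderiv_imp_grad[OF gderiv_x] by simp

lemma grad_y_eq: "grad_y f z = snd (grad f z)"
  unfolding grad_y_def using gderiv_imp_grad[OF gderiv_y] by simp

lemma grad_lipschitz: "norm (grad f z - grad f z') \<le> l * norm (z - z')"
  using lipschitz_onD[OF lipschitz, of z z'] by (simp add: dist_norm)

lemma grad_x_lipschitz: "norm (grad_x f z - grad_x f z') \<le> l * norm (z - z')"
proof -
  have "norm (fst w) \<le> norm w" for w :: "(real^'n) \<times> (real^'m)" by (metis norm_fst_le prod.collapse)
  from order.trans[OF this grad_lipschitz] show ?thesis by (simp add: grad_x_eq flip: fst_diff)
qed

lemma grad_y_lipschitz: "norm (grad_y f z - grad_y f z') \<le> l * norm (z - z')"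
proof -
  have "norm (snd w) \<le> norm w" for w :: "(real^'n) \<times> (real^'m)" by (metis norm_snd_le prod.collapse)
  from order.trans[OF this grad_lipschitz] show ?thesis by (simp add: grad_y_eq flip: snd_diff)
qed

lemma smooth_x: "\<bar>f (x + h, y) - f (x, y) - h \<bullet> grad_x f (x, y)\<bar> \<le> l / 2 * (norm h)\<^sup>2"
proof (rule lipschitz_gradient_quadratic_bound[where F = "\<lambda>u. f (u, y)" and G = "\<lambda>u. grad_x f (u, y)"])
  show "GDERIV (\<lambda>u. f (u, y)) z :> grad_x f (z, y)" for z unfolding grad_x_eq by (rule gderiv_x)
  show "norm (grad_x f (u, y) - grad_x f (v, y)) \<le> l * norm (u - v)" for u v
    using grad_x_lipschitz[of "(u, y)" "(v, y)"] by simp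
qed

lemma smooth_y: "f (x, v) + (u - v) \<bullet> grad_y f (x, v) - l / 2 * (norm (u - v))\<^sup>2 \<le> f (x, u)"
proof -
  have "\<bar>f (x, v + (u - v)) - f (x, v) - (u - v) \<bullet> grad_y f (x, v)\<bar> \<le> l / 2 * (norm (u - v))\<^sup>2"
  proof (rule lipschitz_gradient_quadratic_bound[where F = "\<lambda>u. f (x, u)" and G = "\<lambda>u. grad_y f (x, u)"])
    show "GDERIV (\<lambda>u. f (x, u)) z :> grad_y f (x, z)" for z unfolding grad_y_eq by (rule gderiv_y)
    show "norm (grad_y f (x, u) - grad_y f (x, v)) \<le> l * norm (u - v)" for u v
      using grad_y_lipschitz[of "(x, u)" "(x, v)"] by simp
  qed
  moreover have "v + (u - v) = u" by simp
  ultimately have "\<bar>f (x, u) - f (x, v) - (u - v) \<bullet> grad_y f (x, v)\<bar> \<le> l / 2 * (norm (u - v))\<^sup>2" by simp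
  then show ?thesis by linarith
qed

lemma concave_y: "f (x, u) \<le> f (x, v) + (u - v) \<bullet> grad_y f (x, v) - \<mu> / 2 * (norm (u - v))\<^sup>2"
  unfolding grad_y_eq by (rule strongly_concave_gradient_bound[OF strongly_concave gderiv_y])

lemma monotone_y: "(u - v) \<bullet> (grad_y f (x, u) - grad_y f (x, v)) \<le> - \<mu> * (norm (u - v))\<^sup>2"
  using concave_y[of x u v] concave_y[of x v u]
  by (simp add: inner_diff norm_minus_commute[of v u])

text \<open>Strong monotonicity and Lipschitz continuity of \<open>grad_y f\<close> bound the same
  difference on a unit vector from below and from above.\<close>

lemma mu_le_l: "\<mu> \<le> l"
proof -
  define v :: "real^'m" where "v = axis undefined 1"
  have v: "norm v = 1" by (simp add: v_def)
  have "\<mu> \<le> - ((v - 0) \<bullet> (grad_y f (0, v) - grad_y f (0, 0)))"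
    using monotone_y[of v 0 0] v by simp
  also have "\<dots> \<le> norm v * norm (grad_y f (0, v) - grad_y f (0, 0))"
    using norm_cauchy_schwarz[of "- v" "grad_y f (0, v) - grad_y f (0, 0)"] by simp
  also have "\<dots> \<le> l" using grad_y_lipschitz[of "(0, v)" "(0, 0)"] v by simp
  finally show ?thesis .
qed

lemma l_pos: "0 < l" using mu_pos mu_le_l by simp

lemma kappa_ge_1: "1 \<le> l / \<mu>" using mu_pos mu_le_l by simp

text \<open>Outside the ball of radius \<open>R\<close> the quadratic term outweighs the linear one,
  so values there are at most \<open>f (x, 0)\<close>; a maximizer over the compact ball is
  therefore global.\<close>

lemma exists_maximizer: "\<exists>y. \<forall>v. f (x, v) \<le> f (x, y)"
proof -
  define R where "R = 2 * norm (grad_y f (x, 0)) / \<mu>"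
  have R: "0 \<le> R" using mu_pos by (simp add: R_def)
  have "continuous_on (cball 0 R) (\<lambda>y. f (x, y))"
    using gderiv_y by (metis continuous_at_imp_continuous_on gderiv_def has_derivative_continuous)
  then obtain y where y: "y \<in> cball 0 R" "\<And>v. v \<in> cball 0 R \<Longrightarrow> f (x, v) \<le> f (x, y)"
    using continuous_attains_sup[of "cball 0 R" "\<lambda>y. f (x, y)"] R by auto
  have "f (x, v) \<le> f (x, y)" for v
  proof (cases "v \<in> cball 0 R")
    case False
    then have "R \<le> norm v" by simp
    then have "norm (grad_y f (x, 0)) \<le> \<mu> / 2 * norm v" using mu_pos by (simp add: R_def field_simps)
    then have "norm v * norm (grad_y f (x, 0)) \<le> norm v * (\<mu> / 2 * norm v)" by (rule mult_left_mono) simp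
    moreover have "v \<bullet> grad_y f (x, 0) \<le> norm v * norm (grad_y f (x, 0))" by (rule norm_cauchy_schwarz)
    ultimately have "f (x, v) \<le> f (x, 0)" using concave_y[of x v 0] by (simp add: power2_eq_square algebra_simps)
    also have "\<dots> \<le> f (x, y)" using y R by simp
    finally show ?thesis .
  qed (rule y)
  then show ?thesis by blast
qed

lemma y_star_max: "f (x, v) \<le> f (x, y_star f x)"
proof -
  have "is_arg_max (\<lambda>y. f (x, y)) (\<lambda>_. True) (y_star f x)"
    unfolding y_star_def arg_max_def
    by (rule someI_ex) (use exists_maximizer[of x] in \<open>auto simp: is_arg_max_def not_less\<close>)
  then show ?thesis by (auto simp: is_arg_max_def not_less)
qed

lemma primal_eq: "primal f x = f (x, y_star f x)"
  unfolding primal_def by (rule cSup_eq_maximum) (auto intro: y_star_max)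

text \<open>From a point with nonzero gradient an ascent step of length \<open>1 / l\<close> would
  exceed the maximum.\<close>

lemma grad_y_y_star: "grad_y f (x, y_star f x) = 0"
proof -
  define g where "g = grad_y f (x, y_star f x)"
  have "f (x, y_star f x) + ((1 / l) *\<^sub>R g) \<bullet> g - l / 2 * (norm ((1 / l) *\<^sub>R g))\<^sup>2
      \<le> f (x, y_star f x + (1 / l) *\<^sub>R g)"
    using smooth_y[of x "y_star f x" "y_star f x + (1 / l) *\<^sub>R g"] by (simp add: g_def)
  also have "\<dots> \<le> f (x, y_star f x)" by (rule y_star_max)
  finally have "(norm g)\<^sup>2 / l \<le> (norm g)\<^sup>2 / (2 * l)"
    using l_pos by (simp add: power2_norm_eq_inner power_mult_distrib power2_eq_square[of l] inner_commute field_simps mult_le_0_iff)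
  then show ?thesis using l_pos by (simp add: g_def field_simps mult_le_0_iff)
qed

text \<open>Each \<open>y\<close>-gradient vanishes at its own maximizer. Strong monotonicity at
  \<open>x\<close> is therefore played against the change of \<open>grad_y f\<close> from
  \<open>x'\<close> to \<open>x\<close> at the fixed point \<open>y_star f x'\<close>.\<close>

lemma y_star_lipschitz: "norm (y_star f x - y_star f x') \<le> l / \<mu> * norm (x - x')"
proof -
  define d where "d = y_star f x - y_star f x'"
  have "\<mu> * (norm d)\<^sup>2 \<le> - (d \<bullet> (grad_y f (x, y_star f x) - grad_y f (x, y_star f x')))"
    using monotone_y[of "y_star f x" "y_star f x'" x] by (simp add: d_def)
  also have "\<dots> = d \<bullet> (grad_y f (x, y_star f x') - grad_y f (x', y_star f x'))"
    by (simp add: grad_y_y_star)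
  also have "\<dots> \<le> norm d * norm (grad_y f (x, y_star f x') - grad_y f (x', y_star f x'))"
    by (rule norm_cauchy_schwarz)
  also have "\<dots> \<le> norm d * (l * norm (x - x'))"
    using grad_y_lipschitz[of "(x, y_star f x')" "(x', y_star f x')"] by (intro mult_left_mono) auto
  finally have "norm d * (\<mu> * norm d) \<le> norm d * (l * norm (x - x'))"
    by (simp add: power2_eq_square algebra_simps)
  then have "\<mu> * norm d \<le> l * norm (x - x')"
    using l_pos by (cases "norm d = 0") (auto simp: mult_le_cancel_left)
  then show ?thesis using mu_pos by (simp add: d_def field_simps)
qed

text \<open>Source of the factor \<open>1 + l / \<mu>\<close> that leads from \<open>l\<close> to
  \<open>L1\<close> and from \<open>LH\<close> to \<open>L2\<close>.\<close>

lemma norm_graph_y_star: "norm ((x, y_star f x) - (x', y_star f x')) \<le> (1 + l / \<mu>) * norm (x - x')"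
  using norm_Pair_le[of "x - x'" "y_star f x - y_star f x'"] y_star_lipschitz[of x x']
  by (simp add: distrib_right)

text \<open>Danskin's theorem by squeezing: freezing \<open>y\<close> at the maximizer for
  \<open>x + h\<close> gives the upper bound, freezing it at the one for \<open>x\<close> the lower
  bound. Lipschitz continuity of \<open>y_star f\<close> makes the upper one quadratic too.\<close>

lemma gderiv_primal: "GDERIV (primal f) x :> grad_x f (x, y_star f x)"
proof (rule gderivI_quadratic)
  fix h :: "real^'n"
  define g where "g = grad_x f (x, y_star f x)"
  have nn: "0 \<le> l * (l / \<mu>) * (norm h)\<^sup>2" using l_pos mu_pos by simp
  have up: "primal f (x + h) - primal f x - h \<bullet> g \<le> (l / 2 + l * (l / \<mu>)) * (norm h)\<^sup>2"
  proof -
    define y' where "y' = y_star f (x + h)"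
    have "primal f (x + h) - primal f x \<le> f (x + h, y') - f (x, y')"
      using y_star_max[of x y'] by (simp add: primal_eq y'_def)
    also have "\<dots> \<le> h \<bullet> grad_x f (x, y') + l / 2 * (norm h)\<^sup>2"
      using smooth_x[of x h y'] by linarith
    also have "h \<bullet> grad_x f (x, y') = h \<bullet> g + h \<bullet> (grad_x f (x, y') - g)" by (simp add: inner_diff_right)
    also have "h \<bullet> (grad_x f (x, y') - g) \<le> norm h * norm (grad_x f (x, y') - g)" by (rule norm_cauchy_schwarz)
    also have "\<dots> \<le> norm h * (l * (l / \<mu> * norm h))"
    proof (rule mult_left_mono)
      have "norm (grad_x f (x, y') - g) \<le> l * norm (y' - y_star f x)"
        using grad_x_lipschitz[of "(x, y')" "(x, y_star f x)"] by (simp add: g_def)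
      also have "\<dots> \<le> l * (l / \<mu> * norm h)"
        using y_star_lipschitz[of "x + h" x] l_pos by (intro mult_left_mono) (auto simp: y'_def)
      finally show "norm (grad_x f (x, y') - g) \<le> l * (l / \<mu> * norm h)" .
    qed simp
    finally show ?thesis by (simp add: power2_eq_square algebra_simps)
  qed
  have lo: "- (l / 2 * (norm h)\<^sup>2) \<le> primal f (x + h) - primal f x - h \<bullet> g"
    using smooth_x[of x h "y_star f x"] y_star_max[of "x + h" "y_star f x"]
    unfolding primal_eq g_def by linarith
  show "\<bar>primal f (x + h) - primal f x - h \<bullet> g\<bar> \<le> (l / 2 + l * (l / \<mu>)) * (norm h)\<^sup>2"
    using up lo nn by (simp add: algebra_simps)
qed

lemma grad_primal: "grad (primal f) x = grad_x f (x, y_star f x)"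
  by (rule gderiv_imp_grad[OF gderiv_primal])

lemma gderiv_primal_grad: "GDERIV (primal f) x :> grad (primal f) x"
  unfolding grad_primal by (rule gderiv_primal)

lemma grad_primal_lipschitz:
  "norm (grad (primal f) x - grad (primal f) x') \<le> (l / \<mu> + 1) * l * norm (x - x')"
proof -
  have "norm (grad (primal f) x - grad (primal f) x') \<le> l * norm ((x, y_star f x) - (x', y_star f x'))"
    unfolding grad_primal by (rule grad_x_lipschitz)
  also have "\<dots> \<le> l * ((1 + l / \<mu>) * norm (x - x'))"
    using norm_graph_y_star l_pos by (intro mult_left_mono) auto
  finally show ?thesis by (simp add: algebra_simps)
qed

section \<open>Second-derivative blocks and the Hessian of the primal function\<close>

lemma deriv_xx: "((\<lambda>u. grad_x f (u, y)) has_derivative (*v) (hess_xx f (x, y))) (at x)"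
  using blocks unfolding hess_blocks_exist_def hess_xx_def by (simp add: jacobian_works)

lemma deriv_xy: "((\<lambda>v. grad_x f (x, v)) has_derivative (*v) (hess_xy f (x, y))) (at y)"
  using blocks unfolding hess_blocks_exist_def hess_xy_def by (simp add: jacobian_works)

lemma deriv_yx: "((\<lambda>u. grad_y f (u, y)) has_derivative (*v) (hess_yx f (x, y))) (at x)"
  using blocks unfolding hess_blocks_exist_def hess_yx_def by (simp add: jacobian_works)

lemma deriv_yy: "((\<lambda>v. grad_y f (x, v)) has_derivative (*v) (hess_yy f (x, y))) (at y)"
  using blocks unfolding hess_blocks_exist_def hess_yy_def by (simp add: jacobian_works)

lemma deriv_grad_x: "(grad_x f has_derivative (\<lambda>(h, k). hess_xx f z *v h + hess_xy f z *v k)) (at z)"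
  by (rule has_derivative_jacobian_partials[OF deriv_xx deriv_xy lipschitz_xy])

lemma deriv_grad_y: "(grad_y f has_derivative (\<lambda>(h, k). hess_yx f z *v h + hess_yy f z *v k)) (at z)"
  by (rule has_derivative_jacobian_partials[OF deriv_yx deriv_yy lipschitz_yy])

lemma deriv_grad: "(grad f has_derivative
    (\<lambda>w. (hess_xx f z *v fst w + hess_xy f z *v snd w, hess_yx f z *v fst w + hess_yy f z *v snd w))) (at z)"
proof -
  have "grad f = (\<lambda>z. (grad_x f z, grad_y f z))" by (simp add: grad_x_eq grad_y_eq)
  then show ?thesis
    using has_derivative_Pair[OF deriv_grad_x deriv_grad_y] by (simp add: split_beta')
qed

lemma norm_hess_xx: "norm (hess_xx f z *v v) \<le> l * norm v"
  using lipschitz_derivative_bound[OF deriv_grad_x, where L = l and v = "(v, 0)"] grad_x_lipschitz by simp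

lemma norm_hess_xy: "norm (hess_xy f z *v v) \<le> l * norm v"
  using lipschitz_derivative_bound[OF deriv_grad_x, where L = l and v = "(0, v)"] grad_x_lipschitz by simp

lemma norm_hess_yx: "norm (hess_yx f z *v v) \<le> l * norm v"
  using lipschitz_derivative_bound[OF deriv_grad_y, where L = l and v = "(v, 0)"] grad_y_lipschitz by simp

lemma hess_xx_symmetric: "transpose (hess_xx f z) = hess_xx f z"
proof (rule transpose_eq_if_inner)
  fix u v
  show "u \<bullet> (hess_xx f z *v v) = v \<bullet> (hess_xx f z *v u)"
    using gradient_derivative_symmetric[OF gderiv deriv_grad, of "(u, 0)" z "(v, 0)"] by simp
qed

lemma hess_yy_symmetric: "transpose (hess_yy f z) = hess_yy f z"
proof (rule transpose_eq_if_inner)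
  fix u v
  show "u \<bullet> (hess_yy f z *v v) = v \<bullet> (hess_yy f z *v u)"
    using gradient_derivative_symmetric[OF gderiv deriv_grad, of "(0, u)" z "(0, v)"] by simp
qed

lemma transpose_hess_xy: "transpose (hess_xy f z) = hess_yx f z"
proof (rule transpose_eq_if_inner)
  fix u v
  show "u \<bullet> (hess_xy f z *v v) = v \<bullet> (hess_yx f z *v u)"
    using gradient_derivative_symmetric[OF gderiv deriv_grad, of "(u, 0)" z "(0, v)"] by simp
qed

lemma hess_yy_negative: "v \<bullet> (hess_yy f z *v v) \<le> - \<mu> * (norm v)\<^sup>2"
proof -
  obtain x y where z: "z = (x, y)" by fastforce
  show ?thesis unfolding z by (rule strongly_monotone_derivative_bound[OF deriv_yy monotone_y])
qed

lemma norm_hess_yy_ge: "\<mu> * norm v \<le> norm (hess_yy f z *v v)"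
proof (cases "v = 0")
  case False
  have "\<mu> * (norm v)\<^sup>2 \<le> (- v) \<bullet> (hess_yy f z *v v)" using hess_yy_negative[of v z] by simp
  also have "\<dots> \<le> norm v * norm (hess_yy f z *v v)" by (metis norm_cauchy_schwarz norm_minus_cancel)
  finally have "norm v * (\<mu> * norm v) \<le> norm v * norm (hess_yy f z *v v)"
    by (simp add: power2_eq_square algebra_simps)
  then show ?thesis using False by simp
qed simp

lemma hess_yy_invertible: "invertible (hess_yy f z)"
proof -
  have "x = 0" if "hess_yy f z *v x = 0" for x
    using norm_hess_yy_ge[of x z] that mu_pos by (simp add: mult_le_0_iff)
  then have "\<exists>B. B ** hess_yy f z = mat 1" by (simp add: matrix_left_invertible_ker)
  then show ?thesis by (simp add: invertible_left_inverse)
qed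

lemma hess_yy_inv:
  "matrix_inv (hess_yy f z) ** hess_yy f z = mat 1" "hess_yy f z ** matrix_inv (hess_yy f z) = mat 1"
  using hess_yy_invertible[of z] unfolding matrix_inv_def invertible_def
  by (metis (mono_tags, lifting) someI_ex)+

lemma hess_yy_inv_vec: "hess_yy f z *v (matrix_inv (hess_yy f z) *v v) = v"
  "matrix_inv (hess_yy f z) *v (hess_yy f z *v v) = v"
  by (simp_all add: matrix_vector_mul_assoc hess_yy_inv)

lemma norm_hess_yy_inv: "norm (matrix_inv (hess_yy f z) *v v) \<le> norm v / \<mu>"
  using norm_hess_yy_ge[of "matrix_inv (hess_yy f z) *v v" z] mu_pos
  by (simp add: hess_yy_inv_vec field_simps)

lemma schur_H_vec: "schur_H f z *v v
    = hess_xx f z *v v - hess_xy f z *v (matrix_inv (hess_yy f z) *v (hess_yx f z *v v))"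
  by (simp add: schur_H_def matrix_vector_mult_diff_rdistrib flip: matrix_vector_mul_assoc)

lemma norm_schur_H: "norm (schur_H f z *v v) \<le> (l / \<mu> + 1) * l * norm v"
proof -
  have "norm (hess_xy f z *v (matrix_inv (hess_yy f z) *v (hess_yx f z *v v)))
      \<le> l * norm (matrix_inv (hess_yy f z) *v (hess_yx f z *v v))" by (rule norm_hess_xy)
  also have "\<dots> \<le> l * (norm (hess_yx f z *v v) / \<mu>)"
    using l_pos norm_hess_yy_inv by (intro mult_left_mono) auto
  also have "\<dots> \<le> l * (l * norm v / \<mu>)"
    using l_pos mu_pos norm_hess_yx by (intro mult_left_mono divide_right_mono) auto
  finally show ?thesis
    using norm_hess_xx[of z v] norm_triangle_ineq4[of "hess_xx f z *v v"
      "hess_xy f z *v (matrix_inv (hess_yy f z) *v (hess_yx f z *v v))"]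
    by (simp add: schur_H_vec algebra_simps)
qed

lemma schur_H_symmetric: "transpose (schur_H f z) = schur_H f z"
proof (rule transpose_eq_if_inner)
  fix u v
  have yx: "a \<bullet> (hess_xy f z *v b) = b \<bullet> (hess_yx f z *v a)" for a b
    using transpose_hess_xy[of z] by (metis dot_lmul_matrix inner_commute vector_transpose_matrix transpose_transpose)
  have yy: "a \<bullet> (hess_yy f z *v b) = b \<bullet> (hess_yy f z *v a)" for a b
    using hess_yy_symmetric[of z] by (metis dot_lmul_matrix inner_commute vector_transpose_matrix)
  have inv: "a \<bullet> (matrix_inv (hess_yy f z) *v b) = b \<bullet> (matrix_inv (hess_yy f z) *v a)" for a b
    using yy[of "matrix_inv (hess_yy f z) *v a" "matrix_inv (hess_yy f z) *v b"]
    by (simp add: hess_yy_inv_vec inner_commute)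
  have xx: "u \<bullet> (hess_xx f z *v v) = v \<bullet> (hess_xx f z *v u)"
    using hess_xx_symmetric[of z] by (metis dot_lmul_matrix inner_commute vector_transpose_matrix)
  show "u \<bullet> (schur_H f z *v v) = v \<bullet> (schur_H f z *v u)"
    unfolding schur_H_vec inner_diff_right xx yx
    by (metis inv inner_commute)
qed

text \<open>The factors of the product are exchanged one at a time, the inverse through
  \<open>i - i' = i (hess_yy f z' - hess_yy f z) i'\<close>. Together with the \<open>xx\<close>
  block this gives \<open>1 + k + k\<^sup>2 + k = (1 + k)\<^sup>2\<close>.\<close>

lemma schur_H_lipschitz:
  "norm (schur_H f z *v v - schur_H f z' *v v) \<le> \<rho> * (1 + l / \<mu>)\<^sup>2 * norm (z - z') * norm v"
proof -
  define d where "d = norm (z - z')"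
  define k where "k = l / \<mu>"
  have k: "0 \<le> k" "\<And>a. l * (a / \<mu>) = k * a" using l_pos mu_pos by (auto simp: k_def)
  define i where "i = matrix_inv (hess_yy f z)"
  define i' where "i' = matrix_inv (hess_yy f z')"
  define a where "a = hess_yx f z *v v"
  define a' where "a' = hess_yx f z' *v v"
  have d0: "0 \<le> \<rho> * d" using rho_pos by (simp add: d_def)
  have na: "norm a \<le> l * norm v" "norm a' \<le> l * norm v" by (auto simp: a_def a'_def norm_hess_yx)
  have xx: "norm (hess_xx f z *v v - hess_xx f z' *v v) \<le> \<rho> * d * norm v"
    unfolding d_def by (rule spectral_lipschitzD[OF lipschitz_xx])
  have t1: "norm (hess_xy f z *v (i *v (a - a'))) \<le> k * (\<rho> * d * norm v)"
  proof -
    have "norm (hess_xy f z *v (i *v (a - a'))) \<le> l * (norm (a - a') / \<mu>)"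
      using norm_hess_xy[of z "i *v (a - a')"] norm_hess_yy_inv[of z "a - a'"] l_pos
      by (smt (verit) i_def mult_left_mono)
    also have "\<dots> = k * norm (a - a')" by (rule k)
    also have "\<dots> \<le> k * (\<rho> * d * norm v)"
      unfolding a_def a'_def d_def using k by (intro mult_left_mono spectral_lipschitzD[OF lipschitz_yx])
    finally show ?thesis .
  qed
  have t2: "norm (hess_xy f z *v (i *v a' - i' *v a')) \<le> k * (\<rho> * d * (k * norm v))"
  proof -
    have ni': "norm (i' *v a') \<le> k * norm v"
    proof -
      have "norm (i' *v a') \<le> norm a' / \<mu>" unfolding i'_def by (rule norm_hess_yy_inv)
      also have "\<dots> \<le> l * norm v / \<mu>" using na mu_pos by (intro divide_right_mono) auto
      finally show ?thesis by (simp add: k_def)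
    qed
    have eq: "i *v a' - i' *v a' = i *v (hess_yy f z' *v (i' *v a') - hess_yy f z *v (i' *v a'))"
      by (simp add: matrix_vector_mult_diff_distrib i_def i'_def hess_yy_inv_vec)
    have "norm (hess_xy f z *v (i *v a' - i' *v a'))
        \<le> l * (norm (hess_yy f z' *v (i' *v a') - hess_yy f z *v (i' *v a')) / \<mu>)"
      unfolding eq
      using norm_hess_xy[of z "i *v (hess_yy f z' *v (i' *v a') - hess_yy f z *v (i' *v a'))"]
        norm_hess_yy_inv[of z "hess_yy f z' *v (i' *v a') - hess_yy f z *v (i' *v a')"] l_pos
      by (smt (verit) i_def mult_left_mono)
    also have "\<dots> = k * norm (hess_yy f z' *v (i' *v a') - hess_yy f z *v (i' *v a'))" by (rule k)
    also have "\<dots> \<le> k * (\<rho> * d * norm (i' *v a'))"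
      using k spectral_lipschitzD[OF lipschitz_yy, of z' "i' *v a'" z]
      by (intro mult_left_mono) (auto simp: d_def norm_minus_commute)
    also have "\<dots> \<le> k * (\<rho> * d * (k * norm v))"
      using ni' k d0 by (intro mult_left_mono) auto
    finally show ?thesis .
  qed
  have t3: "norm (hess_xy f z *v (i' *v a') - hess_xy f z' *v (i' *v a')) \<le> \<rho> * d * (k * norm v)"
  proof -
    have "norm (hess_xy f z *v (i' *v a') - hess_xy f z' *v (i' *v a')) \<le> \<rho> * d * norm (i' *v a')"
      unfolding d_def by (rule spectral_lipschitzD[OF lipschitz_xy])
    also have "norm (i' *v a') \<le> norm a' / \<mu>" unfolding i'_def by (rule norm_hess_yy_inv)
    also have "\<dots> \<le> l * norm v / \<mu>" using na mu_pos by (intro divide_right_mono) auto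
    finally show ?thesis using d0 by (simp add: k_def mult_left_mono)
  qed
  have "schur_H f z *v v - schur_H f z' *v v = (hess_xx f z *v v - hess_xx f z' *v v)
      - hess_xy f z *v (i *v (a - a')) - hess_xy f z *v (i *v a' - i' *v a')
      - (hess_xy f z *v (i' *v a') - hess_xy f z' *v (i' *v a'))"
    by (simp add: schur_H_vec a_def a'_def i_def i'_def matrix_vector_mult_diff_distrib)
  also have "norm \<dots> \<le> \<rho> * d * norm v + k * (\<rho> * d * norm v) + k * (\<rho> * d * (k * norm v))
      + \<rho> * d * (k * norm v)"
    by (intro order.trans[OF norm_triangle_ineq4] add_mono xx t1 t2 t3)
  also have "\<dots> = \<rho> * (1 + k)\<^sup>2 * d * norm v" by (simp add: power2_eq_square algebra_simps)
  finally show ?thesis by (simp add: k_def d_def)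
qed

text \<open>Implicit differentiation without an implicit function theorem: \<open>grad_y f\<close>
  vanishes along the graph of \<open>y_star f\<close>, so its linearization there is of smaller
  order than the increment. As \<open>y_star f\<close> is already Lipschitz, this is also smaller
  order in \<open>x\<close>, and the inverse block solves for the increment of
  \<open>y_star f\<close>.\<close>

lemma deriv_y_star:
  "(y_star f has_derivative
      (\<lambda>h. - (matrix_inv (hess_yy f (x, y_star f x)) *v (hess_yx f (x, y_star f x) *v h)))) (at x)"
  unfolding has_derivative_at_alt
proof (intro conjI allI impI)
  define z where "z = (x, y_star f x)"
  define i where "i = matrix_inv (hess_yy f z)"
  show "bounded_linear (\<lambda>h. - (matrix_inv (hess_yy f (x, y_star f x)) *v (hess_yx f (x, y_star f x) *v h)))"
    by (intro bounded_linear_minus bounded_linear_compose[OF matrix_vector_mul_bounded_linear]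
        matrix_vector_mul_bounded_linear)
  fix e :: real assume e: "0 < e"
  define c where "c = 1 + l / \<mu>"
  have c: "1 \<le> c" using kappa_ge_1 by (simp add: c_def)
  \<comment> \<open>\<open>c\<close> bounds the stretching by the graph and \<open>1 / \<mu>\<close>
    the inverse block; both losses are compensated here.\<close>
  have e': "0 < e * \<mu> / c" using e mu_pos c by simp
  obtain \<delta> where \<delta>: "0 < \<delta>" and small: "\<And>w. norm (w - z) < \<delta> \<Longrightarrow>
      norm (grad_y f w - grad_y f z - (case w - z of (h, k) \<Rightarrow> hess_yx f z *v h + hess_yy f z *v k))
        \<le> e * \<mu> / c * norm (w - z)"
    using deriv_grad_y[of z] e' unfolding has_derivative_at_alt by blast
  show "\<exists>d>0. \<forall>y. norm (y - x) < d \<longrightarrow> norm (y_star f y - y_star f x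
      - - (matrix_inv (hess_yy f (x, y_star f x)) *v (hess_yx f (x, y_star f x) *v (y - x)))) \<le> e * norm (y - x)"
  proof (intro exI[of _ "\<delta> / c"] conjI allI impI)
    show "0 < \<delta> / c" using \<delta> c by simp
    fix x' assume x': "norm (x' - x) < \<delta> / c"
    define w where "w = (x', y_star f x')"
    define h where "h = x' - x"
    define k where "k = y_star f x' - y_star f x"
    have wz: "norm (w - z) \<le> c * norm h"
      unfolding w_def z_def c_def h_def by (rule norm_graph_y_star)
    also have "\<dots> < \<delta>" using x' c by (simp add: h_def field_simps)
    finally have "norm (w - z) < \<delta>" .
    from small[OF this] have "norm (hess_yx f z *v h + hess_yy f z *v k) \<le> e * \<mu> / c * norm (w - z)"
      using norm_minus_cancel[of "hess_yx f z *v h + hess_yy f z *v k"]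
      by (simp add: w_def z_def h_def k_def grad_y_y_star)
    also have "\<dots> \<le> e * \<mu> / c * (c * norm h)" using wz e' by (intro mult_left_mono) auto
    also have "\<dots> = e * \<mu> * norm h" using c by simp
    finally have b: "norm (hess_yx f z *v h + hess_yy f z *v k) \<le> e * \<mu> * norm h" .
    have "k - - (i *v (hess_yx f z *v h)) = i *v (hess_yx f z *v h + hess_yy f z *v k)"
      by (simp add: i_def matrix_vector_right_distrib hess_yy_inv_vec)
    also have "norm \<dots> \<le> norm (hess_yx f z *v h + hess_yy f z *v k) / \<mu>"
      unfolding i_def by (rule norm_hess_yy_inv)
    also have "\<dots> \<le> e * norm h" using b mu_pos by (simp add: pos_divide_le_eq algebra_simps)
    finally show "norm (y_star f x' - y_star f x - - (matrix_inv (hess_yy f (x, y_star f x)) *v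
        (hess_yx f (x, y_star f x) *v (x' - x)))) \<le> e * norm (x' - x)"
      by (simp add: k_def i_def h_def z_def)
  qed
qed

lemma deriv_grad_primal:
  "(grad (primal f) has_derivative (*v) (schur_H f (x, y_star f x))) (at x)"
proof -
  have "((\<lambda>x. (x, y_star f x)) has_derivative (\<lambda>h. (h,
      - (matrix_inv (hess_yy f (x, y_star f x)) *v (hess_yx f (x, y_star f x) *v h))))) (at x)"
    by (intro has_derivative_Pair has_derivative_ident deriv_y_star)
  from has_derivative_compose[OF this deriv_grad_x]
  have "((\<lambda>x. grad_x f (x, y_star f x)) has_derivative (*v) (schur_H f (x, y_star f x))) (at x)"
    by (rule has_derivative_eq_rhs) (auto simp: schur_H_vec linear_neg[OF matrix_vector_mul_linear] fun_eq_iff)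
  then show ?thesis by (simp add: grad_primal[abs_def])
qed

lemma hessian_primal: "hessian (primal f) x = schur_H f (x, y_star f x)"
proof -
  have "(grad (primal f) has_derivative (*v) (hessian (primal f) x)) (at x)"
    unfolding hessian_def using deriv_grad_primal jacobian_works differentiableI by blast
  then have "(*v) (hessian (primal f) x) = (*v) (schur_H f (x, y_star f x))"
    using deriv_grad_primal has_derivative_unique by blast
  then show ?thesis by (simp add: matrix_eq fun_eq_iff)
qed

lemma hessian_primal_lipschitz:
  "norm (hessian (primal f) x *v v - hessian (primal f) x' *v v) \<le> \<rho> * (1 + l / \<mu>) ^ 3 * norm (x - x') * norm v"
proof -
  have c: "0 \<le> \<rho> * (1 + l / \<mu>)\<^sup>2" using rho_pos by simp
  have "norm (hessian (primal f) x *v v - hessian (primal f) x' *v v)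
     \<le> \<rho> * (1 + l / \<mu>)\<^sup>2 * norm ((x, y_star f x) - (x', y_star f x')) * norm v"
    unfolding hessian_primal by (rule schur_H_lipschitz)
  also have "\<dots> \<le> \<rho> * (1 + l / \<mu>)\<^sup>2 * ((1 + l / \<mu>) * norm (x - x')) * norm v"
    using norm_graph_y_star c by (intro mult_right_mono mult_left_mono) auto
  also have "\<dots> = \<rho> * (1 + l / \<mu>) ^ 3 * norm (x - x') * norm v" by (simp add: power2_eq_square power3_eq_cube)
  finally show ?thesis .
qed

lemma grad_primal_line:
  "((\<lambda>\<tau>. grad (primal f) (x + \<tau> *\<^sub>R s)) has_vector_derivative hessian (primal f) (x + \<tau> *\<^sub>R s) *v s) (at \<tau>)"
proof -
  have "((\<lambda>\<tau>. grad (primal f) (x + \<tau> *\<^sub>R s)) has_derivative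
      (\<lambda>t. hessian (primal f) (x + \<tau> *\<^sub>R s) *v (t *\<^sub>R s))) (at \<tau>)"
    unfolding hessian_primal
    by (rule has_derivative_compose[where f = "\<lambda>\<tau>. x + \<tau> *\<^sub>R s" and g = "grad (primal f)"])
      (auto intro!: derivative_eq_intros deriv_grad_primal)
  then show ?thesis by (simp add: has_vector_derivative_def matrix_vector_mult_scaleR)
qed

lemma grad_primal_taylor:
  "norm (grad (primal f) (x + s) - grad (primal f) x - hessian (primal f) x *v s)
     \<le> \<rho> * (1 + l / \<mu>) ^ 3 / 2 * (norm s)\<^sup>2"
proof -
  have "norm (grad (primal f) (x + 1 *\<^sub>R s) - grad (primal f) (x + 0 *\<^sub>R s) - hessian (primal f) x *v s)
      \<le> (\<rho> * (1 + l / \<mu>) ^ 3 * (norm s)\<^sup>2) / (real 1 + 1)"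
  proof (rule vector_derivative_power_remainder_bound[OF grad_primal_line])
    fix \<tau> :: real assume "0 < \<tau>" "\<tau> < 1"
    then show "norm (hessian (primal f) (x + \<tau> *\<^sub>R s) *v s - hessian (primal f) x *v s)
        \<le> \<rho> * (1 + l / \<mu>) ^ 3 * (norm s)\<^sup>2 * \<tau> ^ 1"
      using hessian_primal_lipschitz[of "x + \<tau> *\<^sub>R s" s x] by (simp add: power2_eq_square algebra_simps)
  qed
  then show ?thesis by simp
qed

lemma primal_taylor:
  "primal f (x + s) \<le> primal f x + grad (primal f) x \<bullet> s + 1/2 * (s \<bullet> (hessian (primal f) x *v s))
     + \<rho> * (1 + l / \<mu>) ^ 3 / 6 * norm s ^ 3"
proof -
  define K where "K = \<rho> * (1 + l / \<mu>) ^ 3"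
  define c where "c = s \<bullet> (hessian (primal f) x *v s)"
  \<comment> \<open>Removing the quadratic term beforehand leaves a derivative that deviates from
    its value at 0 by order \<open>\<tau>\<^sup>2\<close>; integration turns \<open>K / 2\<close>
    into \<open>K / 6\<close>.\<close>
  define \<phi> where "\<phi> = (\<lambda>\<tau>. primal f (x + \<tau> *\<^sub>R s) - \<tau>\<^sup>2 / 2 * c)"
  have "norm (\<phi> 1 - \<phi> 0 - s \<bullet> grad (primal f) x) \<le> (K / 2 * norm s ^ 3) / (real 2 + 1)"
  proof (rule vector_derivative_power_remainder_bound)
    fix \<tau> :: real
    have "((\<lambda>\<tau>::real. \<tau>\<^sup>2 / 2 * c) has_real_derivative \<tau> * c) (at \<tau>)"
      by (auto intro!: derivative_eq_intros)
    then have q: "((\<lambda>\<tau>::real. \<tau>\<^sup>2 / 2 * c) has_vector_derivative \<tau> * c) (at \<tau>)"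
      by (simp add: has_real_derivative_iff_has_vector_derivative)
    show "(\<phi> has_vector_derivative (s \<bullet> grad (primal f) (x + \<tau> *\<^sub>R s) - \<tau> * c)) (at \<tau>)"
      unfolding \<phi>_def by (intro has_vector_derivative_diff gderiv_line gderiv_primal_grad q)
  next
    fix \<tau> :: real assume \<tau>: "0 < \<tau>" "\<tau> < 1"
    have "norm (s \<bullet> (grad (primal f) (x + \<tau> *\<^sub>R s) - grad (primal f) x - hessian (primal f) x *v (\<tau> *\<^sub>R s)))
        \<le> norm s * (K / 2 * (norm (\<tau> *\<^sub>R s))\<^sup>2)"
      unfolding real_norm_def
      by (intro order.trans[OF Cauchy_Schwarz_ineq2] mult_left_mono grad_primal_taylor[folded K_def]) auto
    then show "norm (s \<bullet> grad (primal f) (x + \<tau> *\<^sub>R s) - \<tau> * c - s \<bullet> grad (primal f) x)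
        \<le> K / 2 * norm s ^ 3 * \<tau> ^ 2"
      using \<tau> by (simp add: c_def inner_diff_right matrix_vector_mult_scaleR power2_eq_square power3_eq_cube algebra_simps)
  qed
  then have "\<bar>\<phi> 1 - \<phi> 0 - s \<bullet> grad (primal f) x\<bar> \<le> K / 6 * norm s ^ 3" by simp
  moreover have "\<phi> 1 - \<phi> 0 = primal f (x + s) - primal f x - 1/2 * c" by (simp add: \<phi>_def)
  ultimately show ?thesis
    unfolding K_def[symmetric] c_def[symmetric] inner_commute[of "grad (primal f) x"] by linarith
qed

end

section \<open>Iteration complexity\<close>

text \<open>Amortized count: in the invariant \<open>b\<close> counts descent steps and
  \<open>j\<close> the shrinking steps since the last one. A descent step resets \<open>gn\<close>
  to at most \<open>G\<close>, after which \<open>gn\<close> falls below \<open>c\<close> within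
  \<open>k\<close> shrinking steps.\<close>

lemma descent_step_count:
  fixes P gn :: "nat \<Rightarrow> real"
  assumes \<delta>: "0 < \<delta>" and low: "\<And>t. m \<le> P t"
    and step: "\<And>t. t < T \<Longrightarrow> P (Suc t) \<le> P t - \<delta> \<or>
      (P (Suc t) \<le> P t \<and> c \<le> gn t \<and> gn (Suc t) \<le> gn t / 3)"
    and bound: "\<And>t. P t \<le> P 0 \<Longrightarrow> gn t \<le> G"
    and k: "G / 3 ^ k < c"
  shows "real T \<le> real (k + 1) * ((P 0 - m) / \<delta>) + real k" and "\<And>t. t \<le> T \<Longrightarrow> P t \<le> P 0"
proof -
  have inv: "\<exists>b j. t \<le> (k + 1) * b + j \<and> j \<le> k \<and> gn t \<le> G / 3 ^ j \<and> P t \<le> P 0 - real b * \<delta>"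
    if "t \<le> T" for t
    using that
  proof (induction t)
    case 0
    show ?case using bound[of 0] by (intro exI[of _ 0]) simp
  next
    case (Suc t)
    then obtain b j where IH: "t \<le> (k + 1) * b + j" "j \<le> k" "gn t \<le> G / 3 ^ j" "P t \<le> P 0 - real b * \<delta>"
      by auto
    have b0: "0 \<le> real b * \<delta>" using \<delta> by simp
    have "P (Suc t) \<le> P t - \<delta> \<or> (P (Suc t) \<le> P t \<and> c \<le> gn t \<and> gn (Suc t) \<le> gn t / 3)"
      using Suc(2) by (intro step) simp
    then show ?case
    proof
      assume d: "P (Suc t) \<le> P t - \<delta>"
      then have "P (Suc t) \<le> P 0 - real (Suc b) * \<delta>" using IH(4) by (simp add: algebra_simps)
      moreover have "gn (Suc t) \<le> G" using d IH(4) b0 \<delta> by (intro bound) linarith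
      moreover have "Suc t \<le> (k + 1) * Suc b + 0" using IH(1,2) by simp
      ultimately show ?thesis by (intro exI[of _ "Suc b"] exI[of _ 0]) simp
    next
      assume i: "P (Suc t) \<le> P t \<and> c \<le> gn t \<and> gn (Suc t) \<le> gn t / 3"
      then have "j \<noteq> k" using IH(3) k by auto
      moreover have "gn (Suc t) \<le> G / 3 ^ Suc j" using i IH(3) by simp
      ultimately show ?thesis using i IH by (intro exI[of _ b] exI[of _ "Suc j"]) simp
    qed
  qed
  obtain b j where bj: "T \<le> (k + 1) * b + j" "j \<le> k" "P T \<le> P 0 - real b * \<delta>" using inv[of T] by auto
  have "real b * \<delta> \<le> P 0 - m" using bj(3) low[of T] by linarith
  then have "real b \<le> (P 0 - m) / \<delta>" using \<delta> by (simp add: pos_le_divide_eq)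
  then have "real (k + 1) * real b \<le> real (k + 1) * ((P 0 - m) / \<delta>)" by (intro mult_left_mono) auto
  moreover have "real T \<le> real (k + 1) * real b + real k"
    using bj(1,2) by (metis add_left_mono of_nat_add of_nat_le_iff of_nat_mult order.trans)
  ultimately show "real T \<le> real (k + 1) * ((P 0 - m) / \<delta>) + real k" by linarith
  show "P t \<le> P 0" if t: "t \<le> T" for t
  proof -
    obtain b where "P t \<le> P 0 - real b * \<delta>" using inv[OF t] by blast
    moreover have "0 \<le> real b * \<delta>" using \<delta> by simp
    ultimately show ?thesis by linarith
  qed
qed

lemma loewner_le_matI:
  assumes "transpose M = M" "\<And>v. - (c * (norm v)\<^sup>2) \<le> v \<bullet> (M *v v)"
  shows "loewner_le (mat (- c)) M"
  unfolding loewner_le_def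
proof (intro conjI allI)
  show "transpose (M - mat (- c)) = M - mat (- c)"
    using assms(1) by (simp add: transpose_def mat_def vec_eq_iff)
  fix v
  show "0 \<le> v \<bullet> ((M - mat (- c)) *v v)"
    using assms(2)[of v]
    by (simp add: matrix_vector_mult_diff_rdistrib mat_vector_mult inner_diff_right
        inner_add_right power2_norm_eq_inner)
qed

section \<open>The constants of the theorem and estimates that involve no run\<close>

context minimax_problem
begin

definition "kappa = l / \<mu>"
definition "L1 = (kappa + 1) * l"
definition "L2 = \<rho> * (1 + kappa) ^ 3"
definition "LH = \<rho> * (1 + kappa) ^ 2"
text \<open>\<open>tol\<close>, \<open>descent_scale\<close> and \<open>grad_bound\<close> are the
  quantities \<open>A\<close>, \<open>C\<close> and \<open>G\<close> of the theorem.\<close>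

definition "tol \<epsilon> = min (min (1 / 96) (sqrt L2 / (16 * L1)) * \<epsilon> powr (3/2) / l)
  (sqrt L2 / 12 * sqrt \<epsilon> / (2 * LH))"
definition "descent_scale x0 Pstar = (128 * sqrt L2 * (primal f x0 - Pstar)) powr (2/3)"
definition "grad_bound x0 Pstar = max (2 + L1 / (4 * sqrt L2) * sqrt (descent_scale x0 Pstar) + descent_scale x0 Pstar)
  (2 + L1 / (4 * sqrt L2))"

lemma constants_pos: "1 \<le> kappa" "0 < L1" "0 < L2" "0 < LH"
proof -
  show k: "1 \<le> kappa" using kappa_ge_1 by (simp add: kappa_def)
  show "0 < L1" "0 < L2" "0 < LH"
    unfolding L1_def L2_def LH_def using k l_pos rho_pos by auto
qed

lemma tol_pos: "0 < \<epsilon> \<Longrightarrow> 0 < tol \<epsilon>"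
  unfolding tol_def using constants_pos l_pos by (simp add: zero_less_mult_iff)

text \<open>\<open>l * tol \<epsilon>\<close> bounds the gradient error. The two estimates are the
  two branches of the minimum in \<open>\<epsilon>1\<close>, in the form that
  \<open>trust_region_step_cases\<close> asks for.\<close>

lemma l_tol_le: 
  assumes "0 < \<epsilon>"
  shows "l * tol \<epsilon> \<le> sqrt \<epsilon> ^ 3 / 96" "l * tol \<epsilon> * L1 \<le> sqrt L2 * sqrt \<epsilon> ^ 3 / 16"
proof -
  have e: "\<epsilon> powr (3/2) = sqrt \<epsilon> ^ 3"
  proof -
    have "\<epsilon> powr (3/2) = (\<epsilon> powr (1/2)) powr 3" by (simp add: powr_powr)
    then show ?thesis using assms by (simp add: powr_half_sqrt powr_numeral)
  qed
  have "tol \<epsilon> \<le> min (1 / 96) (sqrt L2 / (16 * L1)) * sqrt \<epsilon> ^ 3 / l"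
    unfolding tol_def e by simp
  then have t: "l * tol \<epsilon> \<le> min (1 / 96) (sqrt L2 / (16 * L1)) * sqrt \<epsilon> ^ 3"
    using l_pos by (simp add: pos_le_divide_eq mult.commute)
  also have "\<dots> \<le> 1 / 96 * sqrt \<epsilon> ^ 3" using assms by (intro mult_right_mono) auto
  finally show "l * tol \<epsilon> \<le> sqrt \<epsilon> ^ 3 / 96" by simp
  note t
  also have "min (1 / 96) (sqrt L2 / (16 * L1)) * sqrt \<epsilon> ^ 3 \<le> sqrt L2 / (16 * L1) * sqrt \<epsilon> ^ 3"
    using assms by (intro mult_right_mono) auto
  finally have "l * tol \<epsilon> * L1 \<le> sqrt L2 / (16 * L1) * sqrt \<epsilon> ^ 3 * L1"
    using constants_pos(2) by (intro mult_right_mono) auto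
  then show "l * tol \<epsilon> * L1 \<le> sqrt L2 * sqrt \<epsilon> ^ 3 / 16" using constants_pos(2) by simp
qed

lemma LH_tol_le: "LH * tol \<epsilon> \<le> sqrt L2 * sqrt \<epsilon> / 24"
proof -
  have "LH * tol \<epsilon> \<le> LH * (sqrt L2 / 12 * sqrt \<epsilon> / (2 * LH))"
    unfolding tol_def using constants_pos(4) by (intro mult_left_mono) auto
  then show ?thesis using constants_pos(4) by simp
qed

lemma eventually_tol_less:
  assumes "0 < c"
  shows "eventually (\<lambda>\<epsilon>. tol \<epsilon> < c) (at_right 0)"
proof -
  have "((\<lambda>\<epsilon>. sqrt L2 / 12 * sqrt \<epsilon> / (2 * LH)) \<longlongrightarrow> sqrt L2 / 12 * sqrt 0 / (2 * LH)) (at_right 0)"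
    using constants_pos(4) by (intro tendsto_intros) auto
  then have "eventually (\<lambda>\<epsilon>. sqrt L2 / 12 * sqrt \<epsilon> / (2 * LH) < c) (at_right 0)"
    using assms by (intro order_tendstoD) auto
  then show ?thesis by (rule eventually_mono) (auto simp: tol_def)
qed

lemma grad_bound_ge: "2 \<le> grad_bound x0 Pstar"
  unfolding grad_bound_def using constants_pos by (simp add: le_max_iff_disj)

lemma sqrt_descent_scale_mult:
  assumes "Pstar \<le> primal f x0"
  shows "sqrt (descent_scale x0 Pstar) * descent_scale x0 Pstar = 128 * sqrt L2 * (primal f x0 - Pstar)"
proof -
  define z where "z = 128 * sqrt L2 * (primal f x0 - Pstar)"
  define C where "C = z powr (2/3)"
  have z: "0 \<le> z" using assms constants_pos by (simp add: z_def)
  have "sqrt C * C = z"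
  proof (cases "z = 0")
    case False
    then have "sqrt C * C = C powr (1/2) * C" using z by (simp add: powr_half_sqrt C_def)
    also have "\<dots> = z powr (1/3 + 2/3)" by (simp only: C_def powr_powr powr_add) simp
    also have "\<dots> = z" using False z by simp
    finally show ?thesis .
  qed (simp add: C_def)
  then show ?thesis by (simp add: descent_scale_def C_def z_def)
qed

text \<open>AM-GM applied to the two summands of the bound: their product is
  \<open>32 L\<^sub>1 (P x\<^sub>0 - Pstar)\<close>, which dominates the squared gradient norm.\<close>

lemma norm_grad_primal_le:
  assumes low: "\<And>x. Pstar \<le> primal f x" and x: "primal f x \<le> primal f x0"
  shows "8 * norm (grad (primal f) x) \<le> grad_bound x0 Pstar - 2"
proof -
  define C where "C = descent_scale x0 Pstar"
  define a where "a = L1 / (4 * sqrt L2) * sqrt C"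
  have C: "0 \<le> C" by (simp add: C_def descent_scale_def)
  have a: "0 \<le> a" using C constants_pos by (simp add: a_def)
  have "a * C = L1 / (4 * sqrt L2) * (sqrt C * C)" by (simp add: a_def)
  also have "\<dots> = 32 * L1 * (primal f x0 - Pstar)"
    unfolding C_def sqrt_descent_scale_mult[OF low] using constants_pos by simp
  finally have aC: "a * C = 32 * L1 * (primal f x0 - Pstar)" .
  have "(norm (grad (primal f) x))\<^sup>2 \<le> 2 * L1 * (primal f x - Pstar)"
    using grad_primal_lipschitz constants_pos low
    by (intro lipschitz_gradient_norm_bound gderiv_primal_grad) (auto simp: L1_def kappa_def)
  also have "\<dots> \<le> 2 * L1 * (primal f x0 - Pstar)" using x constants_pos by simp
  \<comment> \<open>The factor 8 comes from
    \<open>8\<^sup>2 * 2 * L1 = 4 * (32 * L1)\<close>.\<close>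
  finally have "(8 * norm (grad (primal f) x))\<^sup>2 \<le> 4 * (a * C)" unfolding aC by (simp add: power_mult_distrib)
  also have "\<dots> \<le> (a + C)\<^sup>2"
    using zero_le_power2[of "a - C"] by (simp add: power2_eq_square algebra_simps)
  finally have "8 * norm (grad (primal f) x) \<le> a + C" by (rule power2_le_imp_le) (use a C in simp)
  also have "\<dots> \<le> grad_bound x0 Pstar - 2"
    unfolding grad_bound_def C_def[symmetric] a_def[symmetric] by simp
  finally show ?thesis .
qed

lemma norm_grad_primal_eq_0:
  assumes "\<And>x. primal f x0 \<le> primal f x"
  shows "grad (primal f) x0 = 0"
proof -
  have "(norm (grad (primal f) x0))\<^sup>2 \<le> 2 * L1 * (primal f x0 - primal f x0)"
    using grad_primal_lipschitz constants_pos assms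
    by (intro lipschitz_gradient_norm_bound gderiv_primal_grad) (auto simp: L1_def kappa_def)
  then show ?thesis by simp
qed

lemma powr_minus_three_halves: "0 < \<epsilon> \<Longrightarrow> \<epsilon> powr (- 3 / 2) = 1 / sqrt \<epsilon> ^ 3"
proof -
  assume e: "0 < \<epsilon>"
  have "\<epsilon> powr (- 3 / 2) = 1 / (\<epsilon> powr (1/2)) powr 3" by (simp add: powr_powr powr_minus_divide)
  then show ?thesis using e by (simp add: powr_half_sqrt powr_numeral)
qed

text \<open>The ceiling in the iteration bound is negative for large \<open>\<epsilon>\<close>.\<close>

lemma iteration_bound_nonneg:
  assumes low: "Pstar \<le> primal f x0" and eps: "0 < \<epsilon>"
  shows "0 \<le> 128 * (of_int \<lceil>ln (grad_bound x0 Pstar / \<epsilon>) / ln 3\<rceil> + 1) * sqrt L2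
    * (primal f x0 - Pstar) * \<epsilon> powr (- 3 / 2) + 1"
proof -
  define G where "G = grad_bound x0 Pstar"
  define w where "w = sqrt \<epsilon>"
  define p where "p = sqrt G / w"
  define K where "K = real_of_int \<lceil>ln (G / \<epsilon>) / ln 3\<rceil>"
  define z where "z = 128 * sqrt L2 * (primal f x0 - Pstar)"
  have w: "0 < w" "\<epsilon> = w\<^sup>2" using eps by (auto simp: w_def)
  have G: "2 \<le> G" unfolding G_def by (rule grad_bound_ge)
  have p: "0 < p" "p\<^sup>2 = G / \<epsilon>" using G w by (auto simp: p_def power_divide)
  have z: "0 \<le> z" using low constants_pos by (simp add: z_def)
  \<comment> \<open>\<open>z\<close> is the power 3/2 of \<open>descent_scale x0 Pstar\<close>,
    which is at most \<open>G\<close>.\<close>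
  have zw: "z / w ^ 3 \<le> p ^ 3"
  proof -
    have C: "0 \<le> descent_scale x0 Pstar" "descent_scale x0 Pstar \<le> G"
    proof -
      show C0: "0 \<le> descent_scale x0 Pstar" by (simp add: descent_scale_def)
      have "0 \<le> L1 / (4 * sqrt L2) * sqrt (descent_scale x0 Pstar)" using C0 constants_pos by simp
      then show "descent_scale x0 Pstar \<le> G" unfolding G_def grad_bound_def by linarith
    qed
    have "z \<le> sqrt G * G"
      unfolding z_def sqrt_descent_scale_mult[OF low, symmetric] using C by (intro mult_mono) auto
    also have "\<dots> = sqrt G ^ 3" using G by (simp add: power3_eq_cube)
    finally show ?thesis using w by (simp add: p_def power_divide divide_right_mono)
  qed
  have z0: "0 \<le> z / w ^ 3" using z w by simp
  have "0 \<le> (K + 1) * (z / w ^ 3) + 1"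
  proof (cases "0 \<le> K + 1")
    case False
    have "ln (G / \<epsilon>) / ln 3 \<le> K" by (simp add: K_def)
    then have neg: "ln (G / \<epsilon>) / ln 3 < 0" using False by linarith
    then have ln0: "ln (G / \<epsilon>) < 0" by (simp add: divide_less_0_iff)
    have ln3: "1 \<le> ln (3::real)" using ln_ge_iff[of 3 1] exp_le by simp
    \<comment> \<open>Since \<open>ln 3 \<ge> 1\<close>, omitting the division lowers a negative
      logarithm. Then \<open>- (K + 1)\<close> is at most \<open>1 / p\<^sup>2\<close>, and
      multiplied by \<open>p ^ 3\<close> this is \<open>p \<le> 1\<close>.\<close>
    have "ln (G / \<epsilon>) * ln 3 \<le> ln (G / \<epsilon>) * 1" using ln0 ln3 by (intro mult_left_mono_neg) auto
    then have "ln (G / \<epsilon>) \<le> ln (G / \<epsilon>) / ln 3"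
      using ln3 ln0 by (simp add: pos_le_divide_eq)
    then have "- (K + 1) \<le> - ln (p\<^sup>2)" using \<open>ln (G / \<epsilon>) / ln 3 \<le> K\<close> unfolding p(2) by linarith
    also have "\<dots> = ln (1 / p\<^sup>2)" using p by (simp add: ln_div)
    also have "\<dots> \<le> 1 / p\<^sup>2"
    proof -
      have "0 < 1 / p\<^sup>2" using p(1) by simp
      from ln_le_minus_one[OF this] show ?thesis by linarith
    qed
    finally have "- (K + 1) * (z / w ^ 3) \<le> 1 / p\<^sup>2 * (z / w ^ 3)" using z0 by (rule mult_right_mono)
    also have "\<dots> \<le> 1 / p\<^sup>2 * p ^ 3" using zw by (intro mult_left_mono) auto
    also have "\<dots> = p" using p(1) by (simp add: power2_eq_square power3_eq_cube)
    also have "p \<le> 1"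
    proof -
      have "0 < G / \<epsilon>" using G eps by simp
      then have "p\<^sup>2 < 1" using ln0 unfolding p(2) by (simp only: ln_less_zero_iff)
      then show ?thesis using p(1) power_less_one_iff[of p 2] by simp
    qed
    finally show ?thesis by (simp only: mult_minus_left)
  next
    case True
    show ?thesis using mult_nonneg_nonneg[OF True z0] by linarith
  qed
  then have "0 \<le> 128 * (K + 1) * sqrt L2 * (primal f x0 - Pstar) * (1 / w ^ 3) + 1"
  proof -
    have "128 * k * a * d * (1 / v) = k * (128 * a * d / v)" for k a d v :: real by simp
    then show ?thesis using \<open>0 \<le> (K + 1) * (z / w ^ 3) + 1\<close> unfolding z_def by metis
  qed
  then show ?thesis unfolding powr_minus_three_halves[OF eps] K_def G_def w_def .
qed

text \<open>The logarithm grows at most like \<open>\<epsilon> powr (- 1 / 2)\<close>, because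
  \<open>ln (p\<^sup>2) \<le> 2 * p\<close>. This absorbs the last run of shrinking steps, which no
  descent step pays for, into the \<open>+ 1\<close> next to the ceiling.\<close>

lemma log_ratio_le:
  assumes low: "Pstar \<le> primal f x0" and eps: "0 < \<epsilon>"
    and small: "\<epsilon> * (2 * sqrt (grad_bound x0 Pstar)) \<le> 128 * sqrt L2 * (primal f x0 - Pstar)"
  shows "ln (grad_bound x0 Pstar / \<epsilon>) / ln 3 \<le> 128 * sqrt L2 * (primal f x0 - Pstar) * \<epsilon> powr (- 3 / 2)"
proof -
  define G where "G = grad_bound x0 Pstar"
  define w where "w = sqrt \<epsilon>"
  define p where "p = sqrt G / w"
  have w: "0 < w" "\<epsilon> = w\<^sup>2" using eps by (auto simp: w_def)
  have G: "2 \<le> G" unfolding G_def by (rule grad_bound_ge)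
  have p: "0 < p" "G / \<epsilon> = p\<^sup>2" using G w by (auto simp: p_def power_divide)
  have "ln (G / \<epsilon>) \<le> 2 * p"
    unfolding p(2) using p(1) ln_le_minus_one[of p] by (simp add: ln_realpow)
  moreover have "1 \<le> ln (3::real)" using ln_ge_iff[of 3 1] exp_le by simp
  ultimately have "ln (G / \<epsilon>) / ln 3 \<le> 2 * p"
    using p(1) by (smt (verit) divide_le_eq_1 mult_le_cancel_left1 pos_divide_le_eq)
  also have "\<dots> = \<epsilon> * (2 * sqrt G) / w ^ 3" using w by (simp add: p_def power2_eq_square power3_eq_cube)
  also have "\<dots> \<le> 128 * sqrt L2 * (primal f x0 - Pstar) / w ^ 3"
    using small w(1) unfolding G_def by (intro divide_right_mono) auto
  finally show ?thesis unfolding powr_minus_three_halves[OF eps] by (simp add: G_def w_def)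
qed

lemma approx_second_order_large_eps:
  assumes "norm (grad (primal f) x) \<le> \<xi> * \<epsilon>" "L1 \<le> \<theta> * sqrt \<epsilon>"
  shows "approx_second_order (primal f) \<xi> \<theta> \<epsilon> x"
  unfolding approx_second_order_def
proof (intro conjI loewner_le_matI assms)
  show "transpose (hessian (primal f) x) = hessian (primal f) x"
    unfolding hessian_primal by (rule schur_H_symmetric)
  fix v
  have "- (v \<bullet> (hessian (primal f) x *v v)) \<le> norm v * norm (hessian (primal f) x *v v)"
    by (metis inner_minus_left norm_cauchy_schwarz norm_minus_cancel)
  also have "\<dots> \<le> norm v * (L1 * norm v)"
    using norm_schur_H unfolding hessian_primal L1_def kappa_def by (intro mult_left_mono) auto
  also have "\<dots> \<le> norm v * (\<theta> * sqrt \<epsilon> * norm v)"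
    using assms(2) by (intro mult_left_mono mult_right_mono) auto
  finally show "- (\<theta> * sqrt \<epsilon> * (norm v)\<^sup>2) \<le> v \<bullet> (hessian (primal f) x *v v)"
    by (simp add: power2_eq_square algebra_simps)
qed

end

section \<open>The iterates of a run\<close>

locale grtr_iterates = minimax_problem f \<mu> l \<rho>
  for f :: "(real^'n) \<times> (real^'m) \<Rightarrow> real" and \<mu> l \<rho> :: real +
  fixes x0 :: "real^'n" and yinit :: "real^'m" and \<epsilon> :: real
    and N :: "nat \<Rightarrow> nat" and x :: "nat \<Rightarrow> real^'n" and y :: "nat \<Rightarrow> real^'m" and s :: "nat \<Rightarrow> real^'n"
  assumes eps_pos: "0 < \<epsilon>"
    and run: "grtr_run f x0 yinit (1 / l) ((sqrt kappa - 1) / (sqrt kappa + 1))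
      (sqrt L2 / 2) (1 / (4 * sqrt L2)) \<epsilon> N x y s"
    and budget_0: "2 * sqrt kappa * ln (sqrt (kappa + 1) * norm (yinit - y_star f x0) / tol \<epsilon>) \<le> real (N 0)"
    and budget_Suc: "\<And>t. 2 * sqrt kappa * ln (sqrt (kappa + 1) * (tol \<epsilon> + kappa * norm (s t)) / tol \<epsilon>)
      \<le> real (N (Suc t))"
begin

lemma x_0: "x 0 = x0" and x_Suc: "x (Suc t) = x t + s t"
  using run by (auto simp: grtr_run_def)

lemma y_0: "y 0 = fst (nag f (1 / l) ((sqrt kappa - 1) / (sqrt kappa + 1)) (x 0) yinit (N 0))"
  using run unfolding grtr_run_def by (metis (no_types, lifting) nat.case(1))

lemma y_Suc: "y (Suc t) = fst (nag f (1 / l) ((sqrt kappa - 1) / (sqrt kappa + 1)) (x (Suc t)) (y t) (N (Suc t)))"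
  using run unfolding grtr_run_def by (metis (no_types, lifting) nat.case(2))

lemma trust_region_solution:
  "is_arg_min (\<lambda>d. grad_x f (x t, y t) \<bullet> d + 1/2 * (d \<bullet> ((schur_H f (x t, y t)
      + mat (sqrt L2 / 2 * sqrt (norm (grad_x f (x t, y t))))) *v d)))
    (\<lambda>d. norm d \<le> 1 / (4 * sqrt L2) * max (sqrt (norm (grad_x f (x t, y t)))) (sqrt \<epsilon>)) (s t)"
  using run unfolding grtr_run_def Let_def by blast

text \<open>Warm start: \<open>y t\<close> is within \<open>tol \<epsilon>\<close> of the old
  maximizer, and the maximizer moves by at most \<open>kappa * norm (s t)\<close>. The budget is
  expressed through this bound \<open>D\<close> because the true distance is unknown.\<close>

lemma inner_loop_accuracy: "norm (y t - y_star f (x t)) \<le> tol \<epsilon>"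
proof (induction t)
  case 0
  show ?case
    unfolding y_0 unfolding kappa_def
    by (rule nag_linear_rate[OF concave_y smooth_y mu_pos mu_le_l grad_y_y_star _ tol_pos[OF eps_pos]])
      (use budget_0 in \<open>simp add: kappa_def x_0\<close>)
next
  case (Suc t)
  define D where "D = tol \<epsilon> + kappa * norm (s t)"
  have tol: "0 < tol \<epsilon>" by (rule tol_pos[OF eps_pos])
  have D: "norm (y t - y_star f (x (Suc t))) \<le> D"
  proof -
    have "norm (y_star f (x t) - y_star f (x (Suc t))) \<le> kappa * norm (s t)"
      using y_star_lipschitz[of "x t" "x (Suc t)"] by (simp add: x_Suc kappa_def)
    then show ?thesis
      using Suc norm_triangle_ineq[of "y t - y_star f (x t)" "y_star f (x t) - y_star f (x (Suc t))"]
      by (simp add: D_def)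
  qed
  have D0: "0 < D" using tol constants_pos(1) by (simp add: D_def add_pos_nonneg)
  have "2 * sqrt kappa * ln (sqrt (kappa + 1) * norm (y t - y_star f (x (Suc t))) / tol \<epsilon>) \<le> real (N (Suc t))"
  proof (cases "y t = y_star f (x (Suc t))")
    case False
    have "ln (sqrt (kappa + 1) * norm (y t - y_star f (x (Suc t))) / tol \<epsilon>)
        \<le> ln (sqrt (kappa + 1) * D / tol \<epsilon>)"
      using False D D0 tol constants_pos(1)
      by (intro ln_mono divide_right_mono mult_left_mono) auto
    then have "2 * sqrt kappa * ln (sqrt (kappa + 1) * norm (y t - y_star f (x (Suc t))) / tol \<epsilon>)
        \<le> 2 * sqrt kappa * ln (sqrt (kappa + 1) * D / tol \<epsilon>)"
      using constants_pos(1) by (intro mult_left_mono) auto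
    then show ?thesis using budget_Suc[of t] by (simp add: D_def)
  qed simp
  then show ?case
    unfolding y_Suc unfolding kappa_def
    by (intro nag_linear_rate[OF concave_y smooth_y mu_pos mu_le_l grad_y_y_star _ tol])
qed

lemma gradient_error: "norm (grad_x f (x t, y t) - grad (primal f) (x t)) \<le> l * tol \<epsilon>"
proof -
  have "norm (grad_x f (x t, y t) - grad (primal f) (x t)) \<le> l * norm (y t - y_star f (x t))"
    unfolding grad_primal using grad_x_lipschitz[of "(x t, y t)" "(x t, y_star f (x t))"] by simp
  also have "\<dots> \<le> l * tol \<epsilon>" using l_pos inner_loop_accuracy by (intro mult_left_mono) auto
  finally show ?thesis .
qed

lemma hessian_error:
  "norm (schur_H f (x t, y t) *v v - hessian (primal f) (x t) *v v) \<le> sqrt L2 * sqrt \<epsilon> / 24 * norm v"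
proof -
  have "norm (schur_H f (x t, y t) *v v - hessian (primal f) (x t) *v v)
      \<le> LH * norm (y t - y_star f (x t)) * norm v"
    unfolding hessian_primal LH_def kappa_def
    using schur_H_lipschitz[of "(x t, y t)" v "(x t, y_star f (x t))"] by simp
  also have "\<dots> \<le> LH * tol \<epsilon> * norm v"
    using constants_pos(4) inner_loop_accuracy by (intro mult_right_mono mult_left_mono) auto
  also have "\<dots> \<le> sqrt L2 * sqrt \<epsilon> / 24 * norm v" using LH_tol_le by (intro mult_right_mono) auto
  finally show ?thesis .
qed

text \<open>The thresholds leave room for inexactness: \<open>3 * \<epsilon>\<close> plus the
  gradient error stays below \<open>4 * \<epsilon>\<close>, and \<open>2 + 1/24 \<le> 3\<close>
  accounts for the Hessian error.\<close>

lemma step_cases: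
  assumes "\<epsilon> \<le> 1" "4 \<le> \<xi>" "3 * sqrt L2 \<le> \<theta>"
  shows "approx_second_order (primal f) \<xi> \<theta> \<epsilon> (x t)
    \<or> primal f (x (Suc t)) \<le> primal f (x t) - sqrt \<epsilon> ^ 3 / (128 * sqrt L2)
    \<or> (primal f (x (Suc t)) \<le> primal f (x t) \<and> 3 * \<epsilon> \<le> norm (grad_x f (x t, y t))
        \<and> norm (grad_x f (x (Suc t), y (Suc t))) \<le> norm (grad_x f (x t, y t)) / 3)"
proof -
  define b where "b = sqrt L2"
  define w where "w = sqrt \<epsilon>"
  define g where "g = grad_x f (x t, y t)"
  define H where "H = schur_H f (x t, y t)"
  define HP where "HP = hessian (primal f) (x t)"
  have b: "0 < b" "b\<^sup>2 = L2" using constants_pos(3) by (auto simp: b_def)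
  have w: "0 < w" "w \<le> 1" "w\<^sup>2 = \<epsilon>" using eps_pos assms(1) by (auto simp: w_def)
  have e1: "norm (g - grad (primal f) (x t)) \<le> l * tol \<epsilon>" by (simp add: g_def gradient_error)
  have herr: "norm (H *v v - HP *v v) \<le> b * w / 24 * norm v" for v
    unfolding H_def HP_def b_def w_def by (rule hessian_error)
  have "(norm g < 3 * w\<^sup>2 \<and> (\<forall>v. - (2 * b * w * (norm v)\<^sup>2) \<le> v \<bullet> (H *v v)))
    \<or> primal f (x (Suc t)) \<le> primal f (x t) - w ^ 3 / (128 * b)
    \<or> (primal f (x (Suc t)) \<le> primal f (x t) \<and> 3 * w\<^sup>2 \<le> norm g
        \<and> norm (grad_x f (x (Suc t), y (Suc t))) \<le> norm g / 3)"
  proof (rule trust_region_step_cases[OF b(1) constants_pos(2) w(1,2) _ _ refl _ e1 gradient_error _ _ herr])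
    show "transpose H = H" unfolding H_def by (rule schur_H_symmetric)
    show "norm (H *v v) \<le> L1 * norm v" for v
      unfolding H_def L1_def kappa_def by (rule norm_schur_H)
    show "is_arg_min (\<lambda>d. g \<bullet> d + 1/2 * (d \<bullet> ((H + mat (b / 2 * sqrt (norm g))) *v d)))
       (\<lambda>d. norm d \<le> 1 / (4 * b) * max (sqrt (norm g)) w) (s t)"
      unfolding g_def H_def b_def w_def by (rule trust_region_solution)
    show "l * tol \<epsilon> \<le> w ^ 3 / 96" "l * tol \<epsilon> * L1 \<le> b * w ^ 3 / 16"
      unfolding w_def b_def by (rule l_tol_le[OF eps_pos])+
    show "primal f (x (Suc t)) \<le> primal f (x t) + grad (primal f) (x t) \<bullet> s t
        + 1/2 * (s t \<bullet> (HP *v s t)) + b\<^sup>2 / 6 * norm (s t) ^ 3"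
      unfolding b(2) x_Suc HP_def L2_def kappa_def by (rule primal_taylor)
    show "norm (grad (primal f) (x (Suc t)) - grad (primal f) (x t) - HP *v s t) \<le> b\<^sup>2 / 2 * (norm (s t))\<^sup>2"
      unfolding b(2) x_Suc HP_def L2_def kappa_def by (rule grad_primal_taylor)
  qed
  moreover have "approx_second_order (primal f) \<xi> \<theta> \<epsilon> (x t)"
    if st: "norm g < 3 * w\<^sup>2" "\<forall>v. - (2 * b * w * (norm v)\<^sup>2) \<le> v \<bullet> (H *v v)"
    unfolding approx_second_order_def
  proof (intro conjI loewner_le_matI)
    have "w ^ 3 \<le> w\<^sup>2" using w(1,2) power_decreasing[of 2 3 w] by simp
    then have "l * tol \<epsilon> \<le> \<epsilon>" using l_tol_le(1)[OF eps_pos] w eps_pos unfolding w_def by linarith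
    moreover have "norm (grad (primal f) (x t)) \<le> norm g + norm (g - grad (primal f) (x t))"
      using norm_triangle_ineq4[of g "g - grad (primal f) (x t)"] by simp
    moreover have "4 * \<epsilon> \<le> \<xi> * \<epsilon>" using assms(2) eps_pos by simp
    ultimately show "norm (grad (primal f) (x t)) \<le> \<xi> * \<epsilon>" using st(1) e1 w(3) by linarith
    show "transpose (hessian (primal f) (x t)) = hessian (primal f) (x t)"
      unfolding hessian_primal by (rule schur_H_symmetric)
    fix v
    have "v \<bullet> (H *v v - HP *v v) \<le> norm v * norm (H *v v - HP *v v)" by (rule norm_cauchy_schwarz)
    also have "\<dots> \<le> norm v * (b * w / 24 * norm v)" using herr by (intro mult_left_mono) auto
    finally have "v \<bullet> (H *v v) - v \<bullet> (HP *v v) \<le> b * w / 24 * (norm v)\<^sup>2"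
      by (simp add: inner_diff_right power2_eq_square algebra_simps)
    moreover have "- (2 * b * w * (norm v)\<^sup>2) \<le> v \<bullet> (H *v v)" using st(2) by blast
    moreover have "3 * b * w * (norm v)\<^sup>2 \<le> \<theta> * w * (norm v)\<^sup>2"
      using assms(3) w by (intro mult_right_mono) (auto simp: b_def)
    moreover have "0 \<le> b * w * (norm v)\<^sup>2" using b w by simp
    ultimately show "- (\<theta> * sqrt \<epsilon> * (norm v)\<^sup>2) \<le> v \<bullet> (hessian (primal f) (x t) *v v)"
      unfolding w_def[symmetric] HP_def[symmetric] by argo
  qed
  ultimately show ?thesis unfolding w(3) unfolding b_def w_def g_def by blast
qed

text \<open>The 2 set aside in \<open>grad_bound\<close> pays for the gradient error.\<close>

lemma gradient_norm_le:
  assumes low: "\<And>x. Pstar \<le> primal f x" and t: "primal f (x t) \<le> primal f x0" and eps: "\<epsilon> \<le> 1"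
  shows "norm (grad_x f (x t, y t)) \<le> grad_bound x0 Pstar / 8"
proof -
  have "sqrt \<epsilon> ^ 3 \<le> 1" using eps eps_pos by (simp add: power_le_one)
  then have "l * tol \<epsilon> \<le> 1 / 96" using l_tol_le(1)[OF eps_pos] by linarith
  moreover have "norm (grad_x f (x t, y t))
      \<le> norm (grad (primal f) (x t)) + norm (grad_x f (x t, y t) - grad (primal f) (x t))"
    using norm_triangle_ineq[of "grad (primal f) (x t)" "grad_x f (x t, y t) - grad (primal f) (x t)"] by simp
  ultimately show ?thesis using gradient_error[of t] norm_grad_primal_le[OF low t] by linarith
qed

lemma step_norm_le:
  assumes low: "\<And>x. Pstar \<le> primal f x" and t: "primal f (x t) \<le> primal f x0" and eps: "\<epsilon> \<le> 1 / 4"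
  shows "norm (s t) \<le> 1 / (4 * sqrt L2) * sqrt (grad_bound x0 Pstar / 8)"
proof -
  have "norm (s t) \<le> 1 / (4 * sqrt L2) * max (sqrt (norm (grad_x f (x t, y t)))) (sqrt \<epsilon>)"
    using trust_region_solution[of t] by (simp add: is_arg_min_def)
  \<comment> \<open>\<open>\<epsilon> \<le> 1 / 4\<close> and
    \<open>2 \<le> grad_bound x0 Pstar\<close> ensure that the other branch
    \<open>sqrt \<epsilon>\<close> of the maximum obeys the bound as well.\<close>
  also have "\<dots> \<le> 1 / (4 * sqrt L2) * sqrt (grad_bound x0 Pstar / 8)"
    using gradient_norm_le[OF low t] eps grad_bound_ge[of x0 Pstar] constants_pos(3)
    by (intro mult_left_mono) auto
  finally show ?thesis .
qed

text \<open>Covers \<open>primal f x0 = Pstar\<close>, where no positive \<open>\<epsilon>\<close>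
  is small relative to \<open>primal f x0 - Pstar\<close>. Descent is impossible and the exact
  gradient is 0, which rules out the other alternatives of \<open>step_cases\<close>.\<close>

lemma stationary_if_minimal:
  assumes min: "\<And>x. primal f x0 \<le> primal f x" and "\<epsilon> \<le> 1" "4 \<le> \<xi>" "3 * sqrt L2 \<le> \<theta>"
  shows "approx_second_order (primal f) \<xi> \<theta> \<epsilon> (x 0)"
proof -
  have "sqrt \<epsilon> ^ 3 \<le> (sqrt \<epsilon>)\<^sup>2" using assms(2) eps_pos by (intro power_decreasing) auto
  then have "l * tol \<epsilon> < 3 * \<epsilon>" using l_tol_le(1)[OF eps_pos] eps_pos by simp
  then have "norm (grad_x f (x 0, y 0)) < 3 * \<epsilon>"
    using gradient_error[of 0] norm_grad_primal_eq_0[OF min] by (simp add: x_0)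
  moreover have "0 < sqrt \<epsilon> ^ 3 / (128 * sqrt L2)" using eps_pos constants_pos(3) by simp
  ultimately show ?thesis
    using step_cases[OF assms(2-4), of 0] min[of "x (Suc 0)"] by (auto simp: x_0)
qed

text \<open>Speaks of any initial segment of nonstationary iterates, so it proves that a stationary
  one exists as well as bounding the first.\<close>

lemma nonstationary_bound:
  assumes low: "\<And>x. Pstar \<le> primal f x" and eps: "\<epsilon> \<le> 1 / 4" and \<xi>: "4 \<le> \<xi>" and \<theta>: "3 * sqrt L2 \<le> \<theta>"
    and nonstat: "\<And>t. t < T \<Longrightarrow> \<not> approx_second_order (primal f) \<xi> \<theta> \<epsilon> (x t)"
    and K: "K = real_of_int \<lceil>ln (grad_bound x0 Pstar / \<epsilon>) / ln 3\<rceil>"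
  shows "real T \<le> K * (128 * sqrt L2 * (primal f x0 - Pstar) * \<epsilon> powr (- 3 / 2)) + (K - 1)"
    and "\<And>t. t \<le> T \<Longrightarrow> primal f (x t) \<le> primal f x0"
proof -
  define G where "G = grad_bound x0 Pstar"
  have G: "2 \<le> G" unfolding G_def by (rule grad_bound_ge)
  \<comment> \<open>The threshold is \<open>3 * \<epsilon>\<close>, so one shrinking step fewer than
    the ceiling is enough; strictness comes from \<open>G / 8 < G\<close>. The ceiling is at least
    1, hence \<open>nat\<close> does not truncate.\<close>
  define k where "k = nat (\<lceil>ln (G / \<epsilon>) / ln 3\<rceil> - 1)"
  have "8 \<le> G / \<epsilon>"
  proof -
    have "8 * \<epsilon> \<le> G" using eps G by linarith
    then show ?thesis using eps_pos by (simp add: pos_le_divide_eq)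
  qed
  then have "0 < ln (G / \<epsilon>) / ln 3" by simp
  then have "1 \<le> \<lceil>ln (G / \<epsilon>) / ln 3\<rceil>" by linarith
  then have k: "real k = K - 1" by (simp add: k_def K G_def)
  have eps1: "\<epsilon> \<le> 1" using eps by simp
  have \<delta>: "0 < sqrt \<epsilon> ^ 3 / (128 * sqrt L2)" using eps_pos constants_pos(3) by simp
  have step: "primal f (x (Suc t)) \<le> primal f (x t) - sqrt \<epsilon> ^ 3 / (128 * sqrt L2) \<or>
      (primal f (x (Suc t)) \<le> primal f (x t) \<and> 3 * \<epsilon> \<le> norm (grad_x f (x t, y t)) \<and>
       norm (grad_x f (x (Suc t), y (Suc t))) \<le> norm (grad_x f (x t, y t)) / 3)" if "t < T" for t
    using step_cases[OF eps1 \<xi> \<theta>, of t] nonstat[OF that] by blast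
  have bound: "norm (grad_x f (x t, y t)) \<le> G / 8" if "primal f (x t) \<le> primal f (x 0)" for t
    using gradient_norm_le[OF low _ eps1] that by (simp add: x_0 G_def)
  have kc: "G / 8 / 3 ^ k < 3 * \<epsilon>"
  proof -
    have "ln (G / \<epsilon>) / ln 3 \<le> real k + 1" unfolding k using K by (simp add: G_def)
    then have "ln (G / \<epsilon>) \<le> real (Suc k) * ln 3" by (simp add: pos_divide_le_eq add.commute)
    also have "\<dots> = ln (3 ^ Suc k)" by (simp add: ln_realpow del: power_Suc)
    finally have "G / \<epsilon> \<le> 3 ^ Suc k"
      using G eps_pos by (subst (asm) ln_le_cancel_iff) (auto simp del: power_Suc)
    then have "G \<le> 3 * \<epsilon> * 3 ^ k" using eps_pos by (simp add: pos_divide_le_eq algebra_simps)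
    moreover have "G / 8 < G" using G by simp
    ultimately have "G / 8 < 3 * \<epsilon> * 3 ^ k" by linarith
    then show ?thesis by (simp add: pos_divide_less_eq)
  qed
  note count = descent_step_count[where P = "\<lambda>t. primal f (x t)" and gn = "\<lambda>t. norm (grad_x f (x t, y t))"
      and T = T and m = Pstar, OF \<delta> low step bound kc]
  have "real T \<le> real (k + 1) * ((primal f (x 0) - Pstar) / (sqrt \<epsilon> ^ 3 / (128 * sqrt L2))) + real k"
    by (rule count(1))
  moreover have "(primal f (x 0) - Pstar) / (sqrt \<epsilon> ^ 3 / (128 * sqrt L2))
      = 128 * sqrt L2 * (primal f x0 - Pstar) * \<epsilon> powr (- 3 / 2)"
    unfolding powr_minus_three_halves[OF eps_pos] by (simp add: x_0)
  moreover have "real (k + 1) = K" using k by simp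
  ultimately show "real T \<le> K * (128 * sqrt L2 * (primal f x0 - Pstar) * \<epsilon> powr (- 3 / 2)) + (K - 1)"
    by (simp only: k)
  show "primal f (x t) \<le> primal f x0" if "t \<le> T" for t
    using count(2)[OF _ _ that] by (simp add: x_0)
qed

end

text \<open>0.3536 lies just above \<open>1 / sqrt 8\<close> and 2.72 just above
  \<open>exp 1\<close>; their product is below 0.962. The remaining 0.038 of \<open>S\<close> covers
  1.72 times \<open>a\<close>, as \<open>a \<le> S / 50\<close>.\<close>

lemma log_slack:
  fixes a S n c :: real
  assumes "0 < a" "50 * a \<le> S" "0 \<le> n" "n \<le> 0.3536 * S" "0 < c"
  shows "ln (c * (a + n) / a) + 1 \<le> ln (c * (a + S) / a)"
proof -
  have "exp 1 * (a + n) \<le> 272 / 100 * (a + 0.3536 * S)"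
    using e_less_272 assms by (intro mult_mono) auto
  also have "\<dots> \<le> a + S" using assms by simp
  finally have "c / a * (exp 1 * (a + n)) \<le> c / a * (a + S)" using assms by (intro mult_left_mono) auto
  moreover have "c / a * (exp 1 * (a + n)) = exp 1 * (c * (a + n) / a)" "c / a * (a + S) = c * (a + S) / a"
    by simp_all
  ultimately have le: "exp 1 * (c * (a + n) / a) \<le> c * (a + S) / a" by (simp only:)
  have pos: "0 < c * (a + n) / a" using assms by simp
  have "ln (c * (a + n) / a) + 1 = ln (exp 1 * (c * (a + n) / a))" using pos by (subst ln_mult) auto
  also have "\<dots> \<le> ln (c * (a + S) / a)" by (intro ln_mono le mult_pos_pos exp_gt_zero pos)
  finally show ?thesis .
qed

text \<open>Lower bounds on \<open>N t\<close> alone cannot limit the total, so it is bounded twice: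
  with the excess over the required counts added, and literally when each count is the rounded
  requirement. For \<open>T = 0\<close> no later step could pay for rounding \<open>N 0\<close>,
  hence \<open>1 \<le> T\<close> there.\<close>

theorem theorem2p1:
  fixes f :: "(real^'n) \<times> (real^'m) \<Rightarrow> real"
    and x0 :: "real^'n" and yinit :: "real^'m"
    and \<mu> l \<rho> Pstar :: real
  defines "\<kappa> \<equiv> l / \<mu>"
  defines "L1 \<equiv> (\<kappa> + 1) * l"
    and "L2 \<equiv> \<rho> * (1 + \<kappa>) ^ 3"
    and "LH \<equiv> \<rho> * (1 + \<kappa>) ^ 2"
  defines "\<sigma> \<equiv> sqrt L2 / 2"
    and "r \<equiv> 1 / (4 * sqrt L2)"
  defines "\<epsilon>1 \<equiv> (\<lambda>\<epsilon>. min (1 / 96) (sqrt L2 / (16 * L1)) * \<epsilon> powr (3/2))"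
    and "\<epsilon>2 \<equiv> (\<lambda>\<epsilon>. sqrt L2 / 12 * sqrt \<epsilon>)"
  defines "A \<equiv> (\<lambda>\<epsilon>. min (\<epsilon>1 \<epsilon> / l) (\<epsilon>2 \<epsilon> / (2 * LH)))"
  defines "N_req \<equiv> (\<lambda>\<epsilon> s t. case t of
      0 \<Rightarrow> 2 * sqrt \<kappa> * ln (sqrt (\<kappa> + 1) * norm (yinit - y_star f x0) / A \<epsilon>)
    | Suc t' \<Rightarrow> 2 * sqrt \<kappa> * ln (sqrt (\<kappa> + 1) * (A \<epsilon> + \<kappa> * norm (s t' :: real^'n)) / A \<epsilon>))"
  defines "C \<equiv> (128 * sqrt L2 * (primal f x0 - Pstar)) powr (2/3)"
  defines "G \<equiv> max (2 + L1 / (4 * sqrt L2) * sqrt C + C) (2 + L1 / (4 * sqrt L2))"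
  defines "N_bound \<equiv> (\<lambda>\<epsilon> T.
      2 * sqrt \<kappa> * ln (sqrt (\<kappa> + 1) * norm (yinit - y_star f x0) / A \<epsilon>)
      + 2 * sqrt \<kappa> * real T * ln (sqrt (\<kappa> + 1) * (A \<epsilon> + \<kappa> * r * sqrt G) / A \<epsilon>))"
  assumes "\<mu> > 0" and "\<rho> > 0"
    and "\<forall>z. f differentiable (at z)" and "continuous_on UNIV (grad f)"
    and "\<forall>x. strongly_concave \<mu> (\<lambda>y. f (x, y))"
    and "l-lipschitz_on UNIV (grad f)"
    and "hess_blocks_exist f"
    and "spectral_lipschitz \<rho> (hess_xx f)" and "spectral_lipschitz \<rho> (hess_xy f)"
    and "spectral_lipschitz \<rho> (hess_yx f)" and "spectral_lipschitz \<rho> (hess_yy f)"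
    and "\<forall>x. Pstar \<le> primal f x"
  shows "\<exists>\<xi>>0. \<exists>\<theta>>0. \<forall>\<epsilon>>0. \<forall>N x y s.
    grtr_run f x0 yinit (1 / l) ((sqrt \<kappa> - 1) / (sqrt \<kappa> + 1)) \<sigma> r \<epsilon> N x y s \<longrightarrow>
    (\<forall>t. N_req \<epsilon> s t \<le> real (N t)) \<longrightarrow>
    (let stat = (\<lambda>t. approx_second_order (primal f) \<xi> \<theta> \<epsilon> (x t));
         T = (LEAST t. stat t)
     in (\<exists>t. stat t) \<and>
        real T \<le> 128 * (of_int \<lceil>ln (G / \<epsilon>) / ln 3\<rceil> + 1) * sqrt L2 * (primal f x0 - Pstar)
                    * \<epsilon> powr (-3/2) + 1 \<and>
        (\<Sum>t=0..T. real (N t)) \<le> N_bound \<epsilon> T + (\<Sum>t=0..T. real (N t) - N_req \<epsilon> s t) \<and>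
        ((\<forall>t\<le>T. N t = nat \<lceil>N_req \<epsilon> s t\<rceil>) \<and> 1 \<le> T \<longrightarrow>
           (\<Sum>t=0..T. real (N t)) \<le> N_bound \<epsilon> T))"
proof -
  interpret mp: minimax_problem f \<mu> l \<rho> by unfold_locales (use assms in auto)
  have low: "\<And>x. Pstar \<le> primal f x" using \<open>\<forall>x. Pstar \<le> primal f x\<close> by blast
  have \<kappa>: "\<kappa> = mp.kappa" unfolding \<kappa>_def mp.kappa_def ..
  have L1: "L1 = mp.L1" unfolding L1_def mp.L1_def \<kappa> ..
  have L2: "L2 = mp.L2" unfolding L2_def mp.L2_def \<kappa> ..
  have LH: "LH = mp.LH" unfolding LH_def mp.LH_def \<kappa> ..
  have A: "A = mp.tol"
    unfolding A_def \<epsilon>1_def \<epsilon>2_def L1 L2 LH by (simp add: fun_eq_iff mp.tol_def)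
  have G: "G = mp.grad_bound x0 Pstar"
    unfolding G_def C_def L1 L2 mp.grad_bound_def mp.descent_scale_def ..
  have G2: "2 \<le> G" unfolding G by (rule mp.grad_bound_ge)
  have \<kappa>1: "1 \<le> \<kappa>" unfolding \<kappa> by (rule mp.constants_pos)
  have L2pos: "0 < L2" unfolding L2 by (rule mp.constants_pos)
  have L1pos: "0 < L1" unfolding L1 by (rule mp.constants_pos)
  define D where "D = 128 * sqrt L2 * (primal f x0 - Pstar)"
  have D: "0 \<le> D" using low[of x0] L2pos by (simp add: D_def)
  define S where "S = \<kappa> * r * sqrt G"
  have r: "0 < r" using L2pos by (simp add: r_def)
  have S: "0 < S" using \<kappa>1 r G2 by (simp add: S_def)
  define d0 where "d0 = sqrt (\<kappa> + 1) * norm (yinit - y_star f x0)"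
  have d0: "0 < d0 \<or> yinit = y_star f x0" using \<kappa>1 by (auto simp: d0_def)
  \<comment> \<open>\<open>S / 50\<close> is what \<open>log_slack\<close> needs; a tolerance below
    \<open>d0\<close> makes the first requirement nonnegative.\<close>
  have "0 < min (S / 50) (if 0 < d0 then d0 else 1)" using S by simp
  from mp.eventually_tol_less[OF this] obtain e1 where e1: "0 < e1" "\<And>\<epsilon>. 0 < \<epsilon> \<Longrightarrow> \<epsilon> < e1 \<Longrightarrow> A \<epsilon> < min (S / 50) (if 0 < d0 then d0 else 1)"
    unfolding eventually_at_right[OF zero_less_one] A by blast
  \<comment> \<open>\<open>1 / 4\<close> serves the step length bound and
    \<open>D / (2 * sqrt G)\<close> serves \<open>log_ratio_le\<close>; for \<open>D = 0\<close> the
    point \<open>x0\<close> is a minimizer, which is treated separately.\<close>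
  define e0 where "e0 = min (min (1 / 4) e1) (if 0 < D then D / (2 * sqrt G) else 1)"
  have e0: "0 < e0" using e1(1) G2 by (simp add: e0_def)
  define \<xi> where "\<xi> = 4 + norm (grad (primal f) x0) / e0"
  define \<theta> where "\<theta> = 3 * sqrt L2 + L1 / sqrt e0"
  have \<xi>4: "4 \<le> \<xi>" using e0 by (simp add: \<xi>_def)
  then have \<xi>pos: "0 < \<xi>" by simp
  have \<theta>3: "3 * sqrt mp.L2 \<le> \<theta>" using e0 L1pos by (simp add: \<theta>_def flip: L2)
  have \<theta>pos: "0 < \<theta>" using L2pos L1pos e0 by (simp add: \<theta>_def add_pos_pos)
  show ?thesis
  proof (rule exI[of _ \<xi>], rule conjI[OF \<xi>pos], rule exI[of _ \<theta>], rule conjI[OF \<theta>pos], intro allI impI)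
    fix \<epsilon> :: real and N x y s
    assume \<epsilon>: "0 < \<epsilon>"
      and run: "grtr_run f x0 yinit (1 / l) ((sqrt \<kappa> - 1) / (sqrt \<kappa> + 1)) \<sigma> r \<epsilon> N x y s"
      and budget: "\<forall>t. N_req \<epsilon> s t \<le> real (N t)"
    define stat where "stat = (\<lambda>t. approx_second_order (primal f) \<xi> \<theta> \<epsilon> (x t))"
    define T where "T = (LEAST t. stat t)"
    define Q where "Q = (\<lambda>n. 2 * sqrt \<kappa> * ln (sqrt (\<kappa> + 1) * (A \<epsilon> + n) / A \<epsilon>))"
    have req_0: "N_req \<epsilon> s 0 = 2 * sqrt \<kappa> * ln (d0 / A \<epsilon>)"
      by (simp add: N_req_def d0_def)
    have req_Suc: "N_req \<epsilon> s (Suc t) = Q (\<kappa> * norm (s t))" for t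
      by (simp add: N_req_def Q_def)
    have N_bound: "N_bound \<epsilon> n = N_req \<epsilon> s 0 + real n * Q S" for n
      by (simp add: N_bound_def req_0 Q_def S_def d0_def)
    interpret it: grtr_iterates f \<mu> l \<rho> x0 yinit \<epsilon> N x y s
    proof unfold_locales
      show "0 < \<epsilon>" by (rule \<epsilon>)
      show "grtr_run f x0 yinit (1 / l) ((sqrt mp.kappa - 1) / (sqrt mp.kappa + 1))
          (sqrt mp.L2 / 2) (1 / (4 * sqrt mp.L2)) \<epsilon> N x y s"
        using run unfolding \<sigma>_def r_def \<kappa> L2 .
      show "2 * sqrt mp.kappa * ln (sqrt (mp.kappa + 1) * norm (yinit - y_star f x0) / mp.tol \<epsilon>) \<le> real (N 0)"
        using budget[rule_format, of 0] unfolding req_0 d0_def \<kappa> A .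
      show "2 * sqrt mp.kappa * ln (sqrt (mp.kappa + 1) * (mp.tol \<epsilon> + mp.kappa * norm (s t)) / mp.tol \<epsilon>)
          \<le> real (N (Suc t))" for t
        using budget[rule_format, of "Suc t"] unfolding req_Suc Q_def \<kappa> A .
    qed
    have A0: "0 < A \<epsilon>" unfolding A by (rule mp.tol_pos[OF \<epsilon>])
    have stat_large: "stat 0" if "e0 \<le> \<epsilon>"
    proof -
      have "norm (grad (primal f) x0) \<le> norm (grad (primal f) x0) / e0 * \<epsilon>"
        using that e0 by (simp add: pos_le_divide_eq mult_left_mono)
      also have "\<dots> \<le> \<xi> * \<epsilon>" using \<epsilon> by (intro mult_right_mono) (auto simp: \<xi>_def)
      finally have "norm (grad (primal f) x0) \<le> \<xi> * \<epsilon>" .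
      moreover have "mp.L1 \<le> \<theta> * sqrt \<epsilon>"
      proof -
        have "L1 \<le> L1 / sqrt e0 * sqrt \<epsilon>"
          using that e0 L1pos by (simp add: pos_le_divide_eq mult_left_mono)
        also have "\<dots> \<le> \<theta> * sqrt \<epsilon>" using \<epsilon> L2pos by (intro mult_right_mono) (auto simp: \<theta>_def)
        finally show ?thesis unfolding L1 .
      qed
      ultimately show ?thesis unfolding stat_def it.x_0 by (rule mp.approx_second_order_large_eps)
    qed
    define B where "B = D * \<epsilon> powr (- 3 / 2)"
    define K where "K = real_of_int \<lceil>ln (G / \<epsilon>) / ln 3\<rceil>"
    have B: "0 \<le> B" using D by (simp add: B_def)
    \<comment> \<open>Stated for every initial segment, since the existence of a stationary iterate,
      and with it the meaning of \<open>T\<close>, is derived from it.\<close>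
    have before: "real n \<le> K * B + (K - 1)" "\<And>t. t \<le> n \<Longrightarrow> primal f (x t) \<le> primal f x0"
      if "\<epsilon> < e0" "\<And>t. t < n \<Longrightarrow> \<not> stat t" for n
    proof -
      have "\<epsilon> \<le> 1 / 4" using that(1) by (simp add: e0_def)
      note nb = it.nonstationary_bound[OF low this \<xi>4 \<theta>3 that(2)[unfolded stat_def] K_def[unfolded G]]
      show "real n \<le> K * B + (K - 1)" using nb(1) unfolding B_def D_def L2 by simp
      show "primal f (x t) \<le> primal f x0" if "t \<le> n" for t using nb(2)[OF _ that] by simp
    qed
    have ex: "\<exists>t. stat t"
    proof (rule ccontr)
      assume none: "\<nexists>t. stat t"
      then have "\<epsilon> < e0" using stat_large by force
      moreover obtain n where "K * B + (K - 1) < real n" using reals_Archimedean2 by blast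
      ultimately show False using before(1)[of n] none by auto
    qed
    have nonstat: "\<not> stat t" if "t < T" for t using that not_less_Least unfolding T_def by blast
    have small: "\<epsilon> < e0" if "1 \<le> T"
      using stat_large nonstat[of 0] that by force
    have bound: "real T \<le> 128 * (of_int \<lceil>ln (G / \<epsilon>) / ln 3\<rceil> + 1) * sqrt L2 * (primal f x0 - Pstar)
        * \<epsilon> powr (-3/2) + 1"
    proof (cases "T = 0")
      case True
      then show ?thesis
        using mp.iteration_bound_nonneg[OF low \<epsilon>] unfolding G L2 by simp
    next
      case False
      then have sm: "\<epsilon> < e0" using small by simp
      have "D \<noteq> 0"
      proof
        assume "D = 0"
        then have "primal f x0 = Pstar" using L2pos by (simp add: D_def)
        then have "stat 0"
          unfolding stat_def using sm low \<xi>4 \<theta>3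
          by (intro it.stationary_if_minimal) (auto simp: e0_def)
        then show False using nonstat[of 0] False by simp
      qed
      then have "\<epsilon> * (2 * sqrt G) \<le> D" using sm D G2 by (simp add: e0_def pos_less_divide_eq)
      then have "ln (G / \<epsilon>) / ln 3 \<le> B"
        using mp.log_ratio_le[OF low \<epsilon>] unfolding G B_def D_def L2 by simp
      then have "K \<le> B + 1" unfolding K_def by linarith
      moreover have "real T \<le> K * B + (K - 1)" using sm nonstat by (rule before(1))
      ultimately have "real T \<le> (K + 1) * B + 1" using B by (simp add: algebra_simps)
      then show ?thesis by (simp add: K_def B_def D_def algebra_simps)
    qed
    have s_le: "\<kappa> * norm (s t) \<le> 0.3536 * S" if t: "t < T" for t
    proof -
      have sm: "\<epsilon> < e0" using small t by simp
      then have "norm (s t) \<le> 1 / (4 * sqrt mp.L2) * sqrt (mp.grad_bound x0 Pstar / 8)"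
        using before(2)[OF sm nonstat, of T t] t
        by (intro it.step_norm_le[OF low]) (auto simp: e0_def)
      then have "norm (s t) \<le> r * sqrt (G / 8)" by (simp add: r_def G L2)
      also have "\<dots> \<le> r * (0.3536 * sqrt G)"
      proof (intro mult_left_mono)
        have "sqrt (G / 8) \<le> sqrt ((0.3536)\<^sup>2 * G)" using G2 by (simp add: power2_eq_square)
        also have "\<dots> = 0.3536 * sqrt G" by (simp add: real_sqrt_mult)
        finally show "sqrt (G / 8) \<le> 0.3536 * sqrt G" .
      qed (use r in simp)
      finally have "\<kappa> * norm (s t) \<le> \<kappa> * (r * (0.3536 * sqrt G))" using \<kappa>1 by (intro mult_left_mono) auto
      then show ?thesis by (simp add: S_def algebra_simps)
    qed
    text \<open>The step lengths stay below \<open>r sqrt (G / 8)\<close>; the factor \<open>sqrt 8 > exp 1\<close> gained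
      over the stated bound pays for rounding the inner iteration counts.\<close>
    have Q_le: "Q (\<kappa> * norm (s t)) + 2 \<le> Q S" if t: "t < T" for t
    proof -
      have "\<epsilon> < e0" using small t by simp
      then have "50 * A \<epsilon> \<le> S" using e1(2)[OF \<epsilon>] by (simp add: e0_def)
      then have "ln (sqrt (\<kappa> + 1) * (A \<epsilon> + \<kappa> * norm (s t)) / A \<epsilon>) + 1 \<le> ln (sqrt (\<kappa> + 1) * (A \<epsilon> + S) / A \<epsilon>)"
        using A0 s_le[OF t] \<kappa>1 by (intro log_slack) auto
      then have "2 * sqrt \<kappa> * (ln (sqrt (\<kappa> + 1) * (A \<epsilon> + \<kappa> * norm (s t)) / A \<epsilon>) + 1) \<le> Q S"
        unfolding Q_def using \<kappa>1 by (intro mult_left_mono) auto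
      then have "Q (\<kappa> * norm (s t)) + 2 * sqrt \<kappa> \<le> Q S" by (simp only: Q_def distrib_left mult_1_right)
      moreover have "2 \<le> 2 * sqrt \<kappa>" using \<kappa>1 by simp
      ultimately show ?thesis by linarith
    qed
    have split: "(\<Sum>t=0..T. h t) = h 0 + (\<Sum>t<T. h (Suc t))" for h :: "nat \<Rightarrow> real"
      unfolding atLeast0AtMost by (rule sum.atMost_shift)
    have sum_req: "(\<Sum>t=0..T. N_req \<epsilon> s t) \<le> N_bound \<epsilon> T"
    proof -
      have "(\<Sum>t<T. N_req \<epsilon> s (Suc t)) \<le> (\<Sum>t<T. Q S)"
        unfolding req_Suc using Q_le by (intro sum_mono) force
      then show ?thesis unfolding split N_bound by simp
    qed
    have sum_N: "(\<Sum>t=0..T. real (N t)) \<le> N_bound \<epsilon> T"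
      if exact: "\<forall>t\<le>T. N t = nat \<lceil>N_req \<epsilon> s t\<rceil>" and T1: "1 \<le> T"
    proof -
      \<comment> \<open>Rounding costs at most 1 only for nonnegative requirements, because
        \<open>nat\<close> lifts negative ceilings to 0.\<close>
      have ceil: "real (nat \<lceil>u\<rceil>) \<le> u + 1" if "0 \<le> u" for u :: real using that by linarith
      have req0: "0 \<le> N_req \<epsilon> s 0"
      proof (cases "0 < d0")
        case True
        have "A \<epsilon> < d0" using e1(2)[OF \<epsilon>] small[OF T1] True by (simp add: e0_def)
        then show ?thesis unfolding req_0 using A0 \<kappa>1 by simp
      qed (use d0 in \<open>simp add: req_0 d0_def\<close>)
      have reqS: "0 \<le> N_req \<epsilon> s (Suc t)" for t
      proof -
        have "1 * 1 \<le> sqrt (\<kappa> + 1) * ((A \<epsilon> + \<kappa> * norm (s t)) / A \<epsilon>)"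
          using \<kappa>1 A0 by (intro mult_mono) (auto simp: pos_le_divide_eq)
        then show ?thesis unfolding req_Suc Q_def using \<kappa>1 by simp
      qed
      \<comment> \<open>\<open>Q_le\<close> gains 2 per step and rounding costs 1, so every step
        saves 1; with \<open>1 \<le> T\<close> this pays for rounding \<open>N 0\<close>.\<close>
      have "(\<Sum>t<T. real (N (Suc t))) \<le> (\<Sum>t<T. Q S - 1)"
      proof (rule sum_mono)
        fix t assume "t \<in> {..<T}"
        then have t: "t < T" by simp
        then show "real (N (Suc t)) \<le> Q S - 1"
          using exact ceil[OF reqS, of t] Q_le[OF t] by (simp add: req_Suc)
      qed
      moreover have "real (N 0) \<le> N_req \<epsilon> s 0 + 1" using exact ceil[OF req0] by simp
      ultimately show ?thesis unfolding split N_bound using T1 by (simp add: algebra_simps)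
    qed
    show "let stat = (\<lambda>t. approx_second_order (primal f) \<xi> \<theta> \<epsilon> (x t)); T = (LEAST t. stat t)
      in (\<exists>t. stat t) \<and>
        real T \<le> 128 * (of_int \<lceil>ln (G / \<epsilon>) / ln 3\<rceil> + 1) * sqrt L2 * (primal f x0 - Pstar)
                    * \<epsilon> powr (-3/2) + 1 \<and>
        (\<Sum>t=0..T. real (N t)) \<le> N_bound \<epsilon> T + (\<Sum>t=0..T. real (N t) - N_req \<epsilon> s t) \<and>
        ((\<forall>t\<le>T. N t = nat \<lceil>N_req \<epsilon> s t\<rceil>) \<and> 1 \<le> T \<longrightarrow>
           (\<Sum>t=0..T. real (N t)) \<le> N_bound \<epsilon> T)"
      unfolding Let_def stat_def[symmetric] T_def[symmetric]
    proof (intro conjI impI)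
      show "(\<Sum>t=0..T. real (N t)) \<le> N_bound \<epsilon> T + (\<Sum>t=0..T. real (N t) - N_req \<epsilon> s t)"
        using sum_req by (simp only: sum_subtractf)
    qed (use ex bound sum_N in blast)+
  qed
qed

end
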